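(* Suppose $(u,\theta)$ is a smooth solution, with sufficient decay near (spatial) infinity, of the Boussinesq system $$\partial_t u+u\cdot\nabla u+\nabla P=\Delta u+\theta e_3,\quad \operatorname{div}u=0,\quad \partial_t\theta+u\cdot\nabla\theta=\Delta\theta\quad\text{on }(0,\infty)\times\mathbb{R}^3,$$ with initial data $u(0,\cdot)=u_0$, $\theta(0,\cdot)=\theta_0$, $\operatorname{div}u_0=0$. Then the following solution integration formula holds: $$u(t,x)=e^{t\Delta}u_0+te^{t\Delta}\mathbb{P}(\theta_0e_3)-\int_0^te^{(t-s)\Delta}\mathbb{P}\nabla\cdot(u\otimes u)(s)\,ds-\int_0^t(t-s)e^{(t-s)\Delta}\mathbb{P}\nabla\cdot(\theta e_3\otimes u)(s)\,ds,$$ $$\theta(t,x)=e^{t\Delta}\theta_0-\int_0^te^{(t-s)\Delta}\nabla\cdot(\theta u)(s)\,ds.$$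
   Context: Here $u:\mathbb{R}^+\times\mathbb{R}^3\to\mathbb{R}^3$, $P,\theta:\mathbb{R}^+\times\mathbb{R}^3\to\mathbb{R}$, $e_3=(0,0,1)^T$. $e^{t\Delta}$ is the heat semigroup on $\mathbb{R}^3$, and $\mathbb{P}$ is the Leray projector onto divergence-free vector fields (Fourier symbol $\delta_{jk}-\xi_j\xi_k/|\xi|^2$). The expression $\nabla\cdot(\theta e_3\otimes u)$ denotes the vector field $(\nabla\cdot(\theta u))\,e_3$, and $\nabla\cdot(u\otimes u)$ the vector field with components $\sum_h\partial_h(u_hu_k)$. "Sufficient decay near infinity" is the paper's wording: enough spatial decay of $u,\theta,P$ that the equations can be Fourier transformed in $x$ and treated frequency by frequency. *)

theory Defs
  imports "HOL-Analysis.Analysis"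
begin

section \<open>Smoothness and spatial differential operators\<close>

text \<open>Meant for open \<open>S\<close>; all directional derivatives of order at most \<open>n\<close> exist and are
  continuous.\<close>

primrec Ck_on ::
  "nat \<Rightarrow> 'a::euclidean_space set \<Rightarrow> ('a \<Rightarrow> 'b::real_normed_vector) \<Rightarrow> bool" where
  "Ck_on 0 S f \<longleftrightarrow> continuous_on S f"
| "Ck_on (Suc n) S f \<longleftrightarrow>
     (\<forall>x\<in>S. f differentiable (at x)) \<and> (\<forall>v. Ck_on n S (\<lambda>x. frechet_derivative f (at x) v))"

definition smooth_on ::
  "'a::euclidean_space set \<Rightarrow> ('a \<Rightarrow> 'b::real_normed_vector) \<Rightarrow> bool" where
  "smooth_on S f \<longleftrightarrow> (\<forall>n. Ck_on n S f)"

definition partial :: "3 \<Rightarrow> (real^3 \<Rightarrow> 'b::real_normed_vector) \<Rightarrow> real^3 \<Rightarrow> 'b" where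
  "partial i f x = frechet_derivative f (at x) (axis i 1)"

definition grad :: "(real^3 \<Rightarrow> real) \<Rightarrow> real^3 \<Rightarrow> real^3" where
  "grad f x = (\<chi> i. partial i f x)"

definition divergence :: "(real^3 \<Rightarrow> real^3) \<Rightarrow> real^3 \<Rightarrow> real" where
  "divergence v x = (\<Sum>i\<in>UNIV. partial i (\<lambda>y. v y $ i) x)"

definition laplacian :: "(real^3 \<Rightarrow> 'b::real_normed_vector) \<Rightarrow> real^3 \<Rightarrow> 'b" where
  "laplacian f x = (\<Sum>i\<in>UNIV. partial i (partial i f) x)"

definition advect ::
  "(real^3 \<Rightarrow> real^3) \<Rightarrow> (real^3 \<Rightarrow> 'b::real_normed_vector) \<Rightarrow> real^3 \<Rightarrow> 'b" where
  "advect v f x = (\<Sum>i\<in>UNIV. (v x $ i) *\<^sub>R partial i f x)"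

definition tensor :: "real^3 \<Rightarrow> real^3 \<Rightarrow> real^3^3" where
  "tensor v w = (\<chi> k h. v $ k * w $ h)"

text \<open>The divergence acts on the second index, so that
  \<open>\<nabla> \<cdot> (\<theta> e\<^sub>3 \<otimes> u) = (\<nabla> \<cdot> (\<theta> u)) e\<^sub>3\<close>.\<close>

definition tensor_div :: "(real^3 \<Rightarrow> real^3^3) \<Rightarrow> real^3 \<Rightarrow> real^3" where
  "tensor_div T x = (\<chi> k. \<Sum>h\<in>UNIV. partial h (\<lambda>y. T y $ k $ h) x)"

abbreviation e3 :: "real^3" where
  "e3 \<equiv> axis 3 1"


section \<open>Heat semigroup and Leray projector\<close>

text \<open>The semigroup is given by convolution with the Gauss kernel, which makes sense for all bounded
  continuous functions; the velocity need not be integrable over space.\<close>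

definition heat ::
  "real \<Rightarrow> (real^3 \<Rightarrow> 'b::{banach, second_countable_topology}) \<Rightarrow> real^3 \<Rightarrow> 'b" where
  "heat t f x =
     (if t = 0 then f x
      else \<integral>y. ((4 * pi * t) powr (-3/2) * exp (- (norm (x - y))\<^sup>2 / (4 * t))) *\<^sub>R f y \<partial>lborel)"

definition fourier :: "(real^3 \<Rightarrow> complex) \<Rightarrow> real^3 \<Rightarrow> complex" where
  "fourier f \<xi> = (\<integral>x. cis (- (\<xi> \<bullet> x)) * f x \<partial>lborel)"

definition inv_fourier :: "(real^3 \<Rightarrow> complex) \<Rightarrow> real^3 \<Rightarrow> complex" where
  "inv_fourier g x = (1 / (2 * pi) ^ 3) *\<^sub>R (\<integral>\<xi>. cis (\<xi> \<bullet> x) * g \<xi> \<partial>lborel)"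

text \<open>At \<open>\<xi> = 0\<close> the symbol is undefined mathematically; here division by zero gives the identity
  matrix there, on a null set.\<close>

definition leray_symbol :: "real^3 \<Rightarrow> real^3^3" where
  "leray_symbol \<xi> = (\<chi> j k. (if j = k then 1 else 0) - \<xi> $ j * \<xi> $ k / (norm \<xi>)\<^sup>2)"

text \<open>Meaningful for fields \<open>F\<close> such that \<open>F\<close> and its Fourier transform are both integrable.
  The symbol is real and even, so the inverse transform is real for a real field \<open>F\<close> and
  \<open>Re\<close> only changes the type.\<close>

definition leray :: "(real^3 \<Rightarrow> real^3) \<Rightarrow> real^3 \<Rightarrow> real^3" where
  "leray F x =
     (\<chi> j. Re (inv_fourier
        (\<lambda>\<xi>. \<Sum>k\<in>UNIV. of_real (leray_symbol \<xi> $ j $ k) * fourier (\<lambda>y. of_real (F y $ k)) \<xi>) x))"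


section \<open>Solutions of the Boussinesq system\<close>

text \<open>The pressure is determined only up to a function of time, so it is merely required to be
  smooth in space.\<close>

definition smooth_boussinesq_solution ::
  "(real \<Rightarrow> real^3 \<Rightarrow> real^3) \<Rightarrow> (real \<Rightarrow> real^3 \<Rightarrow> real) \<Rightarrow> (real \<Rightarrow> real^3 \<Rightarrow> real) \<Rightarrow> bool" where
  "smooth_boussinesq_solution u \<theta> p \<longleftrightarrow>
     smooth_on ({0<..} \<times> UNIV) (\<lambda>(t, x). u t x) \<and>
     smooth_on ({0<..} \<times> UNIV) (\<lambda>(t, x). \<theta> t x) \<and>
     (\<forall>t>0. smooth_on UNIV (p t)) \<and>
     continuous_on ({0..} \<times> UNIV) (\<lambda>(t, x). u t x) \<and>
     continuous_on ({0..} \<times> UNIV) (\<lambda>(t, x). \<theta> t x) \<and>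
     (\<forall>t>0. \<forall>x.
        vector_derivative (\<lambda>s. u s x) (at t) + advect (u t) (u t) x + grad (p t) x
          = laplacian (u t) x + \<theta> t x *\<^sub>R e3 \<and>
        divergence (u t) x = 0 \<and>
        vector_derivative (\<lambda>s. \<theta> s x) (at t) + advect (u t) (\<theta> t) x = laplacian (\<theta> t) x)"

text \<open>All spatial derivatives, of order zero included, are \<open>O((1 + |x|)\<^sup>-\<^sup>r)\<close>, uniformly on bounded
  time intervals and up to the initial time.\<close>

definition spatial_decay ::
  "real \<Rightarrow> (real \<Rightarrow> real^3 \<Rightarrow> 'b::real_normed_vector) \<Rightarrow> bool" where
  "spatial_decay r f \<longleftrightarrow>
     (\<forall>t\<ge>0. smooth_on UNIV (f t)) \<and>
     (\<forall>ks T. \<exists>C. \<forall>t\<in>{0..T}. \<forall>x. norm (foldr partial ks (f t) x) \<le> C * (1 + norm x) powr (- r))"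

text \<open>The thresholds are the integrability exponents in dimension three: \<open>\<theta>\<close> and \<open>u \<otimes> u\<close>, with their
  derivatives, are integrable. Requiring \<open>u\<close> itself to be integrable, or rapidly decreasing, would be
  too strong: as soon as \<open>\<theta>\<^sub>0\<close> has nonzero mean, \<open>u(t, x)\<close> decays only like \<open>|x|\<^sup>-\<^sup>3\<close>. The pressure
  enters the equations through its gradient only.\<close>

definition sufficient_decay ::
  "(real \<Rightarrow> real^3 \<Rightarrow> real^3) \<Rightarrow> (real \<Rightarrow> real^3 \<Rightarrow> real) \<Rightarrow> (real \<Rightarrow> real^3 \<Rightarrow> real) \<Rightarrow> bool" where
  "sufficient_decay u \<theta> p \<longleftrightarrow>
     (\<exists>a>3/2. spatial_decay a u) \<and>
     (\<exists>b>3. spatial_decay b \<theta>) \<and>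
     (\<forall>t>0. (grad (p t) \<longlongrightarrow> 0) at_infinity)"

end

theory Submission
  imports Defs "HOL-Probability.Characteristic_Functions"
begin

text \<open>
  The formula is Duhamel's principle. Along a solution the derivative of \<open>heat (t - s) (u s) x\<close> in \<open>s\<close>
  is the heat flow of \<open>\<partial>\<^sub>t u - \<Delta> u\<close>, and integrating it from \<open>0\<close> to \<open>t\<close> expresses \<open>u t x\<close> by the initial
  value and by the forcing. For the temperature this is all: the forcing is \<open>- \<nabla> \<cdot> (\<theta> u)\<close>
  (\<open>temperature_formula\<close>). For the velocity three points need an argument.

  The first is the pressure. Write \<open>F = \<theta> e3 - \<nabla> \<cdot> (u \<otimes> u)\<close>. The divergence of the momentum equation
  gives \<open>\<Delta> p = div F\<close>. All derivatives of \<open>F\<close> decay at an integrable rate, so that \<open>F\<close> has a rapidly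
  decreasing Fourier transform and \<open>leray F\<close> has its usual meaning. The components of \<open>\<nabla> p\<close> and of
  \<open>F - leray F\<close> have equal Laplacians and vanish at infinity, so they agree by the maximum principle
  (\<open>leray_eq_minus_grad\<close>); hence \<open>\<partial>\<^sub>t u - \<Delta> u = leray F\<close> (\<open>leray_forcing\<close>).

  The second is that \<open>u\<close> may fail to be integrable over space and therefore cannot be Fourier
  transformed as a function. Its heat flow is differentiated in physical space instead: the flow is the
  average of \<open>u s (x - sqrt (t - s) *\<^sub>R z)\<close> against a fixed Gaussian in \<open>z\<close>, and a Gaussian integration
  by parts turns the derivative of the square root into the Laplacian (\<open>heat_duhamel_derivative\<close>). Only
  integrable fields are treated frequency by frequency.

  The third is the buoyancy: Duhamel's principle produces the integral of the heat flow of
  \<open>leray (\<theta> e3)\<close>, in which the temperature would have to be replaced by its own formula. Rather than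
  exchanging iterated time integrals, consider \<open>(t - s)\<close> times this flow. Its derivative is minus the
  unwanted integrand, minus \<open>(t - s)\<close> times the heat flow of \<open>leray (\<nabla> \<cdot> (\<theta> u) e3)\<close>
  (\<open>heat_leray_duhamel_derivative\<close>). The sum of the two differentiated quantities has the integrands of
  the formula as its derivative and the initial terms of the formula as its value at \<open>s = 0\<close>
  (\<open>velocity_formula\<close>).
\<close>

section \<open>Integration tools\<close>

lemma lborel_integral_affine:
  fixes f :: "'a::euclidean_space \<Rightarrow> 'b::{banach, second_countable_topology}"
  assumes c: "c \<noteq> 0" and [measurable]: "f \<in> borel_measurable borel"
  shows "(\<integral>x. f x \<partial>lborel) = \<bar>c\<bar> ^ DIM('a) *\<^sub>R (\<integral>x. f (t + c *\<^sub>R x) \<partial>lborel)"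
  by (subst lborel_affine[OF c, of t]) (simp add: integral_density integral_distr)

lemma lborel_integrable_affine:
  fixes f :: "'a::euclidean_space \<Rightarrow> 'b::{banach, second_countable_topology}"
  assumes c: "c \<noteq> 0" and f: "integrable lborel f"
  shows "integrable lborel (\<lambda>x. f (t + c *\<^sub>R x))"
proof -
  have [measurable]: "f \<in> borel_measurable borel"
    using f by auto
  have "integrable (density (distr lborel borel (\<lambda>x. t + c *\<^sub>R x)) (\<lambda>_. ennreal (\<bar>c\<bar> ^ DIM('a)))) f"
    using f lborel_affine[OF c, of t] by simp
  then have "integrable (distr lborel borel (\<lambda>x. t + c *\<^sub>R x)) (\<lambda>x. \<bar>c\<bar> ^ DIM('a) *\<^sub>R f x)"
    by (subst (asm) integrable_density) auto
  then have "integrable (distr lborel borel (\<lambda>x. t + c *\<^sub>R x)) (\<lambda>x. inverse (\<bar>c\<bar> ^ DIM('a)) *\<^sub>R \<bar>c\<bar> ^ DIM('a) *\<^sub>R f x)"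
    by (rule integrable_scaleR_right)
  then have "integrable (distr lborel borel (\<lambda>x. t + c *\<^sub>R x)) f"
    using c by simp
  then show ?thesis
    by (subst (asm) integrable_distr_eq) auto
qed

lemma lborel_integral_shift:
  fixes f :: "'a::euclidean_space \<Rightarrow> 'b::{banach, second_countable_topology}"
  assumes "f \<in> borel_measurable borel"
  shows "(\<integral>x. f (x + t) \<partial>lborel) = (\<integral>x. f x \<partial>lborel)"
  using lborel_integral_affine[of 1 f t] assms by (simp add: add.commute)

lemma lborel_integrable_shift:
  fixes f :: "'a::euclidean_space \<Rightarrow> 'b::{banach, second_countable_topology}"
  assumes "integrable lborel f"
  shows "integrable lborel (\<lambda>x. f (x + t))"
  using lborel_integrable_affine[of 1 f t] assms by (simp add: add.commute)

lemma integral_tendsto_dominated: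
  fixes f :: "'p::first_countable_topology \<Rightarrow> 'a \<Rightarrow> 'b::{banach, second_countable_topology}"
  assumes meas: "\<And>s. s \<in> A \<Longrightarrow> f s \<in> borel_measurable M" and l: "l \<in> borel_measurable M"
    and lim: "AE x in M. ((\<lambda>s. f s x) \<longlongrightarrow> l x) (at s0 within A)"
    and g: "integrable M g"
    and bd: "\<And>s x. s \<in> A \<Longrightarrow> x \<in> space M \<Longrightarrow> norm (f s x) \<le> g x"
  shows "((\<lambda>s. \<integral>x. f s x \<partial>M) \<longlongrightarrow> (\<integral>x. l x \<partial>M)) (at s0 within A)"
proof (unfold tendsto_at_iff_sequentially, intro allI impI)
  fix X :: "nat \<Rightarrow> 'p"
  assume X: "\<forall>i. X i \<in> A - {s0}" "X \<longlonglongrightarrow> s0"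
  have "(\<lambda>i. \<integral>x. f (X i) x \<partial>M) \<longlonglongrightarrow> (\<integral>x. l x \<partial>M)"
  proof (rule integral_dominated_convergence[OF l _ g])
    show "f (X i) \<in> borel_measurable M" for i
      using X meas by blast
    show "AE x in M. (\<lambda>i. f (X i) x) \<longlonglongrightarrow> l x"
      using lim
    proof eventually_elim
      case (elim x)
      then show ?case
        using X unfolding tendsto_at_iff_sequentially o_def by blast
    qed
    show "AE x in M. norm (f (X i) x) \<le> g x" for i
      using X bd by (intro AE_I2) auto
  qed
  then show "((\<lambda>s. \<integral>x. f s x \<partial>M) \<circ> X) \<longlonglongrightarrow> (\<integral>x. l x \<partial>M)"
    by (simp add: o_def)
qed

lemma continuous_on_integral_dominated:
  fixes f :: "'p::first_countable_topology \<Rightarrow> 'a \<Rightarrow> 'b::{banach, second_countable_topology}"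
  assumes "\<And>s. s \<in> A \<Longrightarrow> f s \<in> borel_measurable M"
    and "\<And>x. x \<in> space M \<Longrightarrow> continuous_on A (\<lambda>s. f s x)"
    and "integrable M g"
    and "\<And>s x. s \<in> A \<Longrightarrow> x \<in> space M \<Longrightarrow> norm (f s x) \<le> g x"
  shows "continuous_on A (\<lambda>s. \<integral>x. f s x \<partial>M)"
  unfolding continuous_on_def
proof
  fix s0 assume "s0 \<in> A"
  then show "((\<lambda>s. \<integral>x. f s x \<partial>M) \<longlongrightarrow> (\<integral>x. f s0 x \<partial>M)) (at s0 within A)"
    using assms by (intro integral_tendsto_dominated[where g = g] AE_I2) (auto simp: continuous_on_def)
qed

lemma has_vector_derivative_iff_quotient:
  "(f has_vector_derivative f') (at s) \<longleftrightarrow>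
     ((\<lambda>h. (f (s + h) - f s) /\<^sub>R h) \<longlongrightarrow> f') (at 0)"
proof -
  have "(f has_vector_derivative f') (at s) \<longleftrightarrow>
      ((\<lambda>h. norm (f (s + h) - f s - h *\<^sub>R f') / norm h) \<longlongrightarrow> 0) (at 0)"
    unfolding has_vector_derivative_def has_derivative_at
    by (simp add: bounded_linear_scaleR_left)
  also have "\<dots> \<longleftrightarrow> ((\<lambda>h. norm ((f (s + h) - f s) /\<^sub>R h - f')) \<longlongrightarrow> 0) (at 0)"
  proof (rule filterlim_cong[OF refl refl])
    show "\<forall>\<^sub>F h in at 0. norm (f (s + h) - f s - h *\<^sub>R f') / norm h =
        norm ((f (s + h) - f s) /\<^sub>R h - f')"
    proof (rule eventually_at_filter[THEN iffD2], rule always_eventually, intro allI impI)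
      fix h :: real assume h: "h \<noteq> 0"
      have "(f (s + h) - f s) /\<^sub>R h - f' = (f (s + h) - f s - h *\<^sub>R f') /\<^sub>R h"
        using h by (simp add: scaleR_diff_right)
      then show "norm (f (s + h) - f s - h *\<^sub>R f') / norm h =
        norm ((f (s + h) - f s) /\<^sub>R h - f')"
        by (simp only: norm_scaleR) (simp add: divide_inverse_commute)
    qed
  qed
  also have "\<dots> \<longleftrightarrow> ((\<lambda>h. (f (s + h) - f s) /\<^sub>R h) \<longlongrightarrow> f') (at 0)"
    by (subst tendsto_norm_zero_iff, subst Lim_null[symmetric], rule refl)
  finally show ?thesis .
qed

lemma vector_mean_value_bound:
  fixes f :: "real \<Rightarrow> 'b::real_normed_vector"
  assumes "\<And>s. s \<in> {a<..<b} \<Longrightarrow> (f has_vector_derivative f' s) (at s)"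
    and "\<And>s. s \<in> {a<..<b} \<Longrightarrow> norm (f' s) \<le> B"
    and "s \<in> {a<..<b}" "r \<in> {a<..<b}"
  shows "norm (f s - f r) \<le> B * \<bar>s - r\<bar>"
proof -
  have "norm (f s - f r) \<le> B * norm (s - r)"
  proof (rule differentiable_bound[of "{a<..<b}" f "\<lambda>s h. h *\<^sub>R f' s"])
    show "(f has_derivative (\<lambda>h. h *\<^sub>R f' s)) (at s within {a<..<b})" if "s \<in> {a<..<b}" for s
      using assms(1)[OF that] unfolding has_vector_derivative_def by (rule has_derivative_at_withinI)
    show "onorm (\<lambda>h. h *\<^sub>R f' s) \<le> B" if "s \<in> {a<..<b}" for s
    proof (rule onorm_le)
      show "norm (h *\<^sub>R f' s) \<le> B * norm h" for h
        using mult_right_mono[OF assms(2)[OF that], of "\<bar>h\<bar>"] by (simp add: mult.commute)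
    qed
  qed (use assms in auto)
  then show ?thesis by simp
qed

text \<open>By the mean value inequality the difference quotients are dominated by \<open>g\<close>, so dominated
  convergence applies.\<close>

lemma has_vector_derivative_integral:
  fixes f :: "real \<Rightarrow> 'a \<Rightarrow> 'b::{banach, second_countable_topology}"
  assumes s0: "s0 \<in> {a<..<b}"
    and int: "\<And>s. s \<in> {a<..<b} \<Longrightarrow> integrable M (f s)"
    and der: "\<And>s x. s \<in> {a<..<b} \<Longrightarrow> ((\<lambda>s. f s x) has_vector_derivative f' s x) (at s)"
    and bd: "\<And>s x. s \<in> {a<..<b} \<Longrightarrow> norm (f' s x) \<le> g x"
    and g: "integrable M g"
  shows "((\<lambda>s. \<integral>x. f s x \<partial>M) has_vector_derivative (\<integral>x. f' s0 x \<partial>M)) (at s0)"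
    and "integrable M (f' s0)"
proof -
  define A where "A = {a - s0 <..< b - s0}"
  have A: "open A" "0 \<in> A"
    using s0 by (auto simp: A_def)
  define q where "q h x = (f (s0 + h) x - f s0 x) /\<^sub>R h" for h x
  have lim: "((\<lambda>h. q h x) \<longlongrightarrow> f' s0 x) (at 0)" for x
    using der[OF s0, of x] unfolding has_vector_derivative_iff_quotient q_def .
  have qint: "integrable M (q h)" if "h \<in> A" for h
    using int[OF s0] int[of "s0 + h"] that unfolding q_def A_def by auto
  have qbd: "norm (q h x) \<le> g x" if "h \<in> A" for h x
  proof (cases "h = 0")
    case True
    then show ?thesis
      using bd[OF s0, of x] norm_ge_zero[of "f' s0 x"] by (simp add: q_def del: norm_ge_zero)
  next
    case False
    have "norm (f (s0 + h) x - f s0 x) \<le> g x * \<bar>s0 + h - s0\<bar>"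
      by (rule vector_mean_value_bound[of a b _ "\<lambda>s. f' s x"]) (use that s0 der bd in \<open>auto simp: A_def\<close>)
    then show ?thesis
      using False by (simp only: q_def norm_scaleR) (simp add: divide_simps mult.commute)
  qed
  obtain X :: "nat \<Rightarrow> real" where X: "\<And>i. X i \<in> A - {0}" "X \<longlonglongrightarrow> 0"
  proof -
    have "0 islimpt A"
      using A by (simp add: interior_limit_point interior_open)
    then show ?thesis
      using that unfolding islimpt_sequential by blast
  qed
  have f'm: "f' s0 \<in> borel_measurable M"
  proof (rule borel_measurable_LIMSEQ_metric)
    show "q (X i) \<in> borel_measurable M" for i
      using qint[of "X i"] X(1)[of i] by (intro borel_measurable_integrable) auto
    show "(\<lambda>i. q (X i) x) \<longlonglongrightarrow> f' s0 x" for x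
      using lim[of x] X unfolding tendsto_at_iff_sequentially o_def by blast
  qed
  have "norm (f' s0 x) \<le> norm (g x)" for x
    using bd[OF s0, of x] by simp
  then show "integrable M (f' s0)"
    by (intro Bochner_Integration.integrable_bound[OF g f'm] AE_I2)
  have "((\<lambda>h. \<integral>x. q h x \<partial>M) \<longlongrightarrow> (\<integral>x. f' s0 x \<partial>M)) (at 0 within A)"
  proof (rule integral_tendsto_dominated[OF _ f'm _ g])
    show "q h \<in> borel_measurable M" if "h \<in> A" for h
      using qint[OF that] by (rule borel_measurable_integrable)
    show "AE x in M. ((\<lambda>h. q h x) \<longlongrightarrow> f' s0 x) (at 0 within A)"
      by (rule AE_I2, rule tendsto_within_subset[OF lim]) auto
  qed (use qbd in auto)
  then have "((\<lambda>h. \<integral>x. q h x \<partial>M) \<longlongrightarrow> (\<integral>x. f' s0 x \<partial>M)) (at 0)"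
    unfolding at_within_open[OF A(2,1)] .
  moreover have "\<forall>\<^sub>F h in at 0. (\<integral>x. q h x \<partial>M) = ((\<integral>x. f (s0 + h) x \<partial>M) - (\<integral>x. f s0 x \<partial>M)) /\<^sub>R h"
  proof -
    have "\<forall>\<^sub>F h in at 0. h \<in> A"
      using A by (intro eventually_at_in_open') auto
    then show ?thesis
    proof eventually_elim
      case (elim h)
      then have "integrable M (f (s0 + h))"
        using int[of "s0 + h"] by (auto simp: A_def)
      then show ?case
        using int[OF s0] by (simp add: q_def)
    qed
  qed
  ultimately show "((\<lambda>s. \<integral>x. f s x \<partial>M) has_vector_derivative (\<integral>x. f' s0 x \<partial>M)) (at s0)"
    unfolding has_vector_derivative_iff_quotient by (rule Lim_transform_eventually)
qed

text \<open>Translation invariance makes the integral of \<open>f (x + e) - f x\<close> vanish, and by the fundamental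
  theorem of calculus and Fubini it is also the integral of \<open>f'\<close>. Every integration by parts below is
  an instance, with a product in the role of \<open>f\<close>.\<close>

lemma integral_directional_derivative_eq_0:
  fixes f :: "'a::euclidean_space \<Rightarrow> 'b::euclidean_space"
  assumes der: "\<And>x. ((\<lambda>s. f (x + s *\<^sub>R e)) has_vector_derivative f' x) (at 0)"
    and f: "integrable lborel f" and f': "integrable lborel f'" and cont: "continuous_on UNIV f'"
  shows "(\<integral>x. f' x \<partial>lborel) = 0"
proof -
  have [measurable]: "f \<in> borel_measurable borel" "f' \<in> borel_measurable borel"
    using f f' by auto
  have der': "((\<lambda>s. f (x + s *\<^sub>R e)) has_vector_derivative f' (x + s *\<^sub>R e)) (at s)" for x s
    using der[of "x + s *\<^sub>R e"] unfolding has_vector_derivative_iff_quotient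
    by (simp add: algebra_simps)
  have ftc: "(\<integral>s. indicator {0..1::real} s *\<^sub>R f' (x + s *\<^sub>R e) \<partial>lborel) = f (x + e) - f x" for x
  proof -
    have "continuous_on {0..1} (\<lambda>s. f' (x + s *\<^sub>R e))"
      by (rule continuous_on_compose2[OF cont]) (auto intro!: continuous_intros)
    then show ?thesis
      using integral_FTC_atLeastAtMost[of 0 1 "\<lambda>s. f (x + s *\<^sub>R e)" "\<lambda>s. f' (x + s *\<^sub>R e)"]
        has_vector_derivative_at_within[OF der'] by simp
  qed
  have [measurable]: "(\<lambda>p. f' (snd p + fst p *\<^sub>R e)) \<in> borel_measurable (borel \<Otimes>\<^sub>M borel)"
    by measurable
  have P: "integrable (lborel \<Otimes>\<^sub>M lborel) (\<lambda>(s, x). indicator {0..1::real} s *\<^sub>R f' (x + s *\<^sub>R e))"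
  proof (rule lborel_pair.Fubini_integrable)
    show "(\<lambda>(s, x). indicator {0..1::real} s *\<^sub>R f' (x + s *\<^sub>R e)) \<in> borel_measurable (lborel \<Otimes>\<^sub>M lborel)"
      by (simp add: case_prod_beta')
    have *: "(\<integral>x. norm (indicator {0..1::real} s *\<^sub>R f' (x + s *\<^sub>R e)) \<partial>lborel) =
        indicator {0..1} s *\<^sub>R (\<integral>x. norm (f' x) \<partial>lborel)" for s
      using lborel_integral_shift[of "\<lambda>x. norm (f' x)" "s *\<^sub>R e"] by (simp add: indicator_def)
    show "integrable lborel (\<lambda>s. \<integral>x. norm (case (s, x) of (s, x) \<Rightarrow>
        indicator {0..1::real} s *\<^sub>R f' (x + s *\<^sub>R e)) \<partial>lborel)"
      by (simp only: prod.case *) simp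
    show "AE s in lborel. integrable lborel (\<lambda>x. case (s, x) of (s, x) \<Rightarrow>
        indicator {0..1::real} s *\<^sub>R f' (x + s *\<^sub>R e))"
      using lborel_integrable_shift[OF f'] by auto
  qed
  have "(\<integral>x. (\<integral>s. indicator {0..1::real} s *\<^sub>R f' (x + s *\<^sub>R e) \<partial>lborel) \<partial>lborel) =
      (\<integral>s. (\<integral>x. indicator {0..1::real} s *\<^sub>R f' (x + s *\<^sub>R e) \<partial>lborel) \<partial>lborel)"
    by (rule lborel_pair.Fubini_integral[OF P])
  also have "\<dots> = (\<integral>s. indicator {0..1::real} s *\<^sub>R (\<integral>x. f' x \<partial>lborel) \<partial>lborel)"
    using lborel_integral_shift[of f'] by simp
  also have "\<dots> = (\<integral>x. f' x \<partial>lborel)"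
    by simp
  also have "(\<integral>x. (\<integral>s. indicator {0..1::real} s *\<^sub>R f' (x + s *\<^sub>R e) \<partial>lborel) \<partial>lborel) =
      (\<integral>x. f (x + e) - f x \<partial>lborel)"
    by (simp only: ftc)
  also have "\<dots> = 0"
    using lborel_integral_shift[of f e] lborel_integrable_shift[OF f, of e] f by simp
  finally show ?thesis by simp
qed

text \<open>The form of Fubini's theorem needed to compose Fourier integrals: the kernel will be an
  exponential \<open>cis\<close>.\<close>

lemma integral_swap_bounded_kernel:
  fixes f :: "'a::euclidean_space \<Rightarrow> complex" and g :: "'c::euclidean_space \<Rightarrow> complex"
  assumes f: "integrable lborel f" and g: "integrable lborel g"
    and k[measurable]: "case_prod k \<in> borel_measurable (borel \<Otimes>\<^sub>M borel)"
    and bd: "\<And>x y. norm (k x y) \<le> 1"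
  shows "(\<integral>x. f x * (\<integral>y. k x y * g y \<partial>lborel) \<partial>lborel) =
         (\<integral>y. (\<integral>x. f x * k x y \<partial>lborel) * g y \<partial>lborel)"
proof -
  have [measurable]: "f \<in> borel_measurable borel" "g \<in> borel_measurable borel"
    using f g by auto
  have P0: "integrable (lborel \<Otimes>\<^sub>M lborel) (\<lambda>(x, y). f x * g y)"
  proof (rule lborel_pair.Fubini_integrable)
    show "integrable lborel (\<lambda>x. \<integral>y. norm (case (x, y) of (x, y) \<Rightarrow> f x * g y) \<partial>lborel)"
      using f by (simp add: norm_mult)
  qed (use g in auto)
  have P: "integrable (lborel \<Otimes>\<^sub>M lborel) (\<lambda>(x, y). f x * (k x y * g y))"
  proof (rule Bochner_Integration.integrable_bound[OF P0])
    have "norm (f x * (k x y * g y)) \<le> norm (f x * g y)" for x y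
      using mult_right_mono[OF bd[of x y], of "norm (g y)"]
      by (auto simp: norm_mult intro!: mult_left_mono)
    then show "AE p in lborel \<Otimes>\<^sub>M lborel. norm (case p of (x, y) \<Rightarrow> f x * (k x y * g y))
        \<le> norm (case p of (x, y) \<Rightarrow> f x * g y)"
      by auto
  qed simp
  have "(\<integral>x. f x * (\<integral>y. k x y * g y \<partial>lborel) \<partial>lborel) = (\<integral>x. (\<integral>y. f x * (k x y * g y) \<partial>lborel) \<partial>lborel)"
    by simp
  also have "\<dots> = (\<integral>y. (\<integral>x. f x * (k x y * g y) \<partial>lborel) \<partial>lborel)"
    using lborel_pair.Fubini_integral[OF P] by simp
  also have "\<dots> = (\<integral>y. (\<integral>x. f x * k x y \<partial>lborel) * g y \<partial>lborel)"
    by (simp add: mult.assoc[symmetric])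
  finally show ?thesis .
qed

section \<open>Gaussians and the decay weight\<close>

text \<open>Reduces Gaussian integrals and the integrability of power weights to dimension one.\<close>

lemma lborel_prod_Basis:
  fixes f :: "'a::euclidean_space \<Rightarrow> real \<Rightarrow> complex"
  assumes f: "\<And>b. b \<in> Basis \<Longrightarrow> integrable lborel (f b)"
  shows "integrable lborel (\<lambda>x::'a. \<Prod>b\<in>Basis. f b (x \<bullet> b))"
    and "(\<integral>x. (\<Prod>b\<in>Basis. f b (x \<bullet> b)) \<partial>(lborel :: 'a measure)) = (\<Prod>b\<in>Basis. \<integral>s. f b s \<partial>lborel)"
proof -
  interpret L: product_sigma_finite "\<lambda>b::'a. lborel :: real measure" by standard
  have [measurable]: "b \<in> Basis \<Longrightarrow> f b \<in> borel_measurable borel" for b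
    using f by auto
  have [measurable]: "(\<lambda>x::'a. \<Prod>b\<in>Basis. f b (x \<bullet> b)) \<in> borel_measurable borel"
    by (intro borel_measurable_prod) auto
  have T[measurable]: "(\<lambda>f. \<Sum>b\<in>Basis. f b *\<^sub>R b) \<in> measurable (\<Pi>\<^sub>M b\<in>Basis. lborel) (borel :: 'a measure)"
    by measurable
  have inner: "(\<Prod>b\<in>Basis. f b ((\<Sum>c\<in>Basis. h c *\<^sub>R c) \<bullet> b)) = (\<Prod>b\<in>Basis. f b (h b))" for h :: "'a \<Rightarrow> real"
    by (intro prod.cong refl) (simp add: inner_sum_left_Basis)
  show "integrable lborel (\<lambda>x::'a. \<Prod>b\<in>Basis. f b (x \<bullet> b))"
    by (subst lborel_eq, subst integrable_distr_eq[OF T])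
      (simp_all only: inner, use f in \<open>auto intro!: L.product_integrable_prod\<close>)
  show "(\<integral>x. (\<Prod>b\<in>Basis. f b (x \<bullet> b)) \<partial>(lborel :: 'a measure)) = (\<Prod>b\<in>Basis. \<integral>s. f b s \<partial>lborel)"
    by (subst lborel_eq, subst integral_distr[OF T])
      (simp_all only: inner, use f in \<open>auto intro!: L.product_integral_prod\<close>)
qed

text \<open>Up to scaling, the characteristic function of the standard normal distribution.\<close>

lemma gauss_fourier_real:
  shows "integrable lborel (\<lambda>s. of_real ((4 * pi) powr (-1/2) * exp (- s\<^sup>2 / 4)) * cis (a * s))"
    and "(\<integral>s. of_real ((4 * pi) powr (-1/2) * exp (- s\<^sup>2 / 4)) * cis (a * s) \<partial>lborel) =
         of_real (exp (- a\<^sup>2))"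
proof -
  let ?f = "\<lambda>s. of_real ((4 * pi) powr (-1/2) * exp (- s\<^sup>2 / 4)) * cis (a * s)"
  have scale: "?f (0 + sqrt 2 * s) = (std_normal_density s *\<^sub>R cis ((sqrt 2 * a) * s)) /\<^sub>R sqrt 2" for s
  proof -
    have "(4 * pi) powr (-1/2) = inverse (sqrt 2) * (1 / sqrt (2 * pi))"
      by (simp add: powr_minus powr_half_sqrt real_sqrt_mult field_simps)
    then show ?thesis
      by (simp add: std_normal_density_def scaleR_conv_of_real power_mult_distrib ac_simps)
  qed
  have "integrable lborel (\<lambda>s. std_normal_density s *\<^sub>R cis ((sqrt 2 * a) * s))"
    by (rule Bochner_Integration.integrable_bound[of _ std_normal_density])
       (auto simp: cis_conv_exp)
  then have "integrable lborel (\<lambda>s. ?f (0 + sqrt 2 * s))"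
    unfolding scale by (rule integrable_scaleR_right)
  then show "integrable lborel ?f"
    by (subst (asm) lborel_integrable_real_affine_iff) auto
  have "(\<integral>s. ?f s \<partial>lborel) = \<bar>sqrt 2\<bar> *\<^sub>R (\<integral>s. ?f (0 + sqrt 2 * s) \<partial>lborel)"
    by (rule lborel_integral_real_affine) simp
  also have "\<dots> = (\<integral>s. std_normal_density s *\<^sub>R cis ((sqrt 2 * a) * s) \<partial>lborel)"
    unfolding scale integral_scaleR_right by simp
  also have "\<dots> = char std_normal_distribution (sqrt 2 * a)"
    unfolding char_def
    by (subst integral_density) (auto simp: cis_conv_exp)
  also have "\<dots> = of_real (exp (- a\<^sup>2))"
    by (simp add: char_std_normal_distribution power_mult_distrib)
  finally show "(\<integral>s. ?f s \<partial>lborel) = of_real (exp (- a\<^sup>2))" .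
qed

text \<open>The heat kernel at time 1.\<close>

definition gauss :: "real^3 \<Rightarrow> real" where
  "gauss z = (4 * pi) powr (-3/2) * exp (- (norm z)\<^sup>2 / 4)"

lemma gauss_nonneg [simp]: "0 \<le> gauss z"
  by (simp add: gauss_def)

lemma continuous_on_gauss [continuous_intros]:
  "continuous_on S f \<Longrightarrow> continuous_on S (\<lambda>x. gauss (f x))"
  unfolding gauss_def by (intro continuous_intros) auto

lemma borel_measurable_gauss [measurable]: "gauss \<in> borel_measurable borel"
  by (intro borel_measurable_continuous_onI continuous_intros)

lemma gauss_fourier:
  shows "integrable lborel (\<lambda>z. of_real (gauss z) * cis (\<xi> \<bullet> z))"
    and "(\<integral>z. of_real (gauss z) * cis (\<xi> \<bullet> z) \<partial>lborel) = of_real (exp (- (norm \<xi>)\<^sup>2))"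
proof -
  let ?f = "\<lambda>b s. of_real ((4 * pi) powr (-1/2) * exp (- s\<^sup>2 / 4)) * cis ((\<xi> \<bullet> b) * s)"
  have nn: "(\<Sum>b\<in>Basis. (y \<bullet> b)\<^sup>2) = (norm y)\<^sup>2" for y :: "real^3"
    by (simp only: power2_norm_eq_inner) (simp only: euclidean_inner[of y y] power2_eq_square)
  have e: "(\<Prod>b\<in>Basis. exp (- (y \<bullet> b)\<^sup>2 / c)) = exp (- (norm y)\<^sup>2 / c)" for y :: "real^3" and c
    by (simp add: exp_sum[symmetric] sum_negf sum_divide_distrib[symmetric] nn del: prod_constant)
  have "(\<Prod>b\<in>Basis. cis ((\<xi> \<bullet> b) * (z \<bullet> b))) = cis (\<xi> \<bullet> z)" for z
    by (simp add: cis_conv_exp exp_sum[symmetric] sum_distrib_left[symmetric] euclidean_inner[of \<xi> z])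
  moreover have "(\<Prod>b\<in>(Basis::(real^3) set). (4 * pi) powr (-1/2)) = (4 * pi) powr (-3/2)"
    by (simp add: powr_power)
  ultimately have p: "(\<Prod>b\<in>Basis. ?f b (z \<bullet> b)) = of_real (gauss z) * cis (\<xi> \<bullet> z)" for z
    by (simp only: prod.distrib of_real_prod[symmetric] e gauss_def)
  show "integrable lborel (\<lambda>z. of_real (gauss z) * cis (\<xi> \<bullet> z))"
    using lborel_prod_Basis(1)[of ?f] gauss_fourier_real(1) unfolding p by blast
  have "(\<integral>z. of_real (gauss z) * cis (\<xi> \<bullet> z) \<partial>lborel) = (\<Prod>b\<in>Basis. of_real (exp (- (\<xi> \<bullet> b)\<^sup>2)))"
    using lborel_prod_Basis(2)[of ?f] gauss_fourier_real unfolding p by simp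
  also have "\<dots> = of_real (exp (- (norm \<xi>)\<^sup>2))"
    using e[of \<xi> 1] by (simp only: of_real_prod[symmetric] div_by_1)
  finally show "(\<integral>z. of_real (gauss z) * cis (\<xi> \<bullet> z) \<partial>lborel) = of_real (exp (- (norm \<xi>)\<^sup>2))" .
qed

lemma integrable_gauss: "integrable lborel gauss"
  and integral_gauss: "(\<integral>z. gauss z \<partial>lborel) = 1"
proof -
  have "integrable lborel (\<lambda>z. complex_of_real (gauss z))"
    using gauss_fourier(1)[of 0] by simp
  then show "integrable lborel gauss"
    by (simp only: complex_of_real_integrable_eq)
  have "complex_of_real (\<integral>z. gauss z \<partial>lborel) = 1"
    using gauss_fourier(2)[of 0] by (simp add: integral_complex_of_real)
  then show "(\<integral>z. gauss z \<partial>lborel) = 1"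
    by simp
qed

text \<open>The factor \<open>1 + norm z\<close> arises when the heat flow is differentiated in time. Since
  \<open>1 + norm z \<le> 3 * exp ((norm z)\<^sup>2 / 8)\<close>, it costs half of the Gaussian exponent.\<close>

lemma integrable_linear_gauss: "integrable lborel (\<lambda>z. (1 + norm z) * gauss z)"
proof (rule Bochner_Integration.integrable_bound)
  have "integrable lborel (\<lambda>z. gauss (0 + (1 / sqrt 2) *\<^sub>R z))"
    by (rule lborel_integrable_affine[OF _ integrable_gauss]) simp
  then show "integrable lborel (\<lambda>z. 3 * gauss ((1 / sqrt 2) *\<^sub>R z))"
    by simp
  have "(1 + norm z) * gauss z \<le> 3 * gauss ((1 / sqrt 2) *\<^sub>R z)" for z
  proof -
    (* Expanded, this is norm z \<le> 2 + (norm z)\<^sup>2 / 8. *)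
    have "0 \<le> (norm z - 4)\<^sup>2" by simp
    then have "1 + norm z \<le> 3 * (1 + (norm z)\<^sup>2 / 8)"
      by (simp add: power2_eq_square algebra_simps)
        (use zero_le_square[of "norm z"] in linarith)
    also have "\<dots> \<le> 3 * exp ((norm z)\<^sup>2 / 8)"
      using exp_ge_add_one_self[of "(norm z)\<^sup>2 / 8"] by (intro mult_left_mono) auto
    finally have "(1 + norm z) * gauss z \<le> 3 * exp ((norm z)\<^sup>2 / 8) * gauss z"
      by (intro mult_right_mono) auto
    also have "\<dots> = 3 * gauss ((1 / sqrt 2) *\<^sub>R z)"
      by (simp add: gauss_def power_divide exp_add[symmetric] mult.assoc mult.left_commute[of "exp _"])
    finally show ?thesis .
  qed
  then show "AE z in lborel. norm ((1 + norm z) * gauss z) \<le> norm (3 * gauss ((1 / sqrt 2) *\<^sub>R z))"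
    by (intro AE_I2) (simp add: abs_mult)
qed simp

lemma integrable_weight_real:
  assumes p: "1 < p"
  shows "integrable lborel (\<lambda>x::real. (1 + \<bar>x\<bar>) powr (- p))"
proof -
  have "(\<integral>\<^sup>+x. ennreal ((1 + \<bar>x\<bar>) powr (- p)) * indicator {0::real..} x \<partial>lborel) =
      0 - (- ((1 + 0) powr (1 - p) / (p - 1)))"
  proof (rule nn_integral_FTC_atLeast[of _ 0 "\<lambda>x. - ((1 + x) powr (1 - p) / (p - 1))"])
    show "((\<lambda>x. - ((1 + x) powr (1 - p) / (p - 1))) has_real_derivative (1 + \<bar>x\<bar>) powr (- p)) (at x)"
      if "0 \<le> x" for x
    proof -
      have "((\<lambda>x. (1 + x) powr (1 - p)) has_real_derivative (1 - p) * (1 + x) powr (- p)) (at x)"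
        using DERIV_fun_powr[of "\<lambda>x. 1 + x" 1 x "1 - p"] that by (auto intro!: derivative_eq_intros)
      from DERIV_minus[OF DERIV_cdivide[OF this, of "p - 1"]]
      have "((\<lambda>x. - ((1 + x) powr (1 - p) / (p - 1))) has_real_derivative
          - ((1 - p) * (1 + x) powr (- p) / (p - 1))) (at x)" .
      moreover have "- ((1 - p) * y / (p - 1)) = y" for y
        using p by (simp add: field_simps)
      ultimately show ?thesis
        using that by (simp only: abs_of_nonneg)
    qed
    have "((\<lambda>x::real. (1 + x) powr (1 - p)) \<longlongrightarrow> 0) at_top"
      using p by (intro tendsto_neg_powr filterlim_tendsto_add_at_top[OF tendsto_const filterlim_ident]) auto
    then show "((\<lambda>x::real. - ((1 + x) powr (1 - p) / (p - 1))) \<longlongrightarrow> 0) at_top"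
      using tendsto_minus[OF tendsto_divide[OF _ tendsto_const[of "p - 1"]]] p by fastforce
  qed auto
  then have "(\<integral>\<^sup>+x. ennreal (norm (indicator {0::real..} x * (1 + \<bar>x\<bar>) powr (- p))) \<partial>lborel) < \<infinity>"
    by (simp add: abs_mult ennreal_mult'' ennreal_indicator mult.commute)
  then have half: "integrable lborel (\<lambda>x. indicator {0::real..} x * (1 + \<bar>x\<bar>) powr (- p))"
    by (intro integrableI_bounded) auto
  have "integrable lborel (\<lambda>x. indicator {0::real..} (- x) * (1 + \<bar>- x\<bar>) powr (- p))"
    using lborel_integrable_real_affine[OF half, of "-1" 0] by simp
  note sum = Bochner_Integration.integrable_add[OF half this]
  show ?thesis
    by (rule Bochner_Integration.integrable_bound[OF sum])
       (auto intro!: AE_I2 simp: indicator_def)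
qed

text \<open>The weight is at most a product of one-dimensional weights with exponent \<open>r / 3 > 1\<close>.\<close>

lemma integrable_weight:
  assumes r: "3 < r"
  shows "integrable lborel (\<lambda>x::real^3. (1 + norm x) powr (- r))"
proof -
  let ?f = "\<lambda>(b::real^3) s. complex_of_real ((1 + \<bar>s\<bar>) powr (- (r / 3)))"
  have P: "integrable lborel (\<lambda>x::real^3. \<Prod>b\<in>Basis. ?f b (x \<bullet> b))"
    using r by (intro lborel_prod_Basis(1) integrable_of_real integrable_weight_real) auto
  have "(1 + norm x) powr (- r) \<le> (\<Prod>b\<in>Basis. (1 + \<bar>x \<bullet> b\<bar>) powr (- (r / 3)))" for x :: "real^3"
  proof -
    have "1 + norm x \<noteq> 0"
      using norm_ge_zero[of x] by linarith
    then have "(1 + norm x) powr (- r) = (\<Prod>b\<in>(Basis::(real^3) set). (1 + norm x) powr (- (r / 3)))"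
      using powr_power[of "1 + norm x" "- (r / 3)" 3] by simp
    also have "\<dots> \<le> (\<Prod>b\<in>Basis. (1 + \<bar>x \<bullet> b\<bar>) powr (- (r / 3)))"
      using r by (intro prod_mono conjI powr_mono2') (auto simp: Basis_le_norm)
    finally show ?thesis .
  qed
  then have "AE x::real^3 in lborel. norm ((1 + norm x) powr (- r)) \<le> norm (\<Prod>b\<in>Basis. ?f b (x \<bullet> b))"
    by (intro AE_I2) (simp add: prod_norm[symmetric])
  then show ?thesis
    by (intro Bochner_Integration.integrable_bound[OF P]) auto
qed

section \<open>Heat semigroup and Fourier transform\<close>

lemma integrable_bounded_mult:
  fixes f :: "'a \<Rightarrow> 'b::{banach, second_countable_topology}"
  assumes k: "integrable M k" and f: "f \<in> borel_measurable M" and bd: "\<And>x. norm (f x) \<le> B"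
  shows "integrable M (\<lambda>x. k x *\<^sub>R f x)"
proof (rule Bochner_Integration.integrable_bound)
  show "integrable M (\<lambda>x. k x * B)"
    using k by simp
  have "norm (k x *\<^sub>R f x) \<le> norm (k x * B)" for x
    using mult_left_mono[OF order_trans[OF bd[of x] abs_ge_self], of "\<bar>k x\<bar>"] by (simp add: abs_mult)
  then show "AE x in M. norm (k x *\<^sub>R f x) \<le> norm (k x * B)"
    by simp
qed (use k f in auto)

text \<open>The substitution \<open>y = x - sqrt \<tau> *\<^sub>R z\<close> moves the dependence on time from the singular kernel into
  the argument of \<open>f\<close>. In this form \<open>\<tau> = 0\<close> is no exception, and continuity and differentiability in
  time become questions about \<open>f\<close> alone.\<close>

lemma heat_eq_gauss:
  assumes tau: "0 \<le> \<tau>" and [measurable]: "f \<in> borel_measurable borel"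
  shows "heat \<tau> f x = (\<integral>z. gauss z *\<^sub>R f (x - sqrt \<tau> *\<^sub>R z) \<partial>lborel)"
proof (cases "\<tau> = 0")
  case True
  then show ?thesis
    using integrable_gauss integral_gauss by (simp add: heat_def)
next
  case False
  then have tau: "0 < \<tau>"
    using tau by simp
  let ?F = "\<lambda>y. ((4 * pi * \<tau>) powr (-3/2) * exp (- (norm (x - y))\<^sup>2 / (4 * \<tau>))) *\<^sub>R f y"
  have "\<tau> powr (-3/2) * sqrt \<tau> ^ 3 = 1"
    using tau by (simp add: powr_half_sqrt[symmetric] powr_power powr_add[symmetric])
  then have scale: "?F (x + (- sqrt \<tau>) *\<^sub>R z) = (1 / sqrt \<tau> ^ 3) *\<^sub>R (gauss z *\<^sub>R f (x - sqrt \<tau> *\<^sub>R z))" for z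
    using tau by (simp add: gauss_def power_mult_distrib powr_mult field_simps)
  have "heat \<tau> f x = (sqrt \<tau> ^ 3) *\<^sub>R (\<integral>z. ?F (x + (- sqrt \<tau>) *\<^sub>R z) \<partial>lborel)"
    unfolding heat_def using tau by (subst lborel_integral_affine[of "- sqrt \<tau>" _ x]) auto
  also have "\<dots> = (\<integral>z. gauss z *\<^sub>R f (x - sqrt \<tau> *\<^sub>R z) \<partial>lborel)"
    unfolding scale integral_scaleR_right using tau by simp
  finally show ?thesis .
qed

lemma heat_integrand_integrable:
  fixes f :: "real^3 \<Rightarrow> 'b::{banach, second_countable_topology}"
  assumes [measurable]: "f \<in> borel_measurable borel" and bd: "\<And>x. norm (f x) \<le> B"
  shows "integrable lborel (\<lambda>z. gauss z *\<^sub>R f (x - c *\<^sub>R z))"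
  by (rule integrable_bounded_mult[OF integrable_gauss _ bd]) simp

lemma heat_bounded_linear:
  fixes f :: "real^3 \<Rightarrow> 'b::{banach, second_countable_topology}"
    and T :: "'b \<Rightarrow> 'c::{banach, second_countable_topology}"
  assumes T: "bounded_linear T" and tau: "0 \<le> \<tau>"
    and f[measurable]: "f \<in> borel_measurable borel" and bd: "\<And>x. norm (f x) \<le> B"
  shows "heat \<tau> (\<lambda>y. T (f y)) x = T (heat \<tau> f x)"
proof -
  interpret T: bounded_linear T by (rule T)
  have [measurable]: "(\<lambda>y. T (f y)) \<in> borel_measurable borel"
    by (rule borel_measurable_continuous_on[OF T.continuous_on[OF continuous_on_id] f])
  show ?thesis
    using integral_bounded_linear[OF T heat_integrand_integrable[OF f bd]]
    by (simp add: heat_eq_gauss[OF tau] T.scaleR)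
qed

lemma heat_diff:
  fixes f g :: "real^3 \<Rightarrow> 'b::{banach, second_countable_topology}"
  assumes tau: "0 \<le> \<tau>" and m: "f \<in> borel_measurable borel" "g \<in> borel_measurable borel"
    and bd: "\<And>y. norm (f y) \<le> B" "\<And>y. norm (g y) \<le> C"
  shows "heat \<tau> (\<lambda>y. f y - g y) x = heat \<tau> f x - heat \<tau> g x"
  using heat_integrand_integrable[OF m(1) bd(1)] heat_integrand_integrable[OF m(2) bd(2)] m
  by (simp add: heat_eq_gauss[OF tau] scaleR_diff_right)

lemma continuous_on_heat:
  fixes f :: "real^3 \<Rightarrow> 'b::{banach, second_countable_topology}"
  assumes f: "continuous_on UNIV f" and bd: "\<And>x. norm (f x) \<le> B"
  shows "continuous_on {0..} (\<lambda>\<tau>. heat \<tau> f x)"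
proof -
  have [measurable]: "f \<in> borel_measurable borel"
    using f by (rule borel_measurable_continuous_onI)
  have "continuous_on {0..} (\<lambda>\<tau>. \<integral>z. gauss z *\<^sub>R f (x - sqrt \<tau> *\<^sub>R z) \<partial>lborel)"
  proof (rule continuous_on_integral_dominated)
    show "continuous_on {0..} (\<lambda>\<tau>. gauss z *\<^sub>R f (x - sqrt \<tau> *\<^sub>R z))" for z
      by (intro continuous_intros continuous_on_compose2[OF f]) auto
    show "integrable lborel (\<lambda>z. gauss z * B)"
      using integrable_gauss by simp
    show "norm (gauss z *\<^sub>R f (x - sqrt \<tau> *\<^sub>R z)) \<le> gauss z * B" for z \<tau>
      using bd by (simp add: mult_left_mono)
  qed auto
  then show ?thesis
    by (rule continuous_on_cong[THEN iffD1, rotated 2]) (auto simp: heat_eq_gauss)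
qed

lemma integrable_bounded_mult_complex:
  fixes g :: "'a \<Rightarrow> complex"
  assumes g: "integrable M g" and k: "k \<in> borel_measurable M" and bd: "\<And>x. norm (k x) \<le> B"
  shows "integrable M (\<lambda>x. k x * g x)"
proof (rule Bochner_Integration.integrable_bound)
  show "integrable M (\<lambda>x. B * norm (g x))"
    using g by simp
  have "norm (k x * g x) \<le> norm (B * norm (g x))" for x
    using mult_right_mono[OF order_trans[OF bd[of x] abs_ge_self], of "norm (g x)"]
    by (simp add: norm_mult abs_mult)
  then show "AE x in M. norm (k x * g x) \<le> norm (B * norm (g x))"
    by simp
qed (use g k in auto)

lemma borel_measurable_cis [measurable]:
  "f \<in> borel_measurable M \<Longrightarrow> (\<lambda>x. cis (f x)) \<in> borel_measurable M"
  unfolding cis_conv_exp by measurable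

lemma integrable_cis_mult:
  assumes "integrable lborel g"
  shows "integrable lborel (\<lambda>\<xi>. cis (\<xi> \<bullet> x) * g \<xi>)" "integrable lborel (\<lambda>y. cis (- (x \<bullet> y)) * g y)"
  by (rule integrable_bounded_mult_complex[OF assms, where B = 1]; simp)+

lemma inv_fourier_bound:
  assumes g: "integrable lborel g"
  shows "norm (inv_fourier g x) \<le> (\<integral>\<xi>. norm (g \<xi>) \<partial>lborel)"
proof -
  have "norm (\<integral>\<xi>. cis (\<xi> \<bullet> x) * g \<xi> \<partial>lborel) \<le> (\<integral>\<xi>. norm (g \<xi>) \<partial>lborel)"
    using integral_norm_bound[of lborel "\<lambda>\<xi>. cis (\<xi> \<bullet> x) * g \<xi>"] by (simp add: norm_mult)
  moreover have "(1::real) \<le> (2 * pi) ^ 3"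
    using pi_ge_two by (intro one_le_power) auto
  ultimately show ?thesis
    using mult_right_mono[of "1 / (2 * pi) ^ 3" 1 "norm (\<integral>\<xi>. cis (\<xi> \<bullet> x) * g \<xi> \<partial>lborel)"]
    unfolding inv_fourier_def norm_scaleR by simp
qed

lemma fourier_bound:
  assumes g: "integrable lborel g"
  shows "norm (fourier g \<xi>) \<le> (\<integral>y. norm (g y) \<partial>lborel)"
  using integral_norm_bound[of lborel "\<lambda>y. cis (- (\<xi> \<bullet> y)) * g y"] by (simp add: norm_mult fourier_def)

lemma continuous_on_inv_fourier:
  assumes g: "integrable lborel g"
  shows "continuous_on UNIV (inv_fourier g)"
proof -
  have [measurable]: "g \<in> borel_measurable borel"
    using g by auto
  have "continuous_on UNIV (\<lambda>x. \<integral>\<xi>. cis (\<xi> \<bullet> x) * g \<xi> \<partial>lborel)"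
    by (rule continuous_on_integral_dominated[OF _ _ integrable_norm[OF g]])
       (auto simp: norm_mult intro!: continuous_intros)
  then show ?thesis
    unfolding inv_fourier_def by (intro continuous_intros)
qed

lemma continuous_on_fourier:
  assumes g: "integrable lborel g"
  shows "continuous_on UNIV (fourier g)"
proof -
  have [measurable]: "g \<in> borel_measurable borel"
    using g by auto
  show ?thesis
    unfolding fourier_def
    by (rule continuous_on_integral_dominated[OF _ _ integrable_norm[OF g]])
       (auto simp: norm_mult intro!: continuous_intros)
qed

text \<open>Fubini's theorem and the Gaussian Fourier integral: on the Fourier side the heat flow multiplies
  by \<open>exp (- \<tau> * (norm \<xi>)\<^sup>2)\<close>.\<close>

lemma heat_inv_fourier:
  assumes g: "integrable lborel g" and tau: "0 \<le> \<tau>"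
  shows "heat \<tau> (inv_fourier g) x = inv_fourier (\<lambda>\<xi>. of_real (exp (- \<tau> * (norm \<xi>)\<^sup>2)) * g \<xi>) x"
proof -
  have [measurable]: "g \<in> borel_measurable borel" "inv_fourier g \<in> borel_measurable borel"
    using g continuous_on_inv_fourier[OF g] borel_measurable_continuous_onI by auto
  have "heat \<tau> (inv_fourier g) x =
      (1 / (2 * pi) ^ 3) *\<^sub>R (\<integral>z. of_real (gauss z) * (\<integral>\<xi>. cis (\<xi> \<bullet> (x - sqrt \<tau> *\<^sub>R z)) * g \<xi> \<partial>lborel) \<partial>lborel)"
    unfolding heat_eq_gauss[OF tau \<open>inv_fourier g \<in> borel_measurable borel\<close>] inv_fourier_def
    by (simp add: scaleR_conv_of_real mult.left_commute)
  also have "(\<integral>z. of_real (gauss z) * (\<integral>\<xi>. cis (\<xi> \<bullet> (x - sqrt \<tau> *\<^sub>R z)) * g \<xi> \<partial>lborel) \<partial>lborel) =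
      (\<integral>\<xi>. (\<integral>z. of_real (gauss z) * cis (\<xi> \<bullet> (x - sqrt \<tau> *\<^sub>R z)) \<partial>lborel) * g \<xi> \<partial>lborel)"
    by (rule integral_swap_bounded_kernel) (use g integrable_gauss in \<open>auto simp: integrable_of_real\<close>)
  also have "\<dots> = (\<integral>\<xi>. cis (\<xi> \<bullet> x) * (of_real (exp (- \<tau> * (norm \<xi>)\<^sup>2)) * g \<xi>) \<partial>lborel)"
  proof (rule Bochner_Integration.integral_cong[OF refl])
    fix \<xi>
    have "of_real (gauss z) * cis (\<xi> \<bullet> (x - sqrt \<tau> *\<^sub>R z)) =
        cis (\<xi> \<bullet> x) * (of_real (gauss z) * cis ((- sqrt \<tau> *\<^sub>R \<xi>) \<bullet> z))" for z
      by (simp add: cis_mult inner_diff_right mult.assoc mult.left_commute[of "cis _"])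
    then have "(\<integral>z. of_real (gauss z) * cis (\<xi> \<bullet> (x - sqrt \<tau> *\<^sub>R z)) \<partial>lborel) =
        cis (\<xi> \<bullet> x) * (\<integral>z. of_real (gauss z) * cis ((- sqrt \<tau> *\<^sub>R \<xi>) \<bullet> z) \<partial>lborel)"
      by (simp only: integral_mult_right_zero)
    then show "(\<integral>z. of_real (gauss z) * cis (\<xi> \<bullet> (x - sqrt \<tau> *\<^sub>R z)) \<partial>lborel) * g \<xi> =
        cis (\<xi> \<bullet> x) * (of_real (exp (- \<tau> * (norm \<xi>)\<^sup>2)) * g \<xi>)"
      using tau unfolding gauss_fourier(2) by (simp add: power_mult_distrib)
  qed
  finally show ?thesis
    unfolding inv_fourier_def[of "\<lambda>\<xi>. of_real (exp (- \<tau> * (norm \<xi>)\<^sup>2)) * g \<xi>"] .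
qed

lemma gauss_fourier_scaled:
  fixes x :: "real^3"
  assumes eps: "0 < \<epsilon>"
  shows "integrable lborel (\<lambda>\<xi>. of_real (exp (- \<epsilon> * (norm \<xi>)\<^sup>2)) * cis (\<xi> \<bullet> x))"
    and "(\<integral>\<xi>. of_real (exp (- \<epsilon> * (norm \<xi>)\<^sup>2)) * cis (\<xi> \<bullet> x) \<partial>lborel) =
      of_real ((2 * pi) ^ 3 * ((4 * pi * \<epsilon>) powr (-3/2) * exp (- (norm x)\<^sup>2 / (4 * \<epsilon>))))"
proof -
  let ?F = "\<lambda>\<xi>. of_real (exp (- \<epsilon> * (norm \<xi>)\<^sup>2)) * cis (\<xi> \<bullet> x)"
  let ?G = "\<lambda>z. of_real (gauss z) * cis ((x /\<^sub>R (2 * sqrt \<epsilon>)) \<bullet> z)"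
  define k where "k = (4 * pi) powr (-3/2)"
  have k: "0 < k" "k * k * (4 * pi) ^ 3 = 1"
  proof -
    have "k * k = (4 * pi) powr (- 3)"
      by (simp add: k_def powr_add[symmetric])
    also have "\<dots> = inverse ((4 * pi) ^ 3)"
      by (simp only: powr_minus) (simp add: powr_numeral)
    finally have kk: "k * k = inverse ((4 * pi) ^ 3)" .
    show "k * k * (4 * pi) ^ 3 = 1"
      unfolding kk by (rule left_inverse) simp
  qed (simp add: k_def)
  have e: "(4 * pi * \<epsilon>) powr (-3/2) = k / sqrt \<epsilon> ^ 3"
  proof -
    have "\<epsilon> powr (-3/2) * sqrt \<epsilon> ^ 3 = 1"
      using eps by (simp add: powr_half_sqrt[symmetric] powr_power powr_add[symmetric])
    then show ?thesis
      using eps by (simp add: k_def powr_mult field_simps)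
  qed
  have scale: "?G (0 + (2 * sqrt \<epsilon>) *\<^sub>R \<xi>) = of_real k * ?F \<xi>" for \<xi>
  proof -
    have "(x /\<^sub>R (2 * sqrt \<epsilon>)) \<bullet> (0 + (2 * sqrt \<epsilon>) *\<^sub>R \<xi>) = \<xi> \<bullet> x"
      using eps by (simp add: inner_commute field_simps)
    then show ?thesis
      using eps by (simp only:) (simp add: gauss_def k_def power_mult_distrib)
  qed
  have "integrable lborel (\<lambda>\<xi>. ?G (0 + (2 * sqrt \<epsilon>) *\<^sub>R \<xi>))"
    using eps by (intro lborel_integrable_affine gauss_fourier) auto
  then have "integrable lborel (\<lambda>\<xi>. of_real k * ?F \<xi>)"
    unfolding scale .
  then have "integrable lborel (\<lambda>\<xi>. of_real (1 / k) * (of_real k * ?F \<xi>))"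
    by (rule integrable_mult_right)
  moreover have "of_real (1 / k) * (of_real k * w) = w" for w :: complex
    using k(1) by simp
  ultimately show "integrable lborel ?F"
    by (simp only:)
  have "(\<integral>z. ?G z \<partial>lborel) = (2 * sqrt \<epsilon>) ^ 3 *\<^sub>R (\<integral>\<xi>. ?G (0 + (2 * sqrt \<epsilon>) *\<^sub>R \<xi>) \<partial>lborel)"
    using eps by (subst lborel_integral_affine[of "2 * sqrt \<epsilon>" _ 0]) auto
  then have "of_real (exp (- (norm x)\<^sup>2 / (4 * \<epsilon>))) = of_real ((2 * sqrt \<epsilon>) ^ 3 * k) * (\<integral>\<xi>. ?F \<xi> \<partial>lborel)"
  proof -
    have "- (norm (x /\<^sub>R (2 * sqrt \<epsilon>)))\<^sup>2 = - (norm x)\<^sup>2 / (4 * \<epsilon>)"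
      using eps by (simp add: power_mult_distrib power_divide field_simps)
    moreover assume "(\<integral>z. ?G z \<partial>lborel) = (2 * sqrt \<epsilon>) ^ 3 *\<^sub>R (\<integral>\<xi>. ?G (0 + (2 * sqrt \<epsilon>) *\<^sub>R \<xi>) \<partial>lborel)"
    ultimately show ?thesis
      unfolding scale gauss_fourier(2) integral_mult_right_zero
      by (simp only: scaleR_conv_of_real of_real_mult mult.assoc)
  qed
  then have "(\<integral>\<xi>. ?F \<xi> \<partial>lborel) = of_real (exp (- (norm x)\<^sup>2 / (4 * \<epsilon>)) / ((2 * sqrt \<epsilon>) ^ 3 * k))"
    using eps k(1) by (simp add: field_simps)
  also have "exp (- (norm x)\<^sup>2 / (4 * \<epsilon>)) / ((2 * sqrt \<epsilon>) ^ 3 * k) =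
      (2 * pi) ^ 3 * ((4 * pi * \<epsilon>) powr (-3/2) * exp (- (norm x)\<^sup>2 / (4 * \<epsilon>)))"
  proof -
    have "1 / k = k * (4 * pi) ^ 3"
      using k by (simp add: field_simps)
    then have "E / (8 * S * k) = (2 * pi) ^ 3 * (k / S * E)" if "0 < S" for E S :: real
      using that k by (simp add: field_simps power_mult_distrib)
    then show ?thesis
      using eps unfolding e by (simp add: power_mult_distrib)
  qed
  finally show "(\<integral>\<xi>. ?F \<xi> \<partial>lborel) = of_real ((2 * pi) ^ 3 * ((4 * pi * \<epsilon>) powr (-3/2) * exp (- (norm x)\<^sup>2 / (4 * \<epsilon>))))" .
qed

text \<open>The factor \<open>exp (- \<epsilon> * (norm \<xi>)\<^sup>2)\<close> makes the frequency integral absolutely convergent, so the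
  order of the two integrations can be exchanged.\<close>

lemma heat_eq_inv_fourier:
  assumes f: "integrable lborel f" and eps: "0 < \<epsilon>"
  shows "heat \<epsilon> f x = inv_fourier (\<lambda>\<xi>. of_real (exp (- \<epsilon> * (norm \<xi>)\<^sup>2)) * fourier f \<xi>) x"
proof -
  have [measurable]: "f \<in> borel_measurable borel"
    using f by auto
  have "integrable lborel (\<lambda>\<xi>. cis (\<xi> \<bullet> x) * of_real (exp (- \<epsilon> * (norm \<xi>)\<^sup>2)))"
    using gauss_fourier_scaled(1)[OF eps, of x] by (simp add: mult.commute)
  then have "(\<integral>\<xi>. (cis (\<xi> \<bullet> x) * of_real (exp (- \<epsilon> * (norm \<xi>)\<^sup>2))) * (\<integral>y. cis (- (\<xi> \<bullet> y)) * f y \<partial>lborel) \<partial>lborel) =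
     (\<integral>y. (\<integral>\<xi>. (cis (\<xi> \<bullet> x) * of_real (exp (- \<epsilon> * (norm \<xi>)\<^sup>2))) * cis (- (\<xi> \<bullet> y)) \<partial>lborel) * f y \<partial>lborel)"
    by (rule integral_swap_bounded_kernel[OF _ f]) auto
  also have "\<dots> = (\<integral>y. of_real ((2 * pi) ^ 3) *
      (((4 * pi * \<epsilon>) powr (-3/2) * exp (- (norm (x - y))\<^sup>2 / (4 * \<epsilon>))) *\<^sub>R f y) \<partial>lborel)"
  proof (rule Bochner_Integration.integral_cong[OF refl])
    fix y
    have "(cis (\<xi> \<bullet> x) * of_real (exp (- \<epsilon> * (norm \<xi>)\<^sup>2))) * cis (- (\<xi> \<bullet> y)) =
        of_real (exp (- \<epsilon> * (norm \<xi>)\<^sup>2)) * cis (\<xi> \<bullet> (x - y))" for \<xi>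
      by (simp add: cis_mult inner_diff_right mult.assoc mult.left_commute[of "cis _"])
    then have "(\<integral>\<xi>. (cis (\<xi> \<bullet> x) * of_real (exp (- \<epsilon> * (norm \<xi>)\<^sup>2))) * cis (- (\<xi> \<bullet> y)) \<partial>lborel) =
        (\<integral>\<xi>. of_real (exp (- \<epsilon> * (norm \<xi>)\<^sup>2)) * cis (\<xi> \<bullet> (x - y)) \<partial>lborel)"
      by (simp only:)
    then show "(\<integral>\<xi>. (cis (\<xi> \<bullet> x) * of_real (exp (- \<epsilon> * (norm \<xi>)\<^sup>2))) * cis (- (\<xi> \<bullet> y)) \<partial>lborel) * f y =
       of_real ((2 * pi) ^ 3) *
      (((4 * pi * \<epsilon>) powr (-3/2) * exp (- (norm (x - y))\<^sup>2 / (4 * \<epsilon>))) *\<^sub>R f y)"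
      unfolding gauss_fourier_scaled(2)[OF eps] by (simp add: scaleR_conv_of_real)
  qed
  finally show ?thesis
    using eps by (simp add: inv_fourier_def fourier_def heat_def scaleR_conv_of_real mult.assoc)
qed

text \<open>Both sides of \<open>heat_eq_inv_fourier\<close> converge as \<open>\<epsilon>\<close> tends to 0: the left one to \<open>f\<close>, the right one
  to the inverse transform of \<open>fourier f\<close>.\<close>

lemma fourier_inversion:
  assumes f: "integrable lborel f" and F: "integrable lborel (fourier f)"
    and cont: "continuous_on UNIV f" and bd: "\<And>x. norm (f x) \<le> B"
  shows "inv_fourier (fourier f) = f"
proof
  fix x
  let ?R = "\<lambda>\<epsilon>. inv_fourier (\<lambda>\<xi>. of_real (exp (- \<epsilon> * (norm \<xi>)\<^sup>2)) * fourier f \<xi>) x"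
  have [measurable]: "fourier f \<in> borel_measurable borel"
    using F by auto
  (* Continuity at 0 within the closed half line, where ?R 0 is the inverse transform itself. *)
  have "continuous_on {0..} (\<lambda>\<epsilon>. \<integral>\<xi>. cis (\<xi> \<bullet> x) * (of_real (exp (- \<epsilon> * (norm \<xi>)\<^sup>2)) * fourier f \<xi>) \<partial>lborel)"
    by (rule continuous_on_integral_dominated[OF _ _ integrable_norm[OF F]])
       (auto simp: norm_mult intro!: continuous_intros mult_left_le_one_le)
  then have "continuous_on {0..} ?R"
    unfolding inv_fourier_def by (intro continuous_intros)
  then have R: "(?R \<longlongrightarrow> ?R 0) (at 0 within {0..})"
    unfolding continuous_on_def by (rule bspec) simp
  have H: "((\<lambda>\<epsilon>. heat \<epsilon> f x) \<longlongrightarrow> heat 0 f x) (at 0 within {0..})"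
    using continuous_on_heat[OF cont bd, of x] by (auto simp: continuous_on_def)
  have "\<forall>\<^sub>F \<epsilon> in at 0 within {0..}. heat \<epsilon> f x = ?R \<epsilon>"
    unfolding eventually_at_filter
    by (rule always_eventually) (use heat_eq_inv_fourier[OF f] in auto)
  then have "((\<lambda>\<epsilon>. heat \<epsilon> f x) \<longlongrightarrow> ?R 0) (at 0 within {0..})"
    using R by (subst tendsto_cong)
  moreover have "at (0::real) within {0..} \<noteq> bot"
    by (simp add: at_within_Ici_at_right)
  ultimately have "heat 0 f x = ?R 0"
    using H tendsto_unique by blast
  then show "inv_fourier (fourier f) x = f x"
    by (simp add: heat_def)
qed

section \<open>Partial derivatives\<close>

lemma differentiable_frechet:
  "f differentiable (at x) \<Longrightarrow> (f has_derivative frechet_derivative f (at x)) (at x)"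
  using frechet_derivative_works by blast

lemma partial_unique:
  assumes "(f has_derivative f') (at x)"
  shows "partial i f x = f' (axis i 1)"
  unfolding partial_def using frechet_derivative_at[OF assms] by simp

lemma partial_linear:
  assumes T: "bounded_linear T" and f: "f differentiable (at x)"
  shows "(\<lambda>y. T (f y)) differentiable (at x)" "partial i (\<lambda>y. T (f y)) x = T (partial i f x)"
proof -
  have "((\<lambda>y. T (f y)) has_derivative (\<lambda>h. T (frechet_derivative f (at x) h))) (at x)"
    by (rule bounded_linear.has_derivative[OF T differentiable_frechet[OF f]])
  then show "(\<lambda>y. T (f y)) differentiable (at x)" "partial i (\<lambda>y. T (f y)) x = T (partial i f x)"
    by (auto simp: differentiable_def partial_unique) (simp add: partial_def)
qed

lemma partial_bilinear:
  assumes P: "bounded_bilinear P" and f: "f differentiable (at x)" and g: "g differentiable (at x)"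
  shows "(\<lambda>y. P (f y) (g y)) differentiable (at x)"
    and "partial i (\<lambda>y. P (f y) (g y)) x = P (f x) (partial i g x) + P (partial i f x) (g x)"
proof -
  have "((\<lambda>y. P (f y) (g y)) has_derivative
      (\<lambda>h. P (f x) (frechet_derivative g (at x) h) + P (frechet_derivative f (at x) h) (g x))) (at x)"
    by (rule bounded_bilinear.FDERIV[OF P differentiable_frechet[OF f] differentiable_frechet[OF g]])
  then show "(\<lambda>y. P (f y) (g y)) differentiable (at x)"
    "partial i (\<lambda>y. P (f y) (g y)) x = P (f x) (partial i g x) + P (partial i f x) (g x)"
    by (auto simp: differentiable_def partial_unique) (simp add: partial_def)
qed

lemma partial_add:
  assumes f: "f differentiable (at x)" and g: "g differentiable (at x)"
  shows "partial i (\<lambda>y. f y + g y) x = partial i f x + partial i g x"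
  using partial_unique[OF has_derivative_add[OF differentiable_frechet[OF f] differentiable_frechet[OF g]]]
  by (simp add: partial_def)

lemma partial_diff:
  assumes f: "f differentiable (at x)" and g: "g differentiable (at x)"
  shows "partial i (\<lambda>y. f y - g y) x = partial i f x - partial i g x"
  using partial_unique[OF has_derivative_diff[OF differentiable_frechet[OF f] differentiable_frechet[OF g]]]
  by (simp add: partial_def)

lemma partial_sum:
  assumes f: "\<And>k. k \<in> K \<Longrightarrow> f k differentiable (at x)"
  shows "partial i (\<lambda>y. \<Sum>k\<in>K. f k y) x = (\<Sum>k\<in>K. partial i (f k) x)"
  using partial_unique[OF has_derivative_sum[OF differentiable_frechet[OF f]], of K "\<lambda>k. k"]
  by (simp add: partial_def)

lemma partial_nth:
  assumes "f differentiable (at x)"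
  shows "(\<lambda>y. f y $ k) differentiable (at x)" "partial i (\<lambda>y. f y $ k) x = partial i f x $ k"
  using partial_linear[OF bounded_linear_vec_nth assms] by auto

lemma has_vector_derivative_partial:
  assumes "f differentiable (at (x + s *\<^sub>R axis i 1))"
  shows "((\<lambda>s. f (x + s *\<^sub>R axis i 1)) has_vector_derivative partial i f (x + s *\<^sub>R axis i 1)) (at s)"
proof -
  let ?D = "frechet_derivative f (at (x + s *\<^sub>R axis i 1))"
  have D: "(f has_derivative ?D) (at (x + s *\<^sub>R axis i 1))"
    by (rule differentiable_frechet[OF assms])
  have "((\<lambda>s. f (x + s *\<^sub>R axis i 1)) has_derivative (\<lambda>h. ?D (h *\<^sub>R axis i 1))) (at s)"
    by (rule has_derivative_compose[of "\<lambda>s. x + s *\<^sub>R axis i 1", OF _ D])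
      (auto intro!: derivative_eq_intros)
  then show ?thesis
    unfolding has_vector_derivative_def partial_def
    by (simp add: linear_cmul[OF has_derivative_linear[OF D]])
qed

section \<open>Uniformly decaying families\<close>

text \<open>Families, indexed by time in the applications, and not single functions: the constants have to
  be uniform in time.\<close>

definition decay_bound :: "real \<Rightarrow> 'i set \<Rightarrow> ('i \<Rightarrow> real^3 \<Rightarrow> 'b::real_normed_vector) \<Rightarrow> bool" where
  "decay_bound r S f \<longleftrightarrow> (\<forall>s\<in>S. continuous_on UNIV (f s)) \<and>
     (\<exists>C. \<forall>s\<in>S. \<forall>x. norm (f s x) \<le> C * (1 + norm x) powr (- r))"

text \<open>Counting derivatives recursively reduces closure under sums and products to one
  application of the corresponding rule for first derivatives.\<close>

primrec decays :: "nat \<Rightarrow> real \<Rightarrow> 'i set \<Rightarrow> ('i \<Rightarrow> real^3 \<Rightarrow> 'b::real_normed_vector) \<Rightarrow> bool" where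
  "decays 0 r S f \<longleftrightarrow> decay_bound r S f"
| "decays (Suc n) r S f \<longleftrightarrow> decay_bound r S f \<and> (\<forall>s\<in>S. \<forall>x. f s differentiable (at x)) \<and>
     (\<forall>i. decays n r S (\<lambda>s. partial i (f s)))"

lemma decays_bound: "decays n r S f \<Longrightarrow> decay_bound r S f"
  by (cases n) auto

lemma decays_differentiable: "decays (Suc n) r S f \<Longrightarrow> s \<in> S \<Longrightarrow> f s differentiable (at x)"
  by auto

lemma decays_partial: "decays (Suc n) r S f \<Longrightarrow> decays n r S (\<lambda>s. partial i (f s))"
  by auto

lemma decays_continuous: "decays n r S f \<Longrightarrow> s \<in> S \<Longrightarrow> continuous_on UNIV (f s)"
  using decays_bound[of n r S f] by (auto simp: decay_bound_def)

lemma decay_bound_cong: "(\<And>s. s \<in> S \<Longrightarrow> f s = g s) \<Longrightarrow> decay_bound r S f \<longleftrightarrow> decay_bound r S g"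
  by (simp add: decay_bound_def)

lemma decays_cong: "(\<And>s. s \<in> S \<Longrightarrow> f s = g s) \<Longrightarrow> decays n r S f \<longleftrightarrow> decays n r S g"
proof (induction n arbitrary: f g)
  case 0
  then show ?case by (simp add: decay_bound_cong[of S f g])
next
  case (Suc n)
  have "decays n r S (\<lambda>s. partial i (f s)) \<longleftrightarrow> decays n r S (\<lambda>s. partial i (g s))" for i
    by (rule Suc.IH) (simp add: Suc.prems)
  then show ?case
    using Suc.prems decay_bound_cong[of S f g r] by simp
qed

lemma decays_transfer: "decays n r S f \<Longrightarrow> (\<And>s x. s \<in> S \<Longrightarrow> g s x = f s x) \<Longrightarrow> decays n r S g"
  using decays_cong[of S f g n r] by (auto simp: fun_eq_iff)

lemma decays_SucD: "decays (Suc n) r S f \<Longrightarrow> decays n r S f"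
proof (induction n arbitrary: f)
  case (Suc n)
  from Suc.prems have "\<And>i. decays (Suc n) r S (\<lambda>s. partial i (f s))"
    by auto
  from Suc.IH[OF this] Suc.prems show ?case
    by auto
qed auto

lemma decays_mono: "decays n r S f \<Longrightarrow> m \<le> n \<Longrightarrow> decays m r S f"
proof (induction n)
  case (Suc n)
  then show ?case
    using decays_SucD[of n r S f] by (cases "m = Suc n") auto
qed auto

lemma decays_subset: "decays n r S f \<Longrightarrow> S' \<subseteq> S \<Longrightarrow> decays n r S' f"
proof (induction n arbitrary: f)
  case 0
  then show ?case by (simp add: decay_bound_def) blast
next
  case (Suc n)
  then have "decay_bound r S' f"
    by (simp add: decay_bound_def) blast
  then show ?case
    using Suc by auto
qed

lemma decay_bound_weaken:
  assumes "decay_bound r S f" "q \<le> r"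
  shows "decay_bound q S f"
proof -
  from assms obtain C where C: "\<And>s x. s \<in> S \<Longrightarrow> norm (f s x) \<le> C * (1 + norm x) powr (- r)"
    and cont: "\<forall>s\<in>S. continuous_on UNIV (f s)"
    unfolding decay_bound_def by blast
  have "norm (f s x) \<le> \<bar>C\<bar> * (1 + norm x) powr (- q)" if "s \<in> S" for s x
  proof -
    have "(1 + norm x) powr (- r) \<le> (1 + norm x) powr (- q)"
      using assms by (intro powr_mono) auto
    then have "\<bar>C\<bar> * (1 + norm x) powr (- r) \<le> \<bar>C\<bar> * (1 + norm x) powr (- q)"
      by (rule mult_left_mono) simp
    moreover have "C * (1 + norm x) powr (- r) \<le> \<bar>C\<bar> * (1 + norm x) powr (- r)"
      by (rule mult_right_mono) auto
    ultimately show ?thesis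
      using C[OF that, of x] by linarith
  qed
  then show ?thesis
    using cont unfolding decay_bound_def by blast
qed

lemma decays_weaken: "decays n r S f \<Longrightarrow> q \<le> r \<Longrightarrow> decays n q S f"
  by (induction n arbitrary: f) (auto intro: decay_bound_weaken)

lemma decay_bound_linear:
  assumes T: "bounded_linear T" and f: "decay_bound r S f"
  shows "decay_bound r S (\<lambda>s x. T (f s x))"
proof -
  from f obtain C where C: "\<And>s x. s \<in> S \<Longrightarrow> norm (f s x) \<le> C * (1 + norm x) powr (- r)"
    and cont: "\<And>s. s \<in> S \<Longrightarrow> continuous_on UNIV (f s)"
    unfolding decay_bound_def by blast
  obtain K where K: "0 \<le> K" "\<And>y. norm (T y) \<le> norm y * K"
    using bounded_linear.nonneg_bounded[OF T] by blast
  have "norm (T (f s x)) \<le> (K * C) * (1 + norm x) powr (- r)" if "s \<in> S" for s x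
    using order_trans[OF K(2) mult_right_mono[OF C[OF that, of x] K(1)]] by (simp add: ac_simps)
  moreover have "continuous_on UNIV (\<lambda>x. T (f s x))" if "s \<in> S" for s
    by (rule bounded_linear.continuous_on[OF T cont[OF that]])
  ultimately show ?thesis
    unfolding decay_bound_def by blast
qed

lemma decays_linear:
  assumes T: "bounded_linear T"
  shows "decays n r S f \<Longrightarrow> decays n r S (\<lambda>s x. T (f s x))"
proof (induction n arbitrary: f)
  case 0
  then show ?case using decay_bound_linear[OF T] by simp
next
  case (Suc n)
  have "decays n r S (\<lambda>s. partial i (\<lambda>x. T (f s x)))" for i
  proof -
    have "decays n r S (\<lambda>s x. T (partial i (f s) x))"
      using Suc by auto
    then show ?thesis
      by (rule decays_transfer) (simp add: partial_linear(2)[OF T] decays_differentiable[OF Suc.prems])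
  qed
  then show ?case
    using Suc.prems by (simp add: decay_bound_linear[OF T] partial_linear(1)[OF T])
qed

lemma decay_bound_add:
  assumes f: "decay_bound r S f" and g: "decay_bound r S g"
  shows "decay_bound r S (\<lambda>s x. f s x + g s x)"
proof -
  from f g obtain C D where C: "\<And>s x. s \<in> S \<Longrightarrow> norm (f s x) \<le> C * (1 + norm x) powr (- r)"
    and D: "\<And>s x. s \<in> S \<Longrightarrow> norm (g s x) \<le> D * (1 + norm x) powr (- r)"
    unfolding decay_bound_def by blast
  have "norm (f s x + g s x) \<le> (C + D) * (1 + norm x) powr (- r)" if "s \<in> S" for s x
    using norm_triangle_ineq[of "f s x" "g s x"] C[OF that, of x] D[OF that, of x]
    by (simp add: distrib_right)
  then show ?thesis
    using f g unfolding decay_bound_def by (auto intro!: continuous_intros)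
qed

lemma decays_add: "decays n r S f \<Longrightarrow> decays n r S g \<Longrightarrow> decays n r S (\<lambda>s x. f s x + g s x)"
proof (induction n arbitrary: f g)
  case 0
  then show ?case using decay_bound_add[of r S f g] by simp
next
  case (Suc n)
  have "decays n r S (\<lambda>s. partial i (\<lambda>x. f s x + g s x))" for i
  proof -
    have "decays n r S (\<lambda>s x. partial i (f s) x + partial i (g s) x)"
      using Suc by auto
    then show ?thesis
      by (rule decays_transfer)
        (simp add: partial_add decays_differentiable[OF Suc.prems(1)] decays_differentiable[OF Suc.prems(2)])
  qed
  then show ?case
    using Suc.prems by (simp add: decay_bound_add differentiable_add)
qed

lemma decay_bound_zero: "decay_bound r S (\<lambda>s x. 0)"
  by (auto simp: decay_bound_def intro!: exI[of _ 0])

lemma decays_zero: "decays n r S (\<lambda>s x. 0)"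
proof (induction n)
  case (Suc n)
  have "partial i (\<lambda>x::real^3. 0::'b) = (\<lambda>x. 0)" for i
    using partial_unique[OF has_derivative_const] by (auto simp: fun_eq_iff)
  then show ?case
    using Suc by (simp add: decay_bound_zero)
qed (simp add: decay_bound_zero)

lemma decays_sum:
  assumes "\<And>k. k \<in> K \<Longrightarrow> decays n r S (f k)"
  shows "decays n r S (\<lambda>s x. \<Sum>k\<in>K. f k s x)"
  using assms
  by (induction K rule: infinite_finite_induct) (simp_all add: decays_zero decays_add)

lemma decay_bound_bilinear:
  assumes P: "bounded_bilinear P" and f: "decay_bound r S f" and g: "decay_bound q S g"
  shows "decay_bound (r + q) S (\<lambda>s x. P (f s x) (g s x))"
proof -
  from f g obtain C D where C: "\<And>s x. s \<in> S \<Longrightarrow> norm (f s x) \<le> C * (1 + norm x) powr (- r)"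
    and D: "\<And>s x. s \<in> S \<Longrightarrow> norm (g s x) \<le> D * (1 + norm x) powr (- q)"
    and cont: "\<And>s. s \<in> S \<Longrightarrow> continuous_on UNIV (f s)" "\<And>s. s \<in> S \<Longrightarrow> continuous_on UNIV (g s)"
    unfolding decay_bound_def by blast
  obtain K where K: "0 \<le> K" "\<And>a b. norm (P a b) \<le> norm a * norm b * K"
    using bounded_bilinear.nonneg_bounded[OF P] by blast
  have "norm (P (f s x) (g s x)) \<le> (C * D * K) * (1 + norm x) powr (- (r + q))" if "s \<in> S" for s x
  proof -
    have "norm (f s x) * norm (g s x) \<le> (C * (1 + norm x) powr (- r)) * (D * (1 + norm x) powr (- q))"
      using C[OF that, of x] D[OF that, of x] order_trans[OF norm_ge_zero C[OF that, of x]]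
      by (intro mult_mono) auto
    also have "\<dots> = C * D * (1 + norm x) powr (- (r + q))"
      using powr_add[of "1 + norm x" "- r" "- q"] by simp
    finally have "norm (f s x) * norm (g s x) * K \<le> C * D * (1 + norm x) powr (- (r + q)) * K"
      by (rule mult_right_mono) (rule K)
    then show ?thesis
      using K(2)[of "f s x" "g s x"] by (simp add: ac_simps)
  qed
  moreover have "continuous_on UNIV (\<lambda>x. P (f s x) (g s x))" if "s \<in> S" for s
    by (rule bounded_bilinear.continuous_on[OF P cont[OF that]])
  ultimately show ?thesis
    unfolding decay_bound_def by blast
qed

text \<open>By the Leibniz rule the decay rates add. This is what makes \<open>u \<otimes> u\<close> integrable even if \<open>u\<close> is not.\<close>

lemma decays_bilinear:
  assumes P: "bounded_bilinear P"
  shows "decays n r S f \<Longrightarrow> decays n q S g \<Longrightarrow> decays n (r + q) S (\<lambda>s x. P (f s x) (g s x))"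
proof (induction n arbitrary: f g)
  case 0
  then show ?case using decay_bound_bilinear[OF P, of r S f q g] by simp
next
  case (Suc n)
  have "decays n (r + q) S (\<lambda>s. partial i (\<lambda>x. P (f s x) (g s x)))" for i
  proof -
    have "decays n (r + q) S (\<lambda>s x. P (f s x) (partial i (g s) x) + P (partial i (f s) x) (g s x))"
      using Suc.IH[OF decays_SucD[OF Suc.prems(1)] decays_partial[OF Suc.prems(2), of i]]
        Suc.IH[OF decays_partial[OF Suc.prems(1), of i] decays_SucD[OF Suc.prems(2)]]
      by (rule decays_add)
    then show ?thesis
      by (rule decays_transfer)
        (simp add: partial_bilinear(2)[OF P] decays_differentiable[OF Suc.prems(1)] decays_differentiable[OF Suc.prems(2)])
  qed
  then show ?case
    using Suc.prems by (simp add: decay_bound_bilinear[OF P] partial_bilinear(1)[OF P])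
qed

lemma smooth_on_differentiable:
  assumes "smooth_on S f" "x \<in> S"
  shows "f differentiable (at x)"
  using assms unfolding smooth_on_def by (metis Ck_on.simps(2))

lemma smooth_on_continuous: "smooth_on S f \<Longrightarrow> continuous_on S f"
  unfolding smooth_on_def by (metis Ck_on.simps(1))

lemma smooth_on_frechet:
  assumes "smooth_on S f"
  shows "smooth_on S (\<lambda>x. frechet_derivative f (at x) v)"
  using assms unfolding smooth_on_def by (metis Ck_on.simps(2))

lemma smooth_on_partial: "smooth_on S f \<Longrightarrow> smooth_on S (partial i f)"
  using smooth_on_frechet[of S f "axis i 1"] by (simp add: partial_def[abs_def])

lemma decays_if_spatial_decay:
  assumes f: "spatial_decay r f"
  shows "decays n r {0..T} f"
proof -
  have sm: "smooth_on UNIV (foldr partial ks (f t))" if "0 \<le> t" for t ks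
    using f that by (induction ks) (auto simp: spatial_decay_def intro: smooth_on_partial)
  have bd: "decay_bound r {0..T} (\<lambda>t. foldr partial ks (f t))" for ks
    using f sm by (auto simp: decay_bound_def spatial_decay_def intro: smooth_on_continuous)
  have "decays n r {0..T} (\<lambda>t. foldr partial ks (f t))" for ks
  proof (induction n arbitrary: ks)
    case 0
    show ?case
      by (simp add: bd)
  next
    case (Suc n)
    show ?case
      using Suc.IH[of "_ # ks"] smooth_on_differentiable[OF sm] by (simp add: bd)
  qed
  from this[of "[]"] show ?thesis
    by simp
qed

section \<open>Fourier transforms of decaying fields\<close>

abbreviation ft :: "(real^3 \<Rightarrow> real) \<Rightarrow> real^3 \<Rightarrow> complex" where
  "ft f \<equiv> fourier (\<lambda>y. complex_of_real (f y))"

lemma decay_boundE: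
  assumes "decay_bound r S f"
  obtains C where "0 \<le> C" "\<And>s x. s \<in> S \<Longrightarrow> norm (f s x) \<le> C * (1 + norm x) powr (- r)"
proof -
  from assms obtain C where C: "\<And>s x. s \<in> S \<Longrightarrow> norm (f s x) \<le> C * (1 + norm x) powr (- r)"
    unfolding decay_bound_def by blast
  have "norm (f s x) \<le> \<bar>C\<bar> * (1 + norm x) powr (- r)" if "s \<in> S" for s x
    using C[OF that, of x] mult_right_mono[OF abs_ge_self, of "(1 + norm x) powr (- r)" C] by simp
  then show ?thesis
    using that[of "\<bar>C\<bar>"] by simp
qed

lemma decay_bounded:
  assumes "decay_bound r S f" "0 \<le> r"
  obtains B where "0 \<le> B" "\<And>s x. s \<in> S \<Longrightarrow> norm (f s x) \<le> B"
proof -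
  obtain C where C: "0 \<le> C" "\<And>s x. s \<in> S \<Longrightarrow> norm (f s x) \<le> C * (1 + norm x) powr (- 0)"
    using decay_boundE[OF decay_bound_weaken[OF assms]] by blast
  have "1 + norm x \<noteq> 0" for x :: "real^3"
    using norm_ge_zero[of x] by linarith
  then show ?thesis
    using that[of C] C by simp
qed

lemma decay_integrable:
  fixes f :: "'i \<Rightarrow> real^3 \<Rightarrow> 'b::{banach, second_countable_topology}"
  assumes f: "decay_bound r S f" and "3 < r" "s \<in> S"
  shows "integrable lborel (f s)"
proof -
  obtain C where C: "0 \<le> C" "\<And>s x. s \<in> S \<Longrightarrow> norm (f s x) \<le> C * (1 + norm x) powr (- r)"
    using decay_boundE[OF f] by blast
  have w: "integrable lborel (\<lambda>x::real^3. C * (1 + norm x) powr (- r))"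
    using integrable_weight[OF \<open>3 < r\<close>] by simp
  have "continuous_on UNIV (f s)"
    using f \<open>s \<in> S\<close> by (simp add: decay_bound_def)
  then show ?thesis
    by (intro Bochner_Integration.integrable_bound[OF w] AE_I2)
      (use C \<open>s \<in> S\<close> in \<open>auto intro: borel_measurable_continuous_onI simp: abs_mult\<close>)
qed

lemma integrable_weight_bound:
  fixes g :: "real^3 \<Rightarrow> complex"
  assumes "3 < r" and "\<And>\<xi>. norm (g \<xi>) \<le> C * (1 + norm \<xi>) powr (- r)" and "g \<in> borel_measurable borel"
  shows "integrable lborel g"
proof (rule Bochner_Integration.integrable_bound)
  show "integrable lborel (\<lambda>x::real^3. C * (1 + norm x) powr (- r))"
    using integrable_weight[OF assms(1)] by simp
  have "norm (g \<xi>) \<le> norm (C * (1 + norm \<xi>) powr (- r))" for \<xi>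
    using assms(2)[of \<xi>] by simp
  then show "AE \<xi> in lborel. norm (g \<xi>) \<le> norm (C * (1 + norm \<xi>) powr (- r))"
    by simp
qed (use assms in simp)

text \<open>Integration by parts against \<open>cis (- (\<xi> \<bullet> x))\<close>.\<close>

lemma fourier_partial:
  assumes diff: "\<And>x. f differentiable (at x)" and f: "integrable lborel f"
    and f': "integrable lborel (partial i f)" and cont: "continuous_on UNIV (partial i f)"
  shows "ft (partial i f) \<xi> = \<i> * of_real (\<xi> $ i) * ft f \<xi>"
proof -
  let ?e = "\<lambda>x. cis (- (\<xi> \<bullet> x))"
  let ?D = "\<lambda>x. - \<i> * of_real (\<xi> $ i) * (?e x * of_real (f x)) + ?e x * of_real (partial i f x)"
  have cf: "continuous_on UNIV f"
    using diff differentiable_imp_continuous_within continuous_at_imp_continuous_on by blast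
  have der: "((\<lambda>s. ?e (x + s *\<^sub>R axis i 1) * of_real (f (x + s *\<^sub>R axis i 1))) has_vector_derivative ?D x) (at 0)" for x
  proof -
    have "((\<lambda>s. f (x + s *\<^sub>R axis i 1)) has_real_derivative partial i f x) (at 0)"
      using has_vector_derivative_partial[of f x 0 i] diff
      by (simp add: has_real_derivative_iff_has_vector_derivative)
    then have 1: "((\<lambda>s. complex_of_real (f (x + s *\<^sub>R axis i 1))) has_vector_derivative of_real (partial i f x)) (at 0)"
      by (rule has_vector_derivative_of_real)
    have 2: "((\<lambda>s. ?e (x + s *\<^sub>R axis i 1)) has_vector_derivative - \<i> * of_real (\<xi> $ i) * ?e x) (at 0)"
    proof -
      have "((\<lambda>s. - (\<xi> \<bullet> (x + s *\<^sub>R axis i 1))) has_derivative (\<lambda>s. - (\<xi> $ i) * s)) (at 0)"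
        by (auto intro!: derivative_eq_intros simp: inner_axis mult.commute)
      from has_derivative_cis[OF this] show ?thesis
        unfolding has_vector_derivative_def
        by (rule has_derivative_eq_rhs) (simp add: fun_eq_iff scaleR_conv_of_real)
    qed
    show ?thesis
      using has_vector_derivative_mult[OF 2 1] by (simp add: algebra_simps)
  qed
  have i1: "integrable lborel (\<lambda>x. ?e x * of_real (f x))"
    and i2: "integrable lborel (\<lambda>x. ?e x * of_real (partial i f x))"
    using f f' by (auto intro!: integrable_cis_mult(2))
  have "(\<integral>x. ?D x \<partial>lborel) = 0"
  proof (rule integral_directional_derivative_eq_0[OF der])
    show "integrable lborel ?D"
      using i1 i2 by (intro Bochner_Integration.integrable_add integrable_mult_right)
    show "continuous_on UNIV ?D"
      using cf cont by (intro continuous_intros) auto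
  qed (rule i1)
  also have "(\<integral>x. ?D x \<partial>lborel) = - \<i> * of_real (\<xi> $ i) * ft f \<xi> + ft (partial i f) \<xi>"
    using i1 i2 by (simp add: fourier_def)
  finally show ?thesis
    by (simp add: add_eq_0_iff)
qed

lemma fourier_partial_decays:
  assumes f: "decays (Suc n) r S f" and "3 < r" "s \<in> S"
  shows "ft (partial i (f s)) \<xi> = \<i> * of_real (\<xi> $ i) * ft (f s) \<xi>"
  using assms decay_integrable[OF decays_bound[OF f]] decay_integrable[OF decays_bound[OF decays_partial[OF f]]]
    decays_differentiable[OF f] decays_continuous[OF decays_partial[OF f]]
  by (intro fourier_partial) auto

text \<open>Since \<open>1 + norm \<xi> \<le> 1 + (\<Sum>i\<in>UNIV. \<bar>\<xi> $ i\<bar>)\<close>, each power of \<open>1 + norm \<xi>\<close> costs one derivative of \<open>f\<close>.\<close>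

lemma fourier_decay:
  assumes r: "3 < r"
  shows "decays n r S f \<Longrightarrow> \<exists>C. \<forall>s\<in>S. \<forall>\<xi>. norm (ft (f s) \<xi>) * (1 + norm \<xi>) ^ n \<le> C"
proof (induction n arbitrary: f)
  case 0
  then have f: "decay_bound r S f"
    by simp
  obtain C where C: "0 \<le> C" "\<And>s x. s \<in> S \<Longrightarrow> norm (f s x) \<le> C * (1 + norm x) powr (- r)"
    using decay_boundE[OF f] by blast
  have "norm (ft (f s) \<xi>) \<le> (\<integral>x. C * (1 + norm x) powr (- r) \<partial>(lborel :: (real^3) measure))" if "s \<in> S" for s \<xi>
  proof -
    have i: "integrable lborel (\<lambda>x. complex_of_real (f s x))"
      using decay_integrable[OF f r that] by (rule integrable_of_real)
    have "norm (ft (f s) \<xi>) \<le> (\<integral>x. norm (complex_of_real (f s x)) \<partial>lborel)"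
      by (rule fourier_bound[OF i])
    also have "\<dots> \<le> (\<integral>x. C * (1 + norm x) powr (- r) \<partial>(lborel :: (real^3) measure))"
      using C(2)[OF that] integrable_weight[OF r] integrable_norm[OF i] by (intro integral_mono) auto
    finally show ?thesis .
  qed
  then show ?case
    by auto
next
  case (Suc n)
  obtain C0 where C0: "\<And>s \<xi>. s \<in> S \<Longrightarrow> norm (ft (f s) \<xi>) * (1 + norm \<xi>) ^ n \<le> C0"
    using Suc.IH[OF decays_SucD[OF Suc.prems]] by blast
  have "\<exists>C. \<forall>s\<in>S. \<forall>\<xi>. norm (ft (partial i (f s)) \<xi>) * (1 + norm \<xi>) ^ n \<le> C" for i
    using Suc.IH[OF decays_partial[OF Suc.prems]] .
  then obtain C where C: "\<And>i s \<xi>. s \<in> S \<Longrightarrow> norm (ft (partial i (f s)) \<xi>) * (1 + norm \<xi>) ^ n \<le> C i"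
    by metis
  have "norm (ft (f s) \<xi>) * (1 + norm \<xi>) ^ Suc n \<le> C0 + (\<Sum>i\<in>UNIV. C i)" if "s \<in> S" for s \<xi>
  proof -
    have "1 + norm \<xi> \<le> 1 + (\<Sum>i\<in>UNIV. \<bar>\<xi> $ i\<bar>)"
      using norm_le_l1_cart[of \<xi>] by simp
    then have "norm (ft (f s) \<xi>) * (1 + norm \<xi>) ^ n * (1 + norm \<xi>)
        \<le> norm (ft (f s) \<xi>) * (1 + norm \<xi>) ^ n * (1 + (\<Sum>i\<in>UNIV. \<bar>\<xi> $ i\<bar>))"
      by (rule mult_left_mono) simp
    also have "\<dots> = norm (ft (f s) \<xi>) * (1 + norm \<xi>) ^ n +
        (\<Sum>i\<in>UNIV. norm (ft (partial i (f s)) \<xi>) * (1 + norm \<xi>) ^ n)"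
      by (simp add: fourier_partial_decays[OF Suc.prems r that] norm_mult distrib_left sum_distrib_left sum_distrib_right ac_simps)
    also have "\<dots> \<le> C0 + (\<Sum>i\<in>UNIV. C i)"
      using C0 C that by (intro add_mono sum_mono) auto
    finally show ?thesis
      by (simp add: ac_simps)
  qed
  then show ?case
    by blast
qed

lemma fourier_decay_powr:
  assumes r: "3 < r" and f: "decays n r S f"
  obtains C where "0 \<le> C" "\<And>s \<xi>. s \<in> S \<Longrightarrow> norm (ft (f s) \<xi>) \<le> C * (1 + norm \<xi>) powr (- real n)"
proof -
  obtain C where C: "\<And>s \<xi>. s \<in> S \<Longrightarrow> norm (ft (f s) \<xi>) * (1 + norm \<xi>) ^ n \<le> C"
    using fourier_decay[OF r f] by blast
  have "norm (ft (f s) \<xi>) \<le> \<bar>C\<bar> * (1 + norm \<xi>) powr (- real n)" if "s \<in> S" for s \<xi>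
  proof -
    have pos: "0 < 1 + norm \<xi>"
      using norm_ge_zero[of \<xi>] by linarith
    have "norm (ft (f s) \<xi>) * (1 + norm \<xi>) ^ n \<le> \<bar>C\<bar>"
      using C[OF that, of \<xi>] by linarith
    then show ?thesis
      using pos by (simp only: powr_minus powr_realpow) (simp add: divide_inverse[symmetric] pos_le_divide_eq)
  qed
  then show ?thesis
    using that[of "\<bar>C\<bar>"] by simp
qed

section \<open>The Leray projector on decaying fields\<close>

text \<open>The Fourier transform of component \<open>j\<close> of \<open>leray F\<close>.\<close>

definition leray_hat :: "(real^3 \<Rightarrow> real^3) \<Rightarrow> 3 \<Rightarrow> real^3 \<Rightarrow> complex" where
  "leray_hat F j \<xi> = (\<Sum>k\<in>UNIV. of_real (leray_symbol \<xi> $ j $ k) * ft (\<lambda>y. F y $ k) \<xi>)"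

lemma leray_nth: "leray F x $ j = Re (inv_fourier (leray_hat F j) x)"
  by (simp add: leray_def leray_hat_def[abs_def])

lemma riesz_symbol_bound: "\<bar>\<xi> $ j * \<xi> $ k / (norm (\<xi>::real^3))\<^sup>2\<bar> \<le> 1"
proof (cases "\<xi> = 0")
  case False
  have "\<bar>\<xi> $ j\<bar> * \<bar>\<xi> $ k\<bar> \<le> norm \<xi> * norm \<xi>"
    by (intro mult_mono component_le_norm_cart) auto
  then show ?thesis
    using False by (simp add: abs_mult power2_eq_square)
qed simp

lemma leray_symbol_bound: "\<bar>leray_symbol \<xi> $ j $ k\<bar> \<le> 2"
proof -
  have "\<bar>d - q\<bar> \<le> 2" if "\<bar>q\<bar> \<le> 1" "\<bar>d\<bar> \<le> 1" for d q :: real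
    using that by linarith
  from this[OF riesz_symbol_bound, of "if j = k then 1 else 0" \<xi> j k] show ?thesis
    by (simp only: leray_symbol_def vec_lambda_beta) simp
qed

lemma borel_measurable_leray_symbol [measurable]: "(\<lambda>\<xi>. leray_symbol \<xi> $ j $ k) \<in> borel_measurable borel"
  unfolding leray_symbol_def by simp

lemma decays_nth: "decays n r S F \<Longrightarrow> decays n r S (\<lambda>s y. F s y $ k)"
  by (rule decays_linear[OF bounded_linear_vec_nth])

lemma borel_measurable_ft:
  assumes "integrable lborel f"
  shows "ft f \<in> borel_measurable borel"
  using assms by (intro borel_measurable_continuous_onI continuous_on_fourier integrable_of_real)

lemma borel_measurable_leray_hat:
  assumes F: "\<And>k. integrable lborel (\<lambda>y. F y $ k)"
  shows "leray_hat F j \<in> borel_measurable borel"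
  unfolding leray_hat_def using borel_measurable_ft[OF F]
  by (intro borel_measurable_sum borel_measurable_times) auto

lemma leray_hat_bound:
  assumes r: "3 < r" and F: "decays n r S F"
  obtains C where "0 \<le> C" "\<And>s j \<xi>. s \<in> S \<Longrightarrow> norm (leray_hat (F s) j \<xi>) \<le> C * (1 + norm \<xi>) powr (- real n)"
proof -
  have "\<exists>C\<ge>0. \<forall>s\<in>S. \<forall>\<xi>. norm (ft (\<lambda>y. F s y $ k) \<xi>) \<le> C * (1 + norm \<xi>) powr (- real n)" for k
    using fourier_decay_powr[OF r decays_nth[OF F, of k]] by metis
  then obtain C where C: "\<And>k. 0 \<le> C k"
    "\<And>k s \<xi>. s \<in> S \<Longrightarrow> norm (ft (\<lambda>y. F s y $ k) \<xi>) \<le> C k * (1 + norm \<xi>) powr (- real n)"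
    by metis
  have "norm (leray_hat (F s) j \<xi>) \<le> (\<Sum>k\<in>UNIV. 2 * C k) * (1 + norm \<xi>) powr (- real n)" if "s \<in> S" for s j \<xi>
  proof -
    have "norm (leray_hat (F s) j \<xi>) \<le> (\<Sum>k\<in>UNIV. \<bar>leray_symbol \<xi> $ j $ k\<bar> * norm (ft (\<lambda>y. F s y $ k) \<xi>))"
      unfolding leray_hat_def by (rule order_trans[OF norm_sum]) (simp add: norm_mult)
    also have "\<dots> \<le> (\<Sum>k\<in>UNIV. 2 * (C k * (1 + norm \<xi>) powr (- real n)))"
      using leray_symbol_bound C(2)[OF that] by (intro sum_mono mult_mono) auto
    finally show ?thesis
      by (simp add: sum_distrib_right mult.assoc)
  qed
  moreover have "0 \<le> (\<Sum>k\<in>UNIV. 2 * C k)"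
    using C(1) by (intro sum_nonneg) simp
  ultimately show ?thesis
    using that by blast
qed

lemma decays_nth_integrable:
  fixes F :: "'i \<Rightarrow> real^3 \<Rightarrow> real^3"
  assumes "3 < r" "decays n r S F" "s \<in> S"
  shows "integrable lborel (\<lambda>y. F s y $ k)"
  using decay_integrable[OF decays_bound[OF decays_nth[OF assms(2)]] assms(1,3)] .

text \<open>Four derivatives suffice because 4 is the first integer above the dimension.\<close>

lemma leray_hat_integrable:
  assumes r: "3 < r" and F: "decays 4 r S F" and s: "s \<in> S"
  shows "integrable lborel (leray_hat (F s) j)"
proof -
  obtain C where C: "0 \<le> C" "\<And>s j \<xi>. s \<in> S \<Longrightarrow> norm (leray_hat (F s) j \<xi>) \<le> C * (1 + norm \<xi>) powr (- real 4)"
    using leray_hat_bound[OF r F] by blast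
  show ?thesis
    using C s by (intro integrable_weight_bound[where r = 4] borel_measurable_leray_hat[OF decays_nth_integrable[OF r F s]]) auto
qed

lemma norm_vec3_bound:
  fixes v :: "real^3"
  assumes "\<And>j. \<bar>v $ j\<bar> \<le> B"
  shows "norm v \<le> 3 * B"
proof -
  have "norm v \<le> (\<Sum>j\<in>UNIV. \<bar>v $ j\<bar>)"
    by (rule norm_le_l1_cart)
  also have "\<dots> \<le> (\<Sum>j\<in>(UNIV::3 set). B)"
    using assms by (intro sum_mono)
  finally show ?thesis
    by simp
qed

lemma leray_bounded:
  assumes r: "3 < r" and F: "decays 4 r S F"
  obtains B where "0 \<le> B" "\<And>s x. s \<in> S \<Longrightarrow> norm (leray (F s) x) \<le> B"
proof -
  obtain C where C: "0 \<le> C" "\<And>s j \<xi>. s \<in> S \<Longrightarrow> norm (leray_hat (F s) j \<xi>) \<le> C * (1 + norm \<xi>) powr (- real 4)"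
    using leray_hat_bound[OF r F] by blast
  let ?I = "\<integral>\<xi>. C * (1 + norm \<xi>) powr (- real 4) \<partial>(lborel :: (real^3) measure)"
  have w: "integrable lborel (\<lambda>x::real^3. C * (1 + norm x) powr (- real 4))"
    using integrable_weight[of 4] by simp
  have "\<bar>leray (F s) x $ j\<bar> \<le> ?I" if "s \<in> S" for s x j
  proof -
    note i = leray_hat_integrable[OF r F that, of j]
    have "\<bar>leray (F s) x $ j\<bar> \<le> (\<integral>\<xi>. norm (leray_hat (F s) j \<xi>) \<partial>lborel)"
      unfolding leray_nth by (rule order_trans[OF abs_Re_le_cmod inv_fourier_bound[OF i]])
    also have "\<dots> \<le> ?I"
      using C(2)[OF that] w integrable_norm[OF i] by (intro integral_mono) auto
    finally show ?thesis .
  qed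
  then have "norm (leray (F s) x) \<le> 3 * ?I" if "s \<in> S" for s x
    using that by (intro norm_vec3_bound) auto
  moreover have "0 \<le> ?I"
    using C(1) by (intro integral_nonneg_AE) auto
  ultimately show ?thesis
    using that[of "3 * ?I"] by simp
qed

lemma leray_continuous:
  assumes "\<And>j. integrable lborel (leray_hat F j)"
  shows "continuous_on UNIV (leray F)"
proof -
  have "continuous_on UNIV (\<lambda>x. Re (inv_fourier (leray_hat F j) x))" for j
    by (intro continuous_intros continuous_on_inv_fourier assms)
  then have "continuous_on UNIV (\<lambda>x. \<chi> j. Re (inv_fourier (leray_hat F j) x))"
    by (rule continuous_on_vec_lambda)
  moreover have "leray F = (\<lambda>x. \<chi> j. Re (inv_fourier (leray_hat F j) x))"
    by (simp add: fun_eq_iff vec_eq_iff leray_nth)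
  ultimately show ?thesis
    by (simp only:)
qed

text \<open>Every heat flow of a projected field in the formula is evaluated through this frequency integral.\<close>

lemma heat_leray_nth:
  assumes r: "3 < r" and F: "decays 4 r S F" and s: "s \<in> S" and tau: "0 \<le> \<tau>"
  shows "heat \<tau> (leray (F s)) x $ j =
    Re (inv_fourier (\<lambda>\<xi>. of_real (exp (- \<tau> * (norm \<xi>)\<^sup>2)) * leray_hat (F s) j \<xi>) x)"
proof -
  note i = leray_hat_integrable[OF r F s]
  have m: "leray (F s) \<in> borel_measurable borel" "inv_fourier (leray_hat (F s) j) \<in> borel_measurable borel"
    using leray_continuous[OF i] continuous_on_inv_fourier[OF i] by (auto intro: borel_measurable_continuous_onI)
  obtain B where B: "\<And>x. norm (leray (F s) x) \<le> B"
    using leray_bounded[OF r F] s by metis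
  have "heat \<tau> (leray (F s)) x $ j = heat \<tau> (\<lambda>y. leray (F s) y $ j) x"
    by (rule heat_bounded_linear[OF bounded_linear_vec_nth tau m(1) B, symmetric])
  also have "\<dots> = Re (heat \<tau> (inv_fourier (leray_hat (F s) j)) x)"
    unfolding leray_nth
    by (rule heat_bounded_linear[OF bounded_linear_Re tau m(2) inv_fourier_bound[OF i]])
  finally show ?thesis
    by (simp add: heat_inv_fourier[OF i tau])
qed

lemma leray_hat_diff:
  assumes F: "\<And>k. integrable lborel (\<lambda>y. F y $ k)" and G: "\<And>k. integrable lborel (\<lambda>y. G y $ k)"
  shows "leray_hat (\<lambda>y. F y - G y) j \<xi> = leray_hat F j \<xi> - leray_hat G j \<xi>"
proof -
  have "ft (\<lambda>y. (F y - G y) $ k) \<xi> = ft (\<lambda>y. F y $ k) \<xi> - ft (\<lambda>y. G y $ k) \<xi>" for k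
    using integrable_cis_mult(2)[OF integrable_of_real[OF F[of k]], of \<xi>]
      integrable_cis_mult(2)[OF integrable_of_real[OF G[of k]], of \<xi>]
    by (simp add: fourier_def right_diff_distrib)
  then show ?thesis
    by (simp add: leray_hat_def right_diff_distrib sum_subtractf)
qed

lemma leray_diff:
  assumes F: "\<And>k. integrable lborel (\<lambda>y. F y $ k)" "\<And>j. integrable lborel (leray_hat F j)"
    and G: "\<And>k. integrable lborel (\<lambda>y. G y $ k)" "\<And>j. integrable lborel (leray_hat G j)"
  shows "leray (\<lambda>y. F y - G y) x = leray F x - leray G x"
proof -
  have "inv_fourier (leray_hat (\<lambda>y. F y - G y) j) x = inv_fourier (leray_hat F j) x - inv_fourier (leray_hat G j) x" for j
    using integrable_cis_mult(1)[OF F(2), of x j] integrable_cis_mult(1)[OF G(2), of x j]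
    unfolding inv_fourier_def leray_hat_diff[OF F(1) G(1)] by (simp add: right_diff_distrib scaleR_diff_right)
  then show ?thesis
    by (simp add: vec_eq_iff leray_nth)
qed

section \<open>Symmetry of second derivatives\<close>

text \<open>Schwarz's theorem along two directions. The mean value theorem, applied twice to the second
  difference of \<open>f\<close> over a parallelogram, expresses it by either mixed derivative.\<close>

lemma schwarz_directional:
  fixes f :: "'a::real_normed_vector \<Rightarrow> real"
  assumes U: "open U" "x \<in> U"
    and fv: "\<And>y. y \<in> U \<Longrightarrow> ((\<lambda>s. f (y + s *\<^sub>R v)) has_real_derivative fv y) (at 0)"
    and fw: "\<And>y. y \<in> U \<Longrightarrow> ((\<lambda>s. f (y + s *\<^sub>R w)) has_real_derivative fw y) (at 0)"
    and fvw: "\<And>y. y \<in> U \<Longrightarrow> ((\<lambda>s. fv (y + s *\<^sub>R w)) has_real_derivative fvw y) (at 0)"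
    and fwv: "\<And>y. y \<in> U \<Longrightarrow> ((\<lambda>s. fw (y + s *\<^sub>R v)) has_real_derivative fwv y) (at 0)"
    and cont: "isCont fvw x" "isCont fwv x"
  shows "fvw x = fwv x"
proof -
  have shift: "((\<lambda>s. g (y + s *\<^sub>R b)) has_real_derivative g' (y + s *\<^sub>R b)) (at s)"
    if "\<And>y. y \<in> U \<Longrightarrow> ((\<lambda>s. g (y + s *\<^sub>R b)) has_real_derivative g' y) (at 0)" "y + s *\<^sub>R b \<in> U"
    for g g' :: "'a \<Rightarrow> real" and y b s
    using that(1)[OF that(2)] unfolding DERIV_def by (simp add: algebra_simps)
  \<comment> \<open>The second difference over a small parallelogram, written by the mean value theorem first in
    direction \<open>a\<close>, then in direction \<open>b\<close>.\<close>
  have second_difference: "\<exists>s r. 0 < s \<and> s < h \<and> 0 < r \<and> r < h \<and>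
      f (x + h *\<^sub>R a + h *\<^sub>R b) - f (x + h *\<^sub>R a) - (f (x + h *\<^sub>R b) - f x) = h * (h * gab (x + s *\<^sub>R a + r *\<^sub>R b))"
    if h: "0 < h" and sub: "\<And>s r. 0 \<le> s \<Longrightarrow> s \<le> h \<Longrightarrow> 0 \<le> r \<Longrightarrow> r \<le> h \<Longrightarrow> x + s *\<^sub>R a + r *\<^sub>R b \<in> U"
      and ga: "\<And>y. y \<in> U \<Longrightarrow> ((\<lambda>s. f (y + s *\<^sub>R a)) has_real_derivative ga y) (at 0)"
      and gab: "\<And>y. y \<in> U \<Longrightarrow> ((\<lambda>s. ga (y + s *\<^sub>R b)) has_real_derivative gab y) (at 0)"
    for a b :: 'a and ga gab :: "'a \<Rightarrow> real" and h
  proof -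
    have "((\<lambda>s. f (x + h *\<^sub>R b + s *\<^sub>R a) - f (x + s *\<^sub>R a)) has_real_derivative
        ga (x + h *\<^sub>R b + s *\<^sub>R a) - ga (x + s *\<^sub>R a)) (at s)" if "0 \<le> s" "s \<le> h" for s
      using sub[of s h] sub[of s 0] that h
      by (intro DERIV_diff shift[of f a ga] ga) (auto simp: algebra_simps)
    from MVT2[OF h this] obtain s where s: "0 < s" "s < h"
      "(f (x + h *\<^sub>R b + h *\<^sub>R a) - f (x + h *\<^sub>R a)) - (f (x + h *\<^sub>R b) - f x) =
        h * (ga (x + h *\<^sub>R b + s *\<^sub>R a) - ga (x + s *\<^sub>R a))"
      by auto
    have "((\<lambda>r. ga (x + s *\<^sub>R a + r *\<^sub>R b)) has_real_derivative gab (x + s *\<^sub>R a + r *\<^sub>R b)) (at r)"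
      if "0 \<le> r" "r \<le> h" for r
      using sub[of s r] that s by (intro shift[of ga b gab] gab) auto
    from MVT2[OF h this] obtain r where r: "0 < r" "r < h"
      "ga (x + s *\<^sub>R a + h *\<^sub>R b) - ga (x + s *\<^sub>R a) = h * gab (x + s *\<^sub>R a + r *\<^sub>R b)"
      by auto
    show ?thesis
      using s r by (intro exI[of _ s] exI[of _ r]) (simp add: algebra_simps)
  qed
  have "\<bar>fvw x - fwv x\<bar> < e" if "0 < e" for e
  proof -
    have "\<forall>\<^sub>F y in nhds x. dist (fvw y) (fvw x) < e / 2" "\<forall>\<^sub>F y in nhds x. dist (fwv y) (fwv x) < e / 2"
      using tendstoD[OF cont(1)[unfolded isCont_def], of "e / 2"] tendstoD[OF cont(2)[unfolded isCont_def], of "e / 2"] that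
      by (simp_all add: eventually_nhds_conv_at)
    then have "\<forall>\<^sub>F y in nhds x. y \<in> U \<and> dist (fvw y) (fvw x) < e / 2 \<and> dist (fwv y) (fwv x) < e / 2"
      using U by (intro eventually_conj eventually_nhds_in_open)
    then obtain d where d: "0 < d"
      "\<And>y. dist y x < d \<Longrightarrow> y \<in> U \<and> dist (fvw y) (fvw x) < e / 2 \<and> dist (fwv y) (fwv x) < e / 2"
      unfolding eventually_nhds_metric by blast
    define h where "h = d / (2 * (norm v + norm w + 1))"
    have n: "0 < norm v + norm w + 1"
      using norm_ge_zero[of v] norm_ge_zero[of w] by linarith
    then have h: "0 < h"
      using d by (simp add: h_def)
    have near: "dist (x + s *\<^sub>R v + r *\<^sub>R w) x < d" if "0 \<le> s" "s \<le> h" "0 \<le> r" "r \<le> h" for s r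
    proof -
      have "dist (x + s *\<^sub>R v + r *\<^sub>R w) x \<le> s * norm v + r * norm w"
        using norm_triangle_ineq[of "s *\<^sub>R v" "r *\<^sub>R w"] that by (simp add: dist_norm add.assoc)
      also have "\<dots> \<le> h * norm v + h * norm w"
        using that by (intro add_mono mult_right_mono) auto
      also have "\<dots> \<le> h * (norm v + norm w + 1)"
        using h by (simp add: algebra_simps)
      also have "\<dots> = d / 2"
      proof -
        have "d / (2 * N) * N = d / 2" if "0 < N" for N :: real
          using that by simp
        from this[OF n] show ?thesis
          by (simp only: h_def)
      qed
      finally show ?thesis
        using d by simp
    qed
    obtain s r where 1: "0 < s" "s < h" "0 < r" "r < h"
      "f (x + h *\<^sub>R v + h *\<^sub>R w) - f (x + h *\<^sub>R v) - (f (x + h *\<^sub>R w) - f x) = h * (h * fvw (x + s *\<^sub>R v + r *\<^sub>R w))"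
      using second_difference[OF h _ fv fvw] d(2)[OF near] by blast
    obtain s' r' where 2: "0 < s'" "s' < h" "0 < r'" "r' < h"
      "f (x + h *\<^sub>R w + h *\<^sub>R v) - f (x + h *\<^sub>R w) - (f (x + h *\<^sub>R v) - f x) = h * (h * fwv (x + s' *\<^sub>R w + r' *\<^sub>R v))"
    proof -
      have "x + s *\<^sub>R w + r *\<^sub>R v \<in> U" if "0 \<le> s" "s \<le> h" "0 \<le> r" "r \<le> h" for s r
        using d(2)[OF near[of r s]] that by (simp add: add.commute add.left_commute)
      from second_difference[OF h this fw fwv] show ?thesis
        using that by blast
    qed
    have "h * (h * fvw (x + s *\<^sub>R v + r *\<^sub>R w)) = h * (h * fwv (x + r' *\<^sub>R v + s' *\<^sub>R w))"
      using 1(5) 2(5) by (simp add: algebra_simps)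
    then have "fvw (x + s *\<^sub>R v + r *\<^sub>R w) = fwv (x + r' *\<^sub>R v + s' *\<^sub>R w)"
      using h by simp
    moreover have "dist (fvw (x + s *\<^sub>R v + r *\<^sub>R w)) (fvw x) < e / 2"
      using d(2)[OF near[of s r]] 1 by simp
    moreover have "dist (fwv (x + r' *\<^sub>R v + s' *\<^sub>R w)) (fwv x) < e / 2"
      using d(2)[OF near[of r' s']] 2 by simp
    ultimately show ?thesis
      unfolding dist_real_def by linarith
  qed
  from this[of "\<bar>fvw x - fwv x\<bar>"] show ?thesis
    by force
qed

lemma directional_derivative:
  fixes f :: "'a::real_normed_vector \<Rightarrow> 'b::real_normed_vector"
  assumes "f differentiable (at y)"
  shows "((\<lambda>s. f (y + s *\<^sub>R v)) has_vector_derivative frechet_derivative f (at y) v) (at 0)"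
proof -
  note D = differentiable_frechet[OF assms]
  have "((\<lambda>s. f (y + s *\<^sub>R v)) has_derivative (\<lambda>h. frechet_derivative f (at y) (h *\<^sub>R v))) (at 0)"
    by (rule has_derivative_compose[of "\<lambda>s. y + s *\<^sub>R v"]) (use D in \<open>auto intro!: derivative_eq_intros\<close>)
  then show ?thesis
    unfolding has_vector_derivative_def by (simp add: linear_cmul[OF has_derivative_linear[OF D]])
qed

lemma frechet_derivative_commute:
  fixes f :: "'a::euclidean_space \<Rightarrow> 'b::real_inner"
  assumes f: "smooth_on U f" and U: "open U" "x \<in> U"
  shows "frechet_derivative (\<lambda>y. frechet_derivative f (at y) v) (at x) w =
    frechet_derivative (\<lambda>y. frechet_derivative f (at y) w) (at x) v"
proof -
  let ?D = "\<lambda>f v y. frechet_derivative f (at y) v"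
  have dir: "((\<lambda>s. g (y + s *\<^sub>R b) \<bullet> c) has_real_derivative ?D g b y \<bullet> c) (at 0)"
    if "smooth_on U g" "y \<in> U" for g :: "'a \<Rightarrow> 'b" and b y c
    using bounded_linear.has_vector_derivative[OF bounded_linear_inner_left
        directional_derivative[OF smooth_on_differentiable[OF that]]]
    by (simp add: has_real_derivative_iff_has_vector_derivative)
  have cont: "isCont (\<lambda>y. g y \<bullet> c) x" if "smooth_on U g" for g :: "'a \<Rightarrow> 'b" and c
    using smooth_on_continuous[OF that] U by (auto simp: continuous_on_eq_continuous_at)
  have "?D (?D f v) w x \<bullet> c = ?D (?D f w) v x \<bullet> c" for c
    by (rule schwarz_directional[OF U, of "\<lambda>y. f y \<bullet> c" v "\<lambda>y. ?D f v y \<bullet> c" w "\<lambda>y. ?D f w y \<bullet> c"])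
      (auto intro!: dir cont smooth_on_frechet f)
  then show ?thesis
    using vector_eq_rdot by blast
qed

lemma partial_commute:
  fixes f :: "real^3 \<Rightarrow> 'b::real_inner"
  assumes "smooth_on UNIV f"
  shows "partial i (partial j f) = partial j (partial i f)"
  using frechet_derivative_commute[OF assms] by (simp add: partial_def[abs_def])

section \<open>Harmonic functions vanishing at infinity\<close>

text \<open>Otherwise the first derivative would be positive just to the right of the maximum.\<close>

lemma second_derivative_local_max:
  fixes \<phi> :: "real \<Rightarrow> real"
  assumes 1: "\<And>s. (\<phi> has_real_derivative \<phi>' s) (at s)" and 2: "(\<phi>' has_real_derivative D) (at 0)"
    and d: "0 < d" and max: "\<And>s. \<bar>s\<bar> < d \<Longrightarrow> \<phi> s \<le> \<phi> 0"
  shows "D \<le> 0"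
proof (rule ccontr)
  assume "\<not> D \<le> 0"
  then obtain e where e: "0 < e" "\<And>h. 0 < h \<Longrightarrow> h < e \<Longrightarrow> \<phi>' 0 < \<phi>' (0 + h)"
    using DERIV_pos_inc_right[OF 2] by force
  have "\<phi>' 0 = 0"
    by (rule DERIV_local_max[OF 1 d]) (use max in auto)
  define s where "s = min d e / 2"
  have s: "0 < s" "s < d" "s < e"
    using d e by (auto simp: s_def)
  obtain z where z: "0 < z" "z < s" "\<phi> s - \<phi> 0 = (s - 0) * \<phi>' z"
    using MVT2[OF s(1) 1] by blast
  have "0 < \<phi>' z"
    using e(2)[of z] z s \<open>\<phi>' 0 = 0\<close> by simp
  then have "0 < s * \<phi>' z"
    using s by simp
  then show False
    using z(3) max[of s] s by simp
qed

text \<open>The maximum principle: a positive value would force a maximum in the interior of a large ball.\<close>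

lemma harmonic_vanishing_nonpos:
  fixes h :: "real^3 \<Rightarrow> real"
  assumes cont: "continuous_on UNIV h" and lim: "(h \<longlongrightarrow> 0) at_infinity"
    and h1: "\<And>i x. ((\<lambda>s. h (x + s *\<^sub>R axis i 1)) has_real_derivative h1 i x) (at 0)"
    and h2: "\<And>i x. ((\<lambda>s. h1 i (x + s *\<^sub>R axis i 1)) has_real_derivative h2 i x) (at 0)"
    and lap: "\<And>x. (\<Sum>i\<in>UNIV. h2 i x) = 0"
  shows "h x0 \<le> 0"
proof (rule ccontr)
  define c where "c = h x0"
  assume "\<not> h x0 \<le> 0"
  then have c: "0 < c"
    by (simp add: c_def)
  have "\<forall>\<^sub>F x in at_infinity. dist (h x) 0 < c / 2"
    using lim c by (intro tendstoD) auto
  then obtain R0 where R0: "\<And>x. R0 \<le> norm x \<Longrightarrow> \<bar>h x\<bar> < c / 2"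
    unfolding eventually_at_infinity by auto
  (* Outside the ball of radius R the function stays below half of its positive value c. *)
  define R where "R = max 1 R0"
  have R: "1 \<le> R" "\<And>x. R \<le> norm x \<Longrightarrow> \<bar>h x\<bar> < c / 2"
    using R0 by (auto simp: R_def)
  define e where "e = c / (4 * R\<^sup>2)"
  have e: "0 < e" "e * R\<^sup>2 = c / 4"
    using c R(1) by (auto simp: e_def)
  \<comment> \<open>The added parabola makes the function strictly subharmonic and is too small to move the maximum
    to the boundary of the ball.\<close>
  define g where "g x = h x + e * (x \<bullet> x)" for x
  have "continuous_on (cball 0 R) g"
    unfolding g_def by (intro continuous_intros continuous_on_subset[OF cont]) auto
  then obtain m where m: "m \<in> cball 0 R" "\<And>x. x \<in> cball 0 R \<Longrightarrow> g x \<le> g m"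
    using continuous_attains_sup[of "cball 0 R" g] R(1) by force
  have "norm x0 < R"
    using R(2)[of x0] c unfolding c_def by fastforce
  then have gm: "c \<le> g m"
    using m(2)[of x0] e(1) by (simp add: g_def c_def) (smt (verit) inner_ge_zero mult_nonneg_nonneg)
  have nm: "norm m < R"
  proof (rule ccontr)
    assume "\<not> norm m < R"
    then have nR: "norm m = R"
      using m(1) by simp
    then have "e * (m \<bullet> m) = c / 4"
      using e(2) by (simp add: power2_norm_eq_inner[symmetric])
    then show False
      using gm R(2)[of m] nR c by (simp add: g_def abs_less_iff)
  qed
  have "h2 i m + 2 * e \<le> 0" for i
  proof (rule second_derivative_local_max)
    have h1': "((\<lambda>s. h (m + s *\<^sub>R axis i 1)) has_real_derivative h1 i (m + s *\<^sub>R axis i 1)) (at s)" for s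
      using h1[of "m + s *\<^sub>R axis i 1" i] unfolding DERIV_def by (simp add: algebra_simps)
    have q: "(m + s *\<^sub>R axis i 1) \<bullet> (m + s *\<^sub>R axis i 1) = m \<bullet> m + 2 * s * (m $ i) + s\<^sup>2" for s
      by (simp add: inner_add_left inner_add_right inner_axis inner_commute[of "axis i 1"] power2_eq_square algebra_simps)
    show "((\<lambda>s. g (m + s *\<^sub>R axis i 1)) has_real_derivative h1 i (m + s *\<^sub>R axis i 1) + e * (2 * (m $ i) + 2 * s)) (at s)" for s
      unfolding g_def q by (auto intro!: derivative_eq_intros h1' simp: power2_eq_square)
    show "((\<lambda>s. h1 i (m + s *\<^sub>R axis i 1) + e * (2 * (m $ i) + 2 * s)) has_real_derivative h2 i m + 2 * e) (at 0)"
      by (auto intro!: derivative_eq_intros h2)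
    show "0 < R - norm m"
      using nm by simp
    show "g (m + s *\<^sub>R axis i 1) \<le> g (m + 0 *\<^sub>R axis i 1)" if "\<bar>s\<bar> < R - norm m" for s
      using norm_triangle_ineq[of m "s *\<^sub>R axis i 1"] that by (simp add: m(2))
  qed
  then have "(\<Sum>i\<in>(UNIV::3 set). h2 i m + 2 * e) \<le> 0"
    by (intro sum_nonpos) auto
  then show False
    using lap[of m] e(1) by (simp add: sum.distrib)
qed

lemma harmonic_vanishing_eq_0:
  fixes h :: "real^3 \<Rightarrow> real"
  assumes cont: "continuous_on UNIV h" and lim: "(h \<longlongrightarrow> 0) at_infinity"
    and h1: "\<And>i x. ((\<lambda>s. h (x + s *\<^sub>R axis i 1)) has_real_derivative h1 i x) (at 0)"
    and h2: "\<And>i x. ((\<lambda>s. h1 i (x + s *\<^sub>R axis i 1)) has_real_derivative h2 i x) (at 0)"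
    and lap: "\<And>x. (\<Sum>i\<in>UNIV. h2 i x) = 0"
  shows "h x = 0"
proof (rule antisym)
  show "h x \<le> 0"
    by (rule harmonic_vanishing_nonpos[OF assms])
  have "- h x \<le> 0"
    by (rule harmonic_vanishing_nonpos[where h = "\<lambda>x. - h x" and ?h1.0 = "\<lambda>i x. - h1 i x" and ?h2.0 = "\<lambda>i x. - h2 i x"])
      (use assms in \<open>auto intro!: continuous_intros DERIV_minus tendsto_eq_intros simp: sum_negf\<close>)
  then show "0 \<le> h x"
    by simp
qed

section \<open>Riemann-Lebesgue lemma\<close>

text \<open>The symbol of a Riesz transform is discontinuous at the origin, so the decay of the inverse
  transform cannot be obtained by integrating by parts. Instead \<open>\<xi>\<close> is translated by half a period of
  the phase, which changes its sign; the translation tends to 0 as \<open>x\<close> tends to infinity, and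
  continuity away from the origin together with the weight allows dominated convergence.\<close>

lemma riemann_lebesgue:
  assumes r: "3 < r" and C: "0 \<le> C" and bd: "\<And>\<xi>. norm (g \<xi>) \<le> C * (1 + norm \<xi>) powr (- r)"
    and cont: "continuous_on (- {0}) g" and meas[measurable]: "g \<in> borel_measurable borel"
  shows "(inv_fourier g \<longlongrightarrow> 0) at_infinity"
proof -
  let ?I = "\<lambda>x. \<integral>\<xi>. cis (\<xi> \<bullet> x) * g \<xi> \<partial>lborel"
  let ?J = "\<lambda>a. \<integral>\<xi>. norm (g \<xi> - g (\<xi> + a)) \<partial>lborel"
  have w: "integrable lborel (\<lambda>\<xi>::real^3. (C + C * 2 powr r) * (1 + norm \<xi>) powr (- r))"
    using integrable_weight[OF r] by simp
  have gi: "integrable lborel g"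
  proof (rule Bochner_Integration.integrable_bound)
    show "integrable lborel (\<lambda>\<xi>::real^3. C * (1 + norm \<xi>) powr (- r))"
      using integrable_weight[OF r] by simp
  qed (use bd C in \<open>auto simp: abs_mult\<close>)
  have J: "(?J \<longlongrightarrow> (\<integral>\<xi>. 0 \<partial>(lborel :: (real^3) measure))) (at 0 within ball 0 1)"
  proof (rule integral_tendsto_dominated[OF _ _ _ w])
    show "AE \<xi> in lborel. ((\<lambda>a. norm (g \<xi> - g (\<xi> + a))) \<longlongrightarrow> 0) (at 0 within ball 0 1)"
      using AE_lborel_singleton[of "0 :: real^3"]
    proof eventually_elim
      case (elim \<xi>)
      then have "isCont g \<xi>"
        using cont by (simp add: continuous_on_eq_continuous_at open_Compl)
      then have "((\<lambda>a. g (\<xi> + a)) \<longlongrightarrow> g \<xi>) (at 0)"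
        by (simp add: isCont_iff)
      then have "((\<lambda>a. norm (g \<xi> - g (\<xi> + a))) \<longlongrightarrow> norm (g \<xi> - g \<xi>)) (at 0)"
        by (intro tendsto_intros)
      then have "((\<lambda>a. norm (g \<xi> - g (\<xi> + a))) \<longlongrightarrow> 0) (at 0)"
        by simp
      then show ?case
        by (rule tendsto_within_subset) auto
    qed
    show "norm (norm (g \<xi> - g (\<xi> + a))) \<le> (C + C * 2 powr r) * (1 + norm \<xi>) powr (- r)"
      if "a \<in> ball 0 1" for a \<xi>
    proof -
      have pos: "0 < 1 + norm \<xi>"
        using norm_ge_zero[of \<xi>] by linarith
      have "1 + norm \<xi> \<le> 2 * (1 + norm (\<xi> + a))"
        using norm_triangle_ineq4[of "\<xi> + a" a] that by simp (use norm_ge_zero[of "\<xi> + a"] in linarith)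
      then have "(1 + norm (\<xi> + a)) powr (- r) \<le> ((1 + norm \<xi>) / 2) powr (- r)"
        using pos r by (intro powr_mono2') auto
      also have "\<dots> = (1 + norm \<xi>) powr (- r) / 2 powr (- r)"
        by (rule powr_divide)
      also have "\<dots> = 2 powr r * (1 + norm \<xi>) powr (- r)"
        by (simp add: powr_minus_divide[of 2 r])
      finally have p: "(1 + norm (\<xi> + a)) powr (- r) \<le> 2 powr r * (1 + norm \<xi>) powr (- r)" .
      have "norm (g (\<xi> + a)) \<le> C * (2 powr r * (1 + norm \<xi>) powr (- r))"
        by (rule order_trans[OF bd mult_left_mono[OF p C]])
      then show ?thesis
        using norm_triangle_ineq4[of "g \<xi>" "g (\<xi> + a)"] bd[of \<xi>] by (simp add: algebra_simps)
    qed
  qed auto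
  \<comment> \<open>Shifting \<open>\<xi>\<close> by \<open>a\<close> multiplies the phase by \<open>-1\<close>.\<close>
  define a where "a x = (pi / (norm x)\<^sup>2) *\<^sub>R x" for x :: "real^3"
  have IJ: "2 * norm (?I x) \<le> ?J (a x)" if "x \<noteq> 0" for x
  proof -
    have ax: "a x \<bullet> x = pi"
      using that by (simp add: a_def power2_norm_eq_inner)
    have i: "integrable lborel (\<lambda>\<xi>. g (\<xi> + a x))"
      by (rule lborel_integrable_shift[OF gi])
    have "?I x = (\<integral>\<xi>. cis ((\<xi> + a x) \<bullet> x) * g (\<xi> + a x) \<partial>lborel)"
      by (rule lborel_integral_shift[symmetric]) simp
    also have "\<dots> = (\<integral>\<xi>. - (cis (\<xi> \<bullet> x) * g (\<xi> + a x)) \<partial>lborel)"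
      by (simp add: inner_add_left ax cis_mult[symmetric])
    finally have "2 * ?I x = (\<integral>\<xi>. cis (\<xi> \<bullet> x) * g \<xi> \<partial>lborel) - (\<integral>\<xi>. cis (\<xi> \<bullet> x) * g (\<xi> + a x) \<partial>lborel)"
      by simp
    also have "\<dots> = (\<integral>\<xi>. cis (\<xi> \<bullet> x) * (g \<xi> - g (\<xi> + a x)) \<partial>lborel)"
      using integrable_cis_mult(1)[OF gi] integrable_cis_mult(1)[OF i] by (simp add: right_diff_distrib)
    finally have "norm (2 * ?I x) \<le> (\<integral>\<xi>. norm (cis (\<xi> \<bullet> x) * (g \<xi> - g (\<xi> + a x))) \<partial>lborel)"
      by (simp only: integral_norm_bound)
    then show ?thesis
      by (simp add: norm_mult)
  qed
  have na: "norm (a x) = pi / norm x" for x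
    by (cases "x = 0") (simp_all add: a_def power2_eq_square)
  have "(a \<longlongrightarrow> 0) at_infinity"
  proof (rule tendsto_norm_zero_cancel)
    show "((\<lambda>x. norm (a x)) \<longlongrightarrow> 0) at_infinity"
      unfolding na by (intro tendsto_divide_0[OF tendsto_const] filterlim_at_top_imp_at_infinity filterlim_norm_at_top)
  qed
  moreover have nz: "\<forall>\<^sub>F x::real^3 in at_infinity. x \<noteq> 0"
    unfolding eventually_at_infinity by (intro exI[of _ 1]) auto
  then have "\<forall>\<^sub>F x in at_infinity. a x \<noteq> 0"
    by eventually_elim (simp add: a_def)
  ultimately have a0: "filterlim a (at 0) at_infinity"
    by (simp add: filterlim_at)
  have "(?J \<longlongrightarrow> 0) (at 0)"
    using J by (simp add: at_within_open[of 0 "ball 0 1"])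
  then have Ja: "((\<lambda>x. ?J (a x)) \<longlongrightarrow> 0) at_infinity"
    using a0 by (rule filterlim_compose)
  have "(?I \<longlongrightarrow> 0) at_infinity"
  proof (rule Lim_null_comparison[OF _ Ja])
    show "\<forall>\<^sub>F x in at_infinity. norm (?I x) \<le> ?J (a x)"
      using nz
    proof eventually_elim
      case (elim x)
      then show ?case
        using IJ[of x] norm_ge_zero[of "?I x"] by linarith
    qed
  qed
  then show ?thesis
    unfolding inv_fourier_def by (auto intro: tendsto_eq_intros)
qed

section \<open>Gradients and the Leray projector\<close>

lemma fourier_inversion_decays:
  fixes f :: "'i \<Rightarrow> real^3 \<Rightarrow> real"
  assumes r: "3 < r" and f: "decays 4 r S f" and s: "s \<in> S"
  shows "integrable lborel (ft (f s))" "inv_fourier (ft (f s)) x = of_real (f s x)"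
proof -
  note fi = decay_integrable[OF decays_bound[OF f] r s]
  obtain C where C: "\<And>\<xi>. norm (ft (f s) \<xi>) \<le> C * (1 + norm \<xi>) powr (- real 4)"
    using fourier_decay_powr[OF r f] s by metis
  show 1: "integrable lborel (ft (f s))"
    using C by (intro integrable_weight_bound[where r = 4] borel_measurable_ft fi) auto
  obtain B where "\<And>x. norm (f s x) \<le> B"
    using decay_bounded[OF decays_bound[OF f]] r s by (metis less_eq_real_def less_trans zero_less_numeral)
  then have "inv_fourier (ft (f s)) = (\<lambda>x. of_real (f s x))"
    using decays_continuous[OF f s]
    by (intro fourier_inversion integrable_of_real fi 1 continuous_on_of_real) auto
  then show "inv_fourier (ft (f s)) x = of_real (f s x)"
    by simp
qed

lemma component_weight_bound:
  fixes g :: "real^3 \<Rightarrow> complex"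
  assumes "\<And>\<xi>. norm (g \<xi>) \<le> C * (1 + norm \<xi>) powr (- r)"
  shows "norm (\<i> * of_real (\<xi> $ i) * g \<xi>) \<le> C * (1 + norm \<xi>) powr (- (r - 1))"
proof -
  have pos: "0 < 1 + norm \<xi>"
    using norm_ge_zero[of \<xi>] by linarith
  have "norm (\<i> * of_real (\<xi> $ i) * g \<xi>) = \<bar>\<xi> $ i\<bar> * norm (g \<xi>)"
    by (simp add: norm_mult)
  also have "\<dots> \<le> (1 + norm \<xi>) * (C * (1 + norm \<xi>) powr (- r))"
    using component_le_norm_cart[of \<xi> i] assms[of \<xi>] pos by (intro mult_mono) auto
  also have "\<dots> = C * ((1 + norm \<xi>) powr 1 * (1 + norm \<xi>) powr (- r))"
    using pos by simp
  also have "(1 + norm \<xi>) powr 1 * (1 + norm \<xi>) powr (- r) = (1 + norm \<xi>) powr (- (r - 1))"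
    by (simp only: powr_add[symmetric]) simp
  finally show ?thesis .
qed

lemma inv_fourier_partial:
  assumes r: "4 < r" and bd: "\<And>\<xi>. norm (g \<xi>) \<le> C * (1 + norm \<xi>) powr (- r)"
    and g[measurable]: "g \<in> borel_measurable borel"
  shows "((\<lambda>s. inv_fourier g (x + s *\<^sub>R axis i 1)) has_vector_derivative
    inv_fourier (\<lambda>\<xi>. \<i> * of_real (\<xi> $ i) * g \<xi>) x) (at 0)"
proof -
  have gi: "integrable lborel g"
    using r by (intro integrable_weight_bound[OF _ bd g]) simp
  have gi': "integrable lborel (\<lambda>\<xi>. \<i> * of_real (\<xi> $ i) * g \<xi>)"
    using r by (intro integrable_weight_bound[OF _ component_weight_bound[OF bd]]) simp_all
  let ?f' = "\<lambda>s \<xi>. cis (\<xi> \<bullet> (x + s *\<^sub>R axis i 1)) * (\<i> * of_real (\<xi> $ i) * g \<xi>)"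
  have "((\<lambda>s. \<integral>\<xi>. cis (\<xi> \<bullet> (x + s *\<^sub>R axis i 1)) * g \<xi> \<partial>lborel) has_vector_derivative (\<integral>\<xi>. ?f' 0 \<xi> \<partial>lborel)) (at 0)"
  proof (rule has_vector_derivative_integral(1)[of 0 "-1" 1])
    show "integrable lborel (\<lambda>\<xi>. cis (\<xi> \<bullet> (x + s *\<^sub>R axis i 1)) * g \<xi>)" for s
      by (rule integrable_cis_mult(1)[OF gi])
    show "((\<lambda>s. cis (\<xi> \<bullet> (x + s *\<^sub>R axis i 1)) * g \<xi>) has_vector_derivative ?f' s \<xi>) (at s)" for s \<xi>
    proof -
      have "((\<lambda>s. \<xi> \<bullet> (x + s *\<^sub>R axis i 1)) has_derivative (\<lambda>s. (\<xi> $ i) * s)) (at s)"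
        by (auto intro!: derivative_eq_intros simp: inner_axis mult.commute)
      from has_derivative_cis[OF this]
      have "((\<lambda>s. cis (\<xi> \<bullet> (x + s *\<^sub>R axis i 1))) has_vector_derivative
          \<i> * of_real (\<xi> $ i) * cis (\<xi> \<bullet> (x + s *\<^sub>R axis i 1))) (at s)"
        unfolding has_vector_derivative_def
        by (rule has_derivative_eq_rhs) (simp add: fun_eq_iff scaleR_conv_of_real)
      from has_vector_derivative_mult_left[OF this, of "g \<xi>"] show ?thesis
        by (simp add: ac_simps)
    qed
    show "norm (?f' s \<xi>) \<le> norm (\<i> * of_real (\<xi> $ i) * g \<xi>)" for s \<xi>
      by (simp add: norm_mult)
  qed (use integrable_norm[OF gi'] in auto)
  from has_vector_derivative_scaleR[OF DERIV_const this, of "1 / (2 * pi) ^ 3"] show ?thesis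
    by (simp add: inv_fourier_def)
qed

text \<open>Uniqueness of the Helmholtz decomposition. In each component, \<open>grad p\<close> and the gradient part
  \<open>F - leray F\<close> have the same Laplacian, and both vanish at infinity: \<open>grad p\<close> by assumption,
  \<open>F - leray F\<close> by the Riemann-Lebesgue lemma. Their difference is harmonic and hence zero.\<close>

lemma leray_eq_minus_grad:
  fixes F :: "'i \<Rightarrow> real^3 \<Rightarrow> real^3"
  assumes r: "3 < r" and F: "decays 6 r S F" and s: "s \<in> S"
    and p: "smooth_on UNIV p" and lim: "(grad p \<longlongrightarrow> 0) at_infinity"
    and lap: "\<And>x. laplacian p x = divergence (F s) x"
  shows "leray (F s) x = F s x - grad p x"
proof -
  note F4 = decays_mono[OF F, of 4, simplified]
  have Fk: "decays 6 r S (\<lambda>s y. F s y $ k)" "decays 4 r S (\<lambda>s y. F s y $ k)" for k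
    using decays_nth[OF F] decays_nth[OF F4] by auto
  have grad_nth: "grad p x $ j = partial j p x" for x j
    by (simp add: grad_def)
  have "F s x $ j - leray (F s) x $ j = partial j p x" for j
  proof -
    (* The Fourier transform of the gradient part. Six derivatives of F are used, so that two
       derivatives of the inverse transform of Q still leave an integrable weight of exponent 4. *)
    define Q where "Q \<xi> = ft (\<lambda>y. F s y $ j) \<xi> - leray_hat (F s) j \<xi>" for \<xi>
    have Qsum: "Q \<xi> = (\<Sum>k\<in>UNIV. of_real (\<xi> $ j * \<xi> $ k / (norm \<xi>)\<^sup>2) * ft (\<lambda>y. F s y $ k) \<xi>)" for \<xi>
    proof -
      have "ft (\<lambda>y. F s y $ j) \<xi> = (\<Sum>k\<in>UNIV. of_real (if j = k then 1 else 0) * ft (\<lambda>y. F s y $ k) \<xi>)"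
        by (simp add: if_distrib[of of_real] if_distrib[of "\<lambda>c. c * _"] cong: if_cong)
      then show ?thesis
        unfolding Q_def leray_hat_def
        by (simp only: sum_subtractf[symmetric], intro sum.cong refl)
          (simp add: leray_symbol_def left_diff_distrib)
    qed
    note ik = decays_nth_integrable[OF r F s]
    have Qm: "Q \<in> borel_measurable borel"
      unfolding Q_def using borel_measurable_ft[OF ik] borel_measurable_leray_hat[OF ik] by auto
    obtain C where C: "0 \<le> C" "\<And>\<xi>. norm (Q \<xi>) \<le> C * (1 + norm \<xi>) powr (- 6)"
    proof -
      obtain C1 where C1: "0 \<le> C1" "\<And>\<xi>. norm (leray_hat (F s) j \<xi>) \<le> C1 * (1 + norm \<xi>) powr (- real 6)"
        using leray_hat_bound[OF r F] s by metis
      obtain C2 where C2: "0 \<le> C2" "\<And>\<xi>. norm (ft (\<lambda>y. F s y $ j) \<xi>) \<le> C2 * (1 + norm \<xi>) powr (- real 6)"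
        using fourier_decay_powr[OF r Fk(1)] s by metis
      have "norm (Q \<xi>) \<le> (C2 + C1) * (1 + norm \<xi>) powr (- 6)" for \<xi>
        using norm_triangle_ineq4[of "ft (\<lambda>y. F s y $ j) \<xi>" "leray_hat (F s) j \<xi>"] C1(2)[of \<xi>] C2(2)[of \<xi>]
        by (simp add: Q_def distrib_right)
      then show ?thesis
        using that[of "C2 + C1"] C1(1) C2(1) by simp
    qed
    have m: "(\<lambda>\<xi>. \<i> * of_real (\<xi> $ i) * g \<xi>) \<in> borel_measurable borel"
      if "g \<in> borel_measurable borel" for g :: "real^3 \<Rightarrow> complex" and i
      using that by simp
    let ?Q1 = "\<lambda>i \<xi>. \<i> * of_real (\<xi> $ i) * Q \<xi>"
    let ?Q2 = "\<lambda>i \<xi>. \<i> * of_real (\<xi> $ i) * (\<i> * of_real (\<xi> $ i) * Q \<xi>)"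
    have C5: "norm (?Q1 i \<xi>) \<le> C * (1 + norm \<xi>) powr (- 5)" for i \<xi>
      using component_weight_bound[OF C(2), of \<xi> i] by simp
    have C4: "norm (?Q2 i \<xi>) \<le> C * (1 + norm \<xi>) powr (- 4)" for i \<xi>
      using component_weight_bound[OF C5, of \<xi> i] by simp
    have Qi: "integrable lborel Q" and Q2i: "integrable lborel (?Q2 i)" for i
      using integrable_weight_bound[OF _ C(2) Qm] integrable_weight_bound[OF _ C4 m[OF m[OF Qm]]] by auto
    define h where "h x = partial j p x - Re (inv_fourier Q x)" for x
    have "h x = 0"
    proof (rule harmonic_vanishing_eq_0)
      show "continuous_on UNIV h"
        unfolding h_def
        by (intro continuous_intros continuous_on_inv_fourier Qi smooth_on_continuous smooth_on_partial p)
      have "continuous_on (- {0}) Q"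
      proof -
        have "continuous_on (- {0}) (ft (\<lambda>y. F s y $ k))" for k
          using continuous_on_subset[OF continuous_on_fourier[OF integrable_of_real[OF ik]]] by blast
        then show ?thesis
          unfolding Qsum by (intro continuous_intros) auto
      qed
      from riemann_lebesgue[OF _ C this Qm] have "(inv_fourier Q \<longlongrightarrow> 0) at_infinity"
        by simp
      then have "((\<lambda>x. Re (inv_fourier Q x)) \<longlongrightarrow> 0) at_infinity"
        using tendsto_Re by fastforce
      moreover have "((\<lambda>x. partial j p x) \<longlongrightarrow> 0) at_infinity"
        using tendsto_vec_nth[OF lim, of j] by (simp add: grad_nth)
      ultimately show "(h \<longlongrightarrow> 0) at_infinity"
        unfolding h_def using tendsto_diff by fastforce
      have Re: "((\<lambda>s. Re (f s)) has_real_derivative Re f') (at 0)"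
        if "(f has_vector_derivative f') (at 0)" for f f'
        using bounded_linear.has_vector_derivative[OF bounded_linear_Re that]
        by (simp add: has_real_derivative_iff_has_vector_derivative)
      have P: "((\<lambda>s. f (x + s *\<^sub>R axis i 1)) has_real_derivative partial i f x) (at 0)"
        if "smooth_on UNIV f" for f :: "real^3 \<Rightarrow> real" and x i
        using has_vector_derivative_partial[of f x 0 i] smooth_on_differentiable[OF that]
        by (simp add: has_real_derivative_iff_has_vector_derivative)
      show "((\<lambda>s. h (x + s *\<^sub>R axis i 1)) has_real_derivative
          partial i (partial j p) x - Re (inv_fourier (?Q1 i) x)) (at 0)" for i x
        unfolding h_def
        by (intro DERIV_diff P Re inv_fourier_partial[OF _ C(2) Qm] smooth_on_partial p) simp
      show "((\<lambda>s. partial i (partial j p) (x + s *\<^sub>R axis i 1) - Re (inv_fourier (?Q1 i) (x + s *\<^sub>R axis i 1)))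
          has_real_derivative partial i (partial i (partial j p)) x - Re (inv_fourier (?Q2 i) x)) (at 0)" for i x
        by (intro DERIV_diff P Re inv_fourier_partial[OF _ C5 m[OF Qm]] smooth_on_partial p) simp
      show "(\<Sum>i\<in>UNIV. partial i (partial i (partial j p)) x - Re (inv_fourier (?Q2 i) x)) = 0" for x
      proof -
        have dd: "decays 4 r S (\<lambda>s. partial j (partial k (\<lambda>y. F s y $ k)))" for k
        proof -
          have "decays (Suc (Suc 4)) r S (\<lambda>s y. F s y $ k)"
            using Fk(1) by (simp add: eval_nat_numeral)
          then show ?thesis
            by (intro decays_partial)
        qed
        have ftdd: "ft (partial j (partial k (\<lambda>y. F s y $ k))) \<xi> =
            \<i> * of_real (\<xi> $ j) * (\<i> * of_real (\<xi> $ k) * ft (\<lambda>y. F s y $ k) \<xi>)" for k \<xi>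
        proof -
          have 1: "decays (Suc (Suc 4)) r S (\<lambda>s y. F s y $ k)"
            using Fk(1) by (simp add: eval_nat_numeral)
          show ?thesis
            using fourier_partial_decays[OF 1 r s] fourier_partial_decays[OF decays_partial[OF 1] r s] by simp
        qed
        have "(\<Sum>i\<in>UNIV. ?Q2 i \<xi>) = (\<Sum>k\<in>UNIV. ft (partial j (partial k (\<lambda>y. F s y $ k))) \<xi>)" for \<xi>
        proof (cases "\<xi> = 0")
          case False
          have "(\<Sum>i\<in>UNIV. ?Q2 i \<xi>) = - of_real (\<Sum>i\<in>UNIV. (\<xi> $ i)\<^sup>2) * Q \<xi>"
            by (simp add: sum_distrib_left sum_negf power2_eq_square mult.commute mult.left_commute)
          also have "(\<Sum>i\<in>UNIV. (\<xi> $ i)\<^sup>2) = (norm \<xi>)\<^sup>2"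
            by (simp only: power2_norm_eq_inner) (simp add: inner_vec_def power2_eq_square)
          also have "- of_real ((norm \<xi>)\<^sup>2) * Q \<xi> = (\<Sum>k\<in>UNIV. - of_real (\<xi> $ j * \<xi> $ k) * ft (\<lambda>y. F s y $ k) \<xi>)"
            using False by (simp add: Qsum sum_distrib_left)
          finally show ?thesis
            by (simp add: ftdd mult.assoc) (simp add: algebra_simps)
        qed (simp add: ftdd)
        then have "(\<Sum>i\<in>UNIV. inv_fourier (?Q2 i) x) = (\<Sum>k\<in>UNIV. inv_fourier (ft (partial j (partial k (\<lambda>y. F s y $ k)))) x)"
          unfolding inv_fourier_def scaleR_sum_right[symmetric]
          by (simp flip: Bochner_Integration.integral_sum add: integrable_cis_mult(1)[OF Q2i]
            integrable_cis_mult(1)[OF fourier_inversion_decays(1)[OF r dd s]] sum_distrib_left[symmetric])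
        also have "\<dots> = of_real (\<Sum>k\<in>UNIV. partial j (partial k (\<lambda>y. F s y $ k)) x)"
          using fourier_inversion_decays(2)[OF r dd s] by simp
        also have "(\<Sum>k\<in>UNIV. partial j (partial k (\<lambda>y. F s y $ k)) x) = partial j (divergence (F s)) x"
        proof -
          have "(\<lambda>y. F s y $ k) differentiable (at x)" "partial k (\<lambda>y. F s y $ k) differentiable (at x)" for k x
            using Fk(1)[of k] s by (auto simp: eval_nat_numeral)
          then show ?thesis
            unfolding divergence_def[abs_def] by (subst partial_sum) auto
        qed
        also have "divergence (F s) = laplacian p"
          using lap by (simp add: fun_eq_iff)
        also have "partial j (laplacian p) x = (\<Sum>i\<in>UNIV. partial j (partial i (partial i p)) x)"
          unfolding laplacian_def[abs_def]
          by (intro partial_sum smooth_on_differentiable[where S = UNIV] smooth_on_partial p) auto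
        also have "\<dots> = (\<Sum>i\<in>UNIV. partial i (partial i (partial j p)) x)"
          using partial_commute[OF p] partial_commute[OF smooth_on_partial[OF p]] by metis
        finally have "Re (\<Sum>i\<in>UNIV. inv_fourier (?Q2 i) x) = (\<Sum>i\<in>UNIV. partial i (partial i (partial j p)) x)"
          by simp
        then show ?thesis
          by (simp add: sum_subtractf)
      qed
    qed
    moreover have "Re (inv_fourier Q x) = F s x $ j - leray (F s) x $ j"
    proof -
      have "inv_fourier Q x = inv_fourier (ft (\<lambda>y. F s y $ j)) x - inv_fourier (leray_hat (F s) j) x"
        unfolding Q_def inv_fourier_def
        using integrable_cis_mult(1)[OF fourier_inversion_decays(1)[OF r Fk(2) s]]
          integrable_cis_mult(1)[OF leray_hat_integrable[OF r F4 s]]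
        by (simp add: right_diff_distrib scaleR_diff_right)
      then show ?thesis
        using fourier_inversion_decays(2)[OF r Fk(2) s] by (simp add: leray_nth)
    qed
    ultimately show ?thesis
      by (simp add: h_def)
  qed
  then show ?thesis
    by (simp add: vec_eq_iff grad_nth algebra_simps)
qed

section \<open>Duhamel's principle\<close>

lemma set_integrable_bounded_open:
  fixes f :: "real \<Rightarrow> 'b::euclidean_space"
  assumes cont: "continuous_on {a<..<b} f" and bd: "\<And>s. s \<in> {a<..<b} \<Longrightarrow> norm (f s) \<le> B"
  shows "set_integrable lborel {a<..<b} f"
  unfolding set_integrable_def
proof (rule Bochner_Integration.integrable_bound)
  show "integrable lborel (\<lambda>s. indicator {a<..<b} s *\<^sub>R B)"
    by (intro integrable_scaleR_left integrable_real_indicator) (cases "a \<le> b"; simp)+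
  show "(\<lambda>s. indicator {a<..<b} s *\<^sub>R f s) \<in> borel_measurable lborel"
    using borel_measurable_continuous_on_indicator[OF _ cont] by simp
  have "norm (indicator {a<..<b} s *\<^sub>R f s) \<le> norm (indicator {a<..<b} s *\<^sub>R B)" for s
    using bd[of s] by (auto simp: indicator_def)
  then show "AE s in lborel. norm (indicator {a<..<b} s *\<^sub>R f s) \<le> norm (indicator {a<..<b} s *\<^sub>R B)"
    by simp
qed

text \<open>A derivative is available in the open interval only, since the solutions are merely
  continuous up to the initial time and \<open>sqrt (t - s)\<close> is not differentiable at \<open>s = t\<close>.\<close>

lemma set_lborel_integral_derivative:
  fixes f :: "real \<Rightarrow> 'b::euclidean_space"
  assumes ab: "a \<le> b" and cont: "continuous_on {a..b} f"
    and der: "\<And>s. s \<in> {a<..<b} \<Longrightarrow> (f has_vector_derivative f' s) (at s)"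
    and int: "set_integrable lborel {a<..<b} f'"
  shows "(LBINT s:{a<..<b}. f' s) = f b - f a"
proof -
  have "(f' has_integral (f b - f a)) {a..b}"
    by (rule fundamental_theorem_of_calculus_interior[OF ab cont der])
  then have "(f' has_integral (f b - f a)) {a<..<b}"
    by (simp only: has_integral_Icc_iff_Ioo)
  then show ?thesis
    using set_borel_integral_eq_integral(2)[OF int] by (simp add: integral_unique)
qed

lemma gauss_partial:
  "((\<lambda>s. gauss (z + s *\<^sub>R axis i 1)) has_real_derivative - (z $ i) / 2 * gauss z) (at 0)"
proof -
  have "(norm (z + s *\<^sub>R axis i 1))\<^sup>2 = (norm z)\<^sup>2 + 2 * s * (z $ i) + s\<^sup>2" for s
    unfolding power2_norm_eq_inner
    by (simp add: inner_add_left inner_add_right inner_axis inner_commute[of "axis i 1"] power2_eq_square algebra_simps)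
  then show ?thesis
    unfolding gauss_def by (auto intro!: derivative_eq_intros simp: field_simps)
qed

text \<open>The gradient of the Gaussian is \<open>- z / 2\<close> times the Gaussian.\<close>

lemma gauss_integration_by_parts:
  fixes g :: "real^3 \<Rightarrow> 'b::euclidean_space"
  assumes diff: "\<And>z. g differentiable (at z)" and cont: "continuous_on UNIV (partial i g)"
    and bd: "\<And>z. norm (g z) \<le> B" "\<And>z. norm (partial i g z) \<le> B"
  shows "integrable lborel (\<lambda>z. (gauss z * z $ i) *\<^sub>R g z)"
    and "(\<integral>z. (gauss z * z $ i) *\<^sub>R g z \<partial>lborel) = 2 *\<^sub>R (\<integral>z. gauss z *\<^sub>R partial i g z \<partial>lborel)"
proof -
  have cg: "continuous_on UNIV g"
    using diff differentiable_imp_continuous_within continuous_at_imp_continuous_on by blast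
  have [measurable]: "g \<in> borel_measurable borel" "partial i g \<in> borel_measurable borel"
    using cg cont by (auto intro: borel_measurable_continuous_onI)
  have "integrable lborel (\<lambda>z. gauss z * z $ i)"
  proof (rule Bochner_Integration.integrable_bound[OF integrable_linear_gauss])
    have "\<bar>z $ i\<bar> \<le> 1 + norm z" for z :: "real^3"
      using component_le_norm_cart[of z i] by linarith
    then show "AE z in lborel. norm (gauss z * z $ i) \<le> norm ((1 + norm z) * gauss z)"
      by (simp add: abs_mult mult.commute mult_left_mono)
  qed simp
  then show i1: "integrable lborel (\<lambda>z. (gauss z * z $ i) *\<^sub>R g z)"
    by (rule integrable_bounded_mult[OF _ _ bd(1)]) simp
  have i2: "integrable lborel (\<lambda>z. gauss z *\<^sub>R partial i g z)"
    by (rule integrable_bounded_mult[OF integrable_gauss _ bd(2)]) simp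
  have i0: "integrable lborel (\<lambda>z. gauss z *\<^sub>R g z)"
    by (rule integrable_bounded_mult[OF integrable_gauss _ bd(1)]) simp
  let ?D = "\<lambda>z. gauss z *\<^sub>R partial i g z - (1/2) *\<^sub>R ((gauss z * z $ i) *\<^sub>R g z)"
  have "(\<integral>z. ?D z \<partial>lborel) = 0"
  proof (rule integral_directional_derivative_eq_0[OF _ i0])
    show "((\<lambda>s. gauss (z + s *\<^sub>R axis i 1) *\<^sub>R g (z + s *\<^sub>R axis i 1)) has_vector_derivative ?D z) (at 0)" for z
      using has_vector_derivative_scaleR[OF gauss_partial has_vector_derivative_partial[of g z 0 i]] diff
      by (simp add: mult.commute)
    show "integrable lborel ?D"
      using i1 i2 by (intro Bochner_Integration.integrable_diff integrable_scaleR_right)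
    show "continuous_on UNIV ?D"
      using cg cont by (intro continuous_intros)
  qed
  then have "(1/2) *\<^sub>R (\<integral>z. (gauss z * z $ i) *\<^sub>R g z \<partial>lborel) = (\<integral>z. gauss z *\<^sub>R partial i g z \<partial>lborel)"
    using i1 i2 by (simp only: Bochner_Integration.integral_diff integrable_scaleR_right integral_scaleR_right right_minus_eq)
  then show "(\<integral>z. (gauss z * z $ i) *\<^sub>R g z \<partial>lborel) = 2 *\<^sub>R (\<integral>z. gauss z *\<^sub>R partial i g z \<partial>lborel)"
    by (metis (no_types, lifting) divide_self_if scaleR_one scaleR_scaleR times_divide_eq_right mult.right_neutral zero_neq_numeral)
qed

lemma heat_norm_bound:
  fixes f :: "real^3 \<Rightarrow> 'b::{banach, second_countable_topology}"
  assumes tau: "0 \<le> \<tau>" and f: "f \<in> borel_measurable borel" and bd: "\<And>y. norm (f y) \<le> B"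
  shows "norm (heat \<tau> f x) \<le> B"
proof -
  have "norm (heat \<tau> f x) \<le> (\<integral>z. gauss z * B \<partial>lborel)"
    unfolding heat_eq_gauss[OF tau f]
  proof (rule order_trans[OF integral_norm_bound integral_mono])
    show "integrable lborel (\<lambda>z. norm (gauss z *\<^sub>R f (x - sqrt \<tau> *\<^sub>R z)))"
      by (rule integrable_norm[OF heat_integrand_integrable[OF f bd]])
    show "norm (gauss z *\<^sub>R f (x - sqrt \<tau> *\<^sub>R z)) \<le> gauss z * B" for z
      using bd by (simp add: mult_left_mono)
  qed (use integrable_gauss in simp)
  then show ?thesis
    using integral_gauss by simp
qed

lemma continuous_on_heat_path:
  fixes f :: "real \<Rightarrow> real^3 \<Rightarrow> 'b::{banach, second_countable_topology}"
  assumes cont: "continuous_on (A \<times> UNIV) (\<lambda>(s, y). f s y)" and A: "A \<subseteq> {..t}"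
    and bd: "\<And>s y. s \<in> A \<Longrightarrow> norm (f s y) \<le> B"
  shows "continuous_on A (\<lambda>s. heat (t - s) (f s) x)"
proof -
  have fm: "f s \<in> borel_measurable borel" if "s \<in> A" for s
  proof (rule borel_measurable_continuous_onI)
    show "continuous_on UNIV (f s)"
    proof -
      have "continuous_on UNIV (\<lambda>y. case (s, y) of (s, y) \<Rightarrow> f s y)"
        by (rule continuous_on_compose2[OF cont continuous_on_Pair[OF continuous_on_const continuous_on_id]])
          (use that in auto)
      then show ?thesis
        by simp
    qed
  qed
  have "continuous_on A (\<lambda>s. \<integral>z. gauss z *\<^sub>R f s (x - sqrt (t - s) *\<^sub>R z) \<partial>lborel)"
  proof (rule continuous_on_integral_dominated)
    show "continuous_on A (\<lambda>s. gauss z *\<^sub>R f s (x - sqrt (t - s) *\<^sub>R z))" for z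
    proof -
      have "continuous_on A (\<lambda>s. (s, x - sqrt (t - s) *\<^sub>R z))"
        by (intro continuous_intros)
      then have "continuous_on A (\<lambda>s. case (s, x - sqrt (t - s) *\<^sub>R z) of (s, y) \<Rightarrow> f s y)"
        by (rule continuous_on_compose2[OF cont]) auto
      then show ?thesis
        by (auto intro!: continuous_intros)
    qed
    show "integrable lborel (\<lambda>z. gauss z * B)"
      using integrable_gauss by simp
    show "norm (gauss z *\<^sub>R f s (x - sqrt (t - s) *\<^sub>R z)) \<le> gauss z * B" if "s \<in> A" for z s
      using bd[OF that] by (simp add: mult_left_mono)
    show "(\<lambda>z. gauss z *\<^sub>R f s (x - sqrt (t - s) *\<^sub>R z)) \<in> borel_measurable lborel" if "s \<in> A" for s
      using fm[OF that] by simp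
  qed
  then show ?thesis
    by (rule continuous_on_cong[THEN iffD1, rotated 2]) (use A fm in \<open>auto simp: heat_eq_gauss\<close>)
qed

text \<open>In the form \<open>\<integral> gauss z *\<^sub>R f s (x - sqrt (t - s) *\<^sub>R z)\<close> the kernel does not depend on time, so
  differentiating in \<open>s\<close> only involves derivatives of \<open>f\<close>; one integration by parts turns the drift
  term produced by \<open>sqrt (t - s)\<close> into the Laplacian.\<close>

lemma heat_duhamel_derivative:
  fixes f g :: "real \<Rightarrow> real^3 \<Rightarrow> 'b::euclidean_space"
  assumes der: "\<And>s y. s \<in> {0<..<t} \<Longrightarrow> ((\<lambda>(s, y). f s y) has_derivative
        (\<lambda>(h, k). h *\<^sub>R g s y + (\<Sum>i\<in>UNIV. (k $ i) *\<^sub>R partial i (f s) y))) (at (s, y))"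
    and diff: "\<And>s y i. s \<in> {0<..<t} \<Longrightarrow> partial i (f s) differentiable (at y)"
    and cont: "\<And>s. s \<in> {0<..<t} \<Longrightarrow> continuous_on UNIV (f s)"
      "\<And>s. s \<in> {0<..<t} \<Longrightarrow> continuous_on UNIV (g s)"
      "\<And>s i. s \<in> {0<..<t} \<Longrightarrow> continuous_on UNIV (partial i (partial i (f s)))"
    and bd: "\<And>s y. s \<in> {0<..<t} \<Longrightarrow> norm (f s y) \<le> B"
      "\<And>s y. s \<in> {0<..<t} \<Longrightarrow> norm (g s y) \<le> B"
      "\<And>s y i. s \<in> {0<..<t} \<Longrightarrow> norm (partial i (f s) y) \<le> B"
      "\<And>s y i. s \<in> {0<..<t} \<Longrightarrow> norm (partial i (partial i (f s)) y) \<le> B"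
    and s: "s \<in> {0<..<t}"
  shows "((\<lambda>s. heat (t - s) (f s) x) has_vector_derivative
      heat (t - s) (\<lambda>y. g s y - laplacian (f s) y) x) (at s)"
proof -
  have contp: "continuous_on UNIV (partial i (f s))" if "s \<in> {0<..<t}" for s i
    using diff[OF that] differentiable_imp_continuous_within continuous_at_imp_continuous_on by blast
  note meas = borel_measurable_continuous_onI[OF cont(1)] borel_measurable_continuous_onI[OF cont(2)]
    borel_measurable_continuous_onI[OF cont(3)] borel_measurable_continuous_onI[OF contp]
  define P where "P s z = x - sqrt (t - s) *\<^sub>R z" for s and z :: "real^3"
  define v where "v s z = g s (P s z) + (\<Sum>i\<in>UNIV. (z $ i / (2 * sqrt (t - s))) *\<^sub>R partial i (f s) (P s z))" for s z
  (* A lower bound for sqrt (t - s') as long as s' stays below the midpoint of s and t; it keeps the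
     drift term z / (2 * sqrt (t - s')) away from its singularity at s' = t. *)
  define \<sigma> where "\<sigma> = sqrt ((t - s) / 2)"
  have B: "0 \<le> B"
    using order_trans[OF norm_ge_zero bd(1)[OF s]] .
  have \<sigma>: "0 < \<sigma>"
    using s by (simp add: \<sigma>_def)
  have path: "((\<lambda>s. f s (P s z)) has_vector_derivative v s z) (at s)" if s: "s \<in> {0<..<t}" for s z
  proof -
    have "((\<lambda>s. (s, P s z)) has_derivative (\<lambda>h. (h, (h / (2 * sqrt (t - s))) *\<^sub>R z))) (at s)"
    proof -
      have "((\<lambda>s. sqrt (t - s)) has_real_derivative - 1 / (2 * sqrt (t - s))) (at s)"
      proof -
        have 1: "((\<lambda>s. t - s) has_real_derivative - 1) (at s)"
          by (auto intro!: derivative_eq_intros)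
        have 2: "(sqrt has_real_derivative inverse (sqrt (t - s)) / 2) (at (t - s))"
          by (rule DERIV_real_sqrt) (use s in simp)
        show ?thesis
          by (rule DERIV_cong[OF DERIV_chain2[OF 2 1]]) (simp add: inverse_eq_divide)
      qed
      from has_vector_derivative_diff[OF has_vector_derivative_const has_vector_derivative_scaleR[OF this has_vector_derivative_const]]
      have "((\<lambda>s. P s z) has_vector_derivative (1 / (2 * sqrt (t - s))) *\<^sub>R z) (at s)"
        unfolding P_def by simp
      then have "((\<lambda>s. P s z) has_derivative (\<lambda>h. (h / (2 * sqrt (t - s))) *\<^sub>R z)) (at s)"
        unfolding has_vector_derivative_def by simp
      from has_derivative_Pair[OF has_derivative_ident this] show ?thesis .
    qed
    from has_derivative_compose[OF this der[OF s]]
    have "((\<lambda>s. f s (P s z)) has_derivative (\<lambda>h. h *\<^sub>R g s (P s z) +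
        (\<Sum>i\<in>UNIV. (h / (2 * sqrt (t - s)) * z $ i) *\<^sub>R partial i (f s) (P s z)))) (at s)"
      by simp
    then show ?thesis
      unfolding has_vector_derivative_def
      by (rule has_derivative_eq_rhs) (simp add: v_def fun_eq_iff scaleR_right_distrib scaleR_sum_right)
  qed
  have vbd: "norm (v s' z) \<le> (B + 3 * B / (2 * \<sigma>)) * (1 + norm z)" if "s' \<in> {0<..<(s + t) / 2}" for s' z
  proof -
    have s't: "s' \<in> {0<..<t}" and le: "\<sigma> \<le> sqrt (t - s')"
      using that s by (auto simp: \<sigma>_def)
    have "norm (v s' z) \<le> norm (g s' (P s' z)) + (\<Sum>i\<in>UNIV. norm ((z $ i / (2 * sqrt (t - s'))) *\<^sub>R partial i (f s') (P s' z)))"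
      unfolding v_def by (rule order_trans[OF norm_triangle_ineq]) (intro add_left_mono norm_sum)
    also have "\<dots> \<le> B + (\<Sum>i\<in>(UNIV::3 set). norm z / (2 * \<sigma>) * B)"
    proof (intro add_mono sum_mono)
      fix i :: 3
      have "\<bar>z $ i\<bar> / (2 * sqrt (t - s')) \<le> norm z / (2 * \<sigma>)"
        using component_le_norm_cart[of z i] \<sigma> le by (intro frac_le) auto
      then have "\<bar>z $ i\<bar> / (2 * sqrt (t - s')) * norm (partial i (f s') (P s' z)) \<le> norm z / (2 * \<sigma>) * B"
        using bd(3)[OF s't, of i "P s' z"] \<sigma> by (intro mult_mono) auto
      then show "norm ((z $ i / (2 * sqrt (t - s'))) *\<^sub>R partial i (f s') (P s' z)) \<le> norm z / (2 * \<sigma>) * B"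
        using s't by simp
    qed (use bd(2)[OF s't] in auto)
    also have "\<dots> = B * 1 + (3 * B / (2 * \<sigma>)) * norm z"
      by simp
    also have "\<dots> \<le> B * (1 + norm z) + (3 * B / (2 * \<sigma>)) * (1 + norm z)"
      using B \<sigma> by (intro add_mono mult_left_mono) auto
    finally show ?thesis
      by (simp add: distrib_right)
  qed
  have "((\<lambda>s. \<integral>z. gauss z *\<^sub>R f s (P s z) \<partial>lborel) has_vector_derivative (\<integral>z. gauss z *\<^sub>R v s z \<partial>lborel)) (at s)"
  proof (rule has_vector_derivative_integral(1)[of s 0 "(s + t) / 2"])
    show "s \<in> {0<..<(s + t) / 2}"
      using s by auto
    show "integrable lborel (\<lambda>z. gauss z *\<^sub>R f s' (P s' z))" if "s' \<in> {0<..<(s + t) / 2}" for s'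
    proof -
      have "s' \<in> {0<..<t}"
        using that s by auto
      then show ?thesis
        unfolding P_def by (intro heat_integrand_integrable[OF meas(1) bd(1)])
    qed
    show "((\<lambda>s. gauss z *\<^sub>R f s (P s z)) has_vector_derivative gauss z *\<^sub>R v s' z) (at s')"
      if "s' \<in> {0<..<(s + t) / 2}" for s' z
      using has_vector_derivative_scaleR[OF DERIV_const path[of s' z], of "gauss z"] that s by auto
    show "norm (gauss z *\<^sub>R v s' z) \<le> (B + 3 * B / (2 * \<sigma>)) * ((1 + norm z) * gauss z)"
      if "s' \<in> {0<..<(s + t) / 2}" for s' z
      using mult_right_mono[OF vbd[OF that, of z] gauss_nonneg[of z]] by (simp add: ac_simps)
    show "integrable lborel (\<lambda>z. (B + 3 * B / (2 * \<sigma>)) * ((1 + norm z) * gauss z))"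
      by (rule integrable_mult_right[OF integrable_linear_gauss])
  qed
  then have 1: "((\<lambda>s. heat (t - s) (f s) x) has_vector_derivative (\<integral>z. gauss z *\<^sub>R v s z \<partial>lborel)) (at s)"
    by (rule has_vector_derivative_transform_within_open[of _ _ _ "{0<..<t}"])
      (use s meas in \<open>auto simp: heat_eq_gauss P_def\<close>)
  have gi: "integrable lborel (\<lambda>z. gauss z *\<^sub>R g s (P s z))"
    unfolding P_def by (rule heat_integrand_integrable[OF meas(2)[OF s] bd(2)[OF s]])
  have ppi: "integrable lborel (\<lambda>z. gauss z *\<^sub>R partial i (partial i (f s)) (P s z))" for i
    unfolding P_def by (rule heat_integrand_integrable[OF meas(3)[OF s] bd(4)[OF s]])
  define \<rho> where "\<rho> = sqrt (t - s)"
  have \<rho>: "0 < \<rho>"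
    using s by (simp add: \<rho>_def)
  have parts: "integrable lborel (\<lambda>z. (gauss z * z $ i) *\<^sub>R partial i (f s) (P s z))"
    "(\<integral>z. (gauss z * z $ i) *\<^sub>R partial i (f s) (P s z) \<partial>lborel) =
      - (2 * \<rho>) *\<^sub>R (\<integral>z. gauss z *\<^sub>R partial i (partial i (f s)) (P s z) \<partial>lborel)" for i
  proof -
    have D: "((\<lambda>z. partial i (f s) (P s z)) has_derivative
        (\<lambda>h. frechet_derivative (partial i (f s)) (at (P s z)) (- \<rho> *\<^sub>R h))) (at z)" for z
      by (rule has_derivative_compose[of "P s", OF _ differentiable_frechet[OF diff[OF s]]])
        (auto intro!: derivative_eq_intros simp: P_def[abs_def] \<rho>_def)
    have lin: "linear (frechet_derivative (partial i (f s)) (at (P s z)))" for z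
      by (rule has_derivative_linear[OF differentiable_frechet[OF diff[OF s]]])
    have p: "partial i (\<lambda>z. partial i (f s) (P s z)) z = - \<rho> *\<^sub>R partial i (partial i (f s)) (P s z)" for z
      unfolding partial_unique[OF D] linear_cmul[OF lin] by (simp add: partial_def)
    have cP: "continuous_on UNIV (P s)"
      unfolding P_def by (intro continuous_intros)
    have d: "(\<lambda>z. partial i (f s) (P s z)) differentiable (at z)" for z
      using D unfolding differentiable_def by blast
    have c: "continuous_on UNIV (partial i (\<lambda>z. partial i (f s) (P s z)))"
      unfolding p by (intro continuous_intros continuous_on_compose2[OF cont(3)[OF s] cP]) auto
    have b1: "norm (partial i (f s) (P s z)) \<le> B + \<rho> * B" for z
      using bd(3)[OF s, of i "P s z"] mult_nonneg_nonneg[OF less_imp_le[OF \<rho>] B] by linarith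
    have b2: "norm (partial i (\<lambda>z. partial i (f s) (P s z)) z) \<le> B + \<rho> * B" for z
    proof -
      have "norm (partial i (\<lambda>z. partial i (f s) (P s z)) z) \<le> \<rho> * B"
        unfolding p using mult_left_mono[OF bd(4)[OF s, of i "P s z"], of \<rho>] \<rho> by simp
      then show ?thesis
        using B by linarith
    qed
    show "integrable lborel (\<lambda>z. (gauss z * z $ i) *\<^sub>R partial i (f s) (P s z))"
      by (rule gauss_integration_by_parts(1)[OF d c b1 b2])
    show "(\<integral>z. (gauss z * z $ i) *\<^sub>R partial i (f s) (P s z) \<partial>lborel) =
      - (2 * \<rho>) *\<^sub>R (\<integral>z. gauss z *\<^sub>R partial i (partial i (f s)) (P s z) \<partial>lborel)"
    proof -
      have "gauss z *\<^sub>R - \<rho> *\<^sub>R w = - \<rho> *\<^sub>R gauss z *\<^sub>R w" for z and w :: 'b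
        by (simp add: mult.commute)
      then show ?thesis
        unfolding gauss_integration_by_parts(2)[OF d c b1 b2] p by (simp only: integral_scaleR_right) simp
    qed
  qed
  define W where "W i z = (gauss z * z $ i) *\<^sub>R partial i (f s) (P s z)" for i z
  have Wi: "integrable lborel (W i)" for i
    unfolding W_def[abs_def] by (rule parts)
  have v_eq: "gauss z *\<^sub>R v s z = gauss z *\<^sub>R g s (P s z) + (\<Sum>i\<in>UNIV. (1 / (2 * \<rho>)) *\<^sub>R W i z)" for z
    by (simp add: v_def W_def scaleR_right_distrib scaleR_sum_right \<rho>_def)
  have "(\<integral>z. gauss z *\<^sub>R v s z \<partial>lborel) = (\<integral>z. gauss z *\<^sub>R g s (P s z) \<partial>lborel) +
      (\<Sum>i\<in>UNIV. (1 / (2 * \<rho>)) *\<^sub>R (\<integral>z. W i z \<partial>lborel))"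
    unfolding v_eq using gi Wi by (simp add: Bochner_Integration.integrable_sum)
  also have "\<dots> = (\<integral>z. gauss z *\<^sub>R g s (P s z) \<partial>lborel) -
      (\<Sum>i\<in>UNIV. \<integral>z. gauss z *\<^sub>R partial i (partial i (f s)) (P s z) \<partial>lborel)"
    using \<rho> by (simp add: W_def parts(2) sum_negf)
  also have "\<dots> = (\<integral>z. gauss z *\<^sub>R g s (P s z) - (\<Sum>i\<in>UNIV. gauss z *\<^sub>R partial i (partial i (f s)) (P s z)) \<partial>lborel)"
    using gi ppi by (subst Bochner_Integration.integral_diff) (auto intro!: Bochner_Integration.integrable_sum)
  also have "\<dots> = (\<integral>z. gauss z *\<^sub>R (g s (P s z) - laplacian (f s) (P s z)) \<partial>lborel)"
    by (simp add: laplacian_def scaleR_diff_right scaleR_sum_right)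
  also have "\<dots> = heat (t - s) (\<lambda>y. g s y - laplacian (f s) y) x"
    using s meas[OF s] unfolding laplacian_def by (subst heat_eq_gauss) (auto simp: P_def)
  finally show ?thesis
    using 1 by simp
qed

lemma continuous_on_fourier_time:
  fixes f :: "real \<Rightarrow> real^3 \<Rightarrow> real"
  assumes r: "3 < r" and f: "decay_bound r S f" and c: "\<And>y. continuous_on S (\<lambda>s. f s y)"
  shows "continuous_on S (\<lambda>s. ft (f s) \<xi>)"
proof -
  obtain C where C: "0 \<le> C" "\<And>s x. s \<in> S \<Longrightarrow> norm (f s x) \<le> C * (1 + norm x) powr (- r)"
    using decay_boundE[OF f] by blast
  have m: "f s \<in> borel_measurable borel" if "s \<in> S" for s
    using f that by (auto simp: decay_bound_def intro: borel_measurable_continuous_onI)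
  show ?thesis
    unfolding fourier_def
  proof (rule continuous_on_integral_dominated)
    show "integrable lborel (\<lambda>x::real^3. C * (1 + norm x) powr (- r))"
      using integrable_weight[OF r] by simp
  qed (use C m c in \<open>auto intro!: continuous_intros simp: norm_mult\<close>)
qed

text \<open>Continuity in time is checked frequency by frequency; the decay of the Fourier transforms
  dominates the frequency integral uniformly in time.\<close>

lemma heat_leray_path:
  fixes F :: "real \<Rightarrow> real^3 \<Rightarrow> real^3"
  assumes r: "3 < r" and F: "decays 4 r S F" and S: "S \<subseteq> {..t}"
    and c: "\<And>y. continuous_on S (\<lambda>s. F s y)"
  shows "continuous_on S (\<lambda>s. heat (t - s) (leray (F s)) x)"
    and "\<exists>B. \<forall>s\<in>S. norm (heat (t - s) (leray (F s)) x) \<le> B"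
proof -
  obtain C where C: "0 \<le> C" "\<And>s j \<xi>. s \<in> S \<Longrightarrow> norm (leray_hat (F s) j \<xi>) \<le> C * (1 + norm \<xi>) powr (- real 4)"
    using leray_hat_bound[OF r F] by blast
  have "continuous_on S (\<lambda>s. ft (\<lambda>y. F s y $ k) \<xi>)" for k \<xi>
    by (rule continuous_on_fourier_time[OF r decays_bound[OF decays_nth[OF F]]]) (intro continuous_intros c)
  then have L: "continuous_on S (\<lambda>s. leray_hat (F s) j \<xi>)" for j \<xi>
    unfolding leray_hat_def by (intro continuous_intros)
  have "continuous_on S (\<lambda>s. Re (inv_fourier (\<lambda>\<xi>. of_real (exp (- (t - s) * (norm \<xi>)\<^sup>2)) * leray_hat (F s) j \<xi>) x))" for j
    unfolding inv_fourier_def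
  proof (intro continuous_intros continuous_on_integral_dominated)
    show "continuous_on S (\<lambda>s. leray_hat (F s) j \<xi>)" for \<xi>
      by (rule L)
    show "integrable lborel (\<lambda>x::real^3. C * (1 + norm x) powr (- real 4))"
      using integrable_weight[of 4] by simp
    show "norm (cis (\<xi> \<bullet> x) * (of_real (exp (- (t - s) * (norm \<xi>)\<^sup>2)) * leray_hat (F s) j \<xi>)) \<le> C * (1 + norm \<xi>) powr (- real 4)"
      if "s \<in> S" for s \<xi>
    proof -
      have "0 \<le> (t - s) * (norm \<xi>)\<^sup>2"
        using S that by auto
      then have "exp (- (t - s) * (norm \<xi>)\<^sup>2) \<le> 1"
        by (simp only: mult_minus_left exp_le_one_iff neg_le_0_iff_le)
      then have "exp (- (t - s) * (norm \<xi>)\<^sup>2) * norm (leray_hat (F s) j \<xi>) \<le> norm (leray_hat (F s) j \<xi>)"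
        by (intro mult_left_le_one_le) auto
      then show ?thesis
        using C(2)[OF that, of j \<xi>] by (simp add: norm_mult)
    qed
    show "(\<lambda>\<xi>. cis (\<xi> \<bullet> x) * (of_real (exp (- (t - s) * (norm \<xi>)\<^sup>2)) * leray_hat (F s) j \<xi>)) \<in> borel_measurable lborel"
      if "s \<in> S" for s
      using borel_measurable_leray_hat[OF decays_nth_integrable[OF r F that], of j] by simp
  qed
  moreover have "heat (t - s) (leray (F s)) x $ j = Re (inv_fourier (\<lambda>\<xi>. of_real (exp (- (t - s) * (norm \<xi>)\<^sup>2)) * leray_hat (F s) j \<xi>) x)"
    if "s \<in> S" for s j
    using S that by (intro heat_leray_nth[OF r F]) auto
  ultimately have "continuous_on S (\<lambda>s. heat (t - s) (leray (F s)) x $ j)" for j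
    using continuous_on_cong[OF refl, of S "\<lambda>s. heat (t - s) (leray (F s)) x $ j"] by simp
  then have "continuous_on S (\<lambda>s. \<chi> j. heat (t - s) (leray (F s)) x $ j)"
    by (rule continuous_on_vec_lambda)
  then show "continuous_on S (\<lambda>s. heat (t - s) (leray (F s)) x)"
    by simp
  obtain B where "\<And>s x. s \<in> S \<Longrightarrow> norm (leray (F s) x) \<le> B"
    using leray_bounded[OF r F] by metis
  then have "norm (heat (t - s) (leray (F s)) x) \<le> B" if "s \<in> S" for s
    using S that borel_measurable_continuous_onI[OF leray_continuous[OF leray_hat_integrable[OF r F that]]]
    by (intro heat_norm_bound) auto
  then show "\<exists>B. \<forall>s\<in>S. norm (heat (t - s) (leray (F s)) x) \<le> B"
    by blast
qed

section \<open>Derivatives in space-time\<close>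

lemma frechet_derivative_cong:
  assumes "open S" "x \<in> S" "\<And>y. y \<in> S \<Longrightarrow> f y = g y" "f differentiable (at x)"
  shows "g differentiable (at x)" "frechet_derivative g (at x) = frechet_derivative f (at x)"
proof -
  have "(g has_derivative frechet_derivative f (at x)) (at x)"
    using differentiable_frechet[OF assms(4)] assms(1,2,3) by (rule has_derivative_transform_within_open)
  then show "g differentiable (at x)" "frechet_derivative g (at x) = frechet_derivative f (at x)"
    using frechet_derivative_at[of g] by (auto simp: differentiable_def)
qed

lemma Ck_on_cong:
  assumes S: "open S"
  shows "(\<And>y. y \<in> S \<Longrightarrow> f y = g y) \<Longrightarrow> Ck_on n S f \<Longrightarrow> Ck_on n S g"
proof (induction n arbitrary: f g)
  case 0
  then show ?case
    using continuous_on_cong[of S S f g] by simp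
next
  case (Suc n)
  have d: "f differentiable (at x)" if "x \<in> S" for x
    using Suc.prems(2) that by simp
  have "Ck_on n S (\<lambda>x. frechet_derivative g (at x) v)" for v
  proof (rule Suc.IH)
    show "Ck_on n S (\<lambda>x. frechet_derivative f (at x) v)"
      using Suc.prems(2) by simp
    show "frechet_derivative f (at y) v = frechet_derivative g (at y) v" if "y \<in> S" for y
      using frechet_derivative_cong(2)[OF S that Suc.prems(1) d[OF that]] by simp
  qed
  moreover have "g differentiable (at x)" if "x \<in> S" for x
    using frechet_derivative_cong(1)[OF S that Suc.prems(1) d[OF that]] by simp
  ultimately show ?case
    by simp
qed

lemma smooth_on_cong:
  assumes "open S" "smooth_on S f" "\<And>y. y \<in> S \<Longrightarrow> f y = g y"
  shows "smooth_on S g"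
  unfolding smooth_on_def
proof
  fix n
  have "Ck_on n S f"
    using assms(2) by (simp add: smooth_on_def)
  then show "Ck_on n S g"
    using Ck_on_cong[OF assms(1), of f g n] assms(3) by blast
qed

abbreviation future :: "(real \<times> (real^3)) set" where
  "future \<equiv> {0<..} \<times> UNIV"

definition time_deriv :: "(real \<Rightarrow> real^3 \<Rightarrow> 'b::real_normed_vector) \<Rightarrow> real \<Rightarrow> real^3 \<Rightarrow> 'b" where
  "time_deriv f t x = vector_derivative (\<lambda>s. f s x) (at t)"

lemma open_future: "open future"
  by (intro open_Times) auto

context
  fixes f :: "real \<Rightarrow> real^3 \<Rightarrow> 'b::real_inner"
  assumes f: "smooth_on future (\<lambda>(t, x). f t x)"
begin

lemma spacetime_has_derivative:
  assumes "0 < t"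
  shows "((\<lambda>(t, x). f t x) has_derivative frechet_derivative (\<lambda>(t, x). f t x) (at (t, x))) (at (t, x))"
  using assms by (intro differentiable_frechet smooth_on_differentiable[OF f]) auto

lemma spacetime_partial:
  assumes t: "0 < t"
  shows "f t differentiable (at x)"
    and "partial i (f t) x = frechet_derivative (\<lambda>(t, x). f t x) (at (t, x)) (0, axis i 1)"
proof -
  have "((\<lambda>y. (\<lambda>(t, x). f t x) (t, y)) has_derivative
      (\<lambda>h. frechet_derivative (\<lambda>(t, x). f t x) (at (t, x)) (0, h))) (at x)"
    by (rule has_derivative_compose[of "\<lambda>y. (t, y)", OF _ spacetime_has_derivative[OF t]])
      (auto intro!: derivative_eq_intros)
  then have D: "(f t has_derivative (\<lambda>h. frechet_derivative (\<lambda>(t, x). f t x) (at (t, x)) (0, h))) (at x)"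
    by simp
  show "f t differentiable (at x)"
    using D by (auto simp: differentiable_def)
  show "partial i (f t) x = frechet_derivative (\<lambda>(t, x). f t x) (at (t, x)) (0, axis i 1)"
    by (rule partial_unique[OF D])
qed

lemma spacetime_time_deriv:
  assumes t: "0 < t"
  shows "((\<lambda>s. f s x) has_vector_derivative time_deriv f t x) (at t)"
    and "time_deriv f t x = frechet_derivative (\<lambda>(t, x). f t x) (at (t, x)) (1, 0)"
proof -
  note D = spacetime_has_derivative[OF t, of x]
  have "((\<lambda>s. (\<lambda>(t, x). f t x) (s, x)) has_derivative
      (\<lambda>h. frechet_derivative (\<lambda>(t, x). f t x) (at (t, x)) (h, 0))) (at t)"
    by (rule has_derivative_compose[of "\<lambda>s. (s, x)", OF _ D]) (auto intro!: derivative_eq_intros)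
  then have D': "((\<lambda>s. f s x) has_derivative
      (\<lambda>h. frechet_derivative (\<lambda>(t, x). f t x) (at (t, x)) (h, 0))) (at t)"
    by (simp only: prod.case)
  have "frechet_derivative (\<lambda>(t, x). f t x) (at (t, x)) (h, 0) =
      h *\<^sub>R frechet_derivative (\<lambda>(t, x). f t x) (at (t, x)) (1, 0)" for h
    using linear_cmul[OF has_derivative_linear[OF D], of h "(1, 0)"] by simp
  then have v: "((\<lambda>s. f s x) has_vector_derivative frechet_derivative (\<lambda>(t, x). f t x) (at (t, x)) (1, 0)) (at t)"
    unfolding has_vector_derivative_def by (intro has_derivative_eq_rhs[OF D'] ext)
  then show "time_deriv f t x = frechet_derivative (\<lambda>(t, x). f t x) (at (t, x)) (1, 0)"
    unfolding time_deriv_def by (rule vector_derivative_at)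
  with v show "((\<lambda>s. f s x) has_vector_derivative time_deriv f t x) (at t)"
    by (simp only:)
qed

text \<open>The chain rule along the curve \<open>(s, x - sqrt (t - s) *\<^sub>R z)\<close> needs the total derivative in space-time.\<close>

lemma spacetime_total_derivative:
  assumes t: "0 < t"
  shows "((\<lambda>(s, y). f s y) has_derivative
    (\<lambda>(h, k). h *\<^sub>R time_deriv f t x + (\<Sum>i\<in>UNIV. (k $ i) *\<^sub>R partial i (f t) x))) (at (t, x))"
proof -
  let ?D = "frechet_derivative (\<lambda>(t, x). f t x) (at (t, x))"
  note D = spacetime_has_derivative[OF t, of x]
  note lin = has_derivative_linear[OF D]
  have "?D (h, k) = h *\<^sub>R time_deriv f t x + (\<Sum>i\<in>UNIV. (k $ i) *\<^sub>R partial i (f t) x)" for h k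
  proof -
    have k: "k = (\<Sum>i\<in>UNIV. (k $ i) *\<^sub>R axis i 1)"
      using basis_expansion[of k] by (simp add: scalar_mult_eq_scaleR)
    have "(h, k) = h *\<^sub>R (1, 0) + (\<Sum>i\<in>UNIV. (k $ i) *\<^sub>R (0, axis i 1))"
      by (subst k) (simp add: prod_eq_iff fst_sum snd_sum)
    then have "?D (h, k) = h *\<^sub>R ?D (1, 0) + (\<Sum>i\<in>UNIV. (k $ i) *\<^sub>R ?D (0, axis i 1))"
      by (simp only: linear_add[OF lin] linear_sum[OF lin] linear_cmul[OF lin])
    then show ?thesis
      by (simp add: spacetime_partial(2)[OF t] spacetime_time_deriv(2)[OF t])
  qed
  then have "?D = (\<lambda>(h, k). h *\<^sub>R time_deriv f t x + (\<Sum>i\<in>UNIV. (k $ i) *\<^sub>R partial i (f t) x))"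
    by auto
  with D show ?thesis
    by simp
qed

lemma smooth_on_spacetime_partial: "smooth_on future (\<lambda>(t, x). partial i (f t) x)"
  by (rule smooth_on_cong[OF open_future smooth_on_frechet[OF f, of "(0, axis i 1)"]])
    (auto simp: spacetime_partial)

lemma smooth_on_time_deriv: "smooth_on future (\<lambda>(t, x). time_deriv f t x)"
  by (rule smooth_on_cong[OF open_future smooth_on_frechet[OF f, of "(1, 0)"]])
    (auto simp: spacetime_time_deriv)

lemma spacetime_continuous: "continuous_on future (\<lambda>(t, x). f t x)"
  by (rule smooth_on_continuous[OF f])

end

lemma partial_time_deriv:
  fixes f :: "real \<Rightarrow> real^3 \<Rightarrow> 'b::real_inner"
  assumes f: "smooth_on future (\<lambda>(t, x). f t x)" and t: "0 < t"
  shows "partial i (time_deriv f t) x = time_deriv (\<lambda>t. partial i (f t)) t x"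
proof -
  let ?F = "\<lambda>(t, x). f t x"
  have m: "(t, x) \<in> future"
    using t by simp
  have 1: "frechet_derivative (\<lambda>(t, x). time_deriv f t x) (at (t, x)) =
      frechet_derivative (\<lambda>y. frechet_derivative ?F (at y) (1, 0)) (at (t, x))"
    by (rule frechet_derivative_cong(2)[OF open_future m])
      (auto simp: spacetime_time_deriv[OF f] intro!: smooth_on_differentiable[OF smooth_on_frechet[OF f] m])
  have 2: "frechet_derivative (\<lambda>(t, x). partial i (f t) x) (at (t, x)) =
      frechet_derivative (\<lambda>y. frechet_derivative ?F (at y) (0, axis i 1)) (at (t, x))"
    by (rule frechet_derivative_cong(2)[OF open_future m])
      (auto simp: spacetime_partial[OF f] intro!: smooth_on_differentiable[OF smooth_on_frechet[OF f] m])
  show ?thesis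
    unfolding spacetime_partial(2)[OF smooth_on_time_deriv[OF f] t] 1
      spacetime_time_deriv(2)[OF smooth_on_spacetime_partial[OF f] t] 2
    by (rule frechet_derivative_commute[OF f open_future m])
qed

lemma continuous_on_slice_time:
  assumes "continuous_on (A \<times> UNIV) (\<lambda>(t, x). f t x)"
  shows "continuous_on A (\<lambda>t. f t x)"
proof -
  have "continuous_on A (\<lambda>t. case (t, x) of (t, x) \<Rightarrow> f t x)"
    by (rule continuous_on_compose2[OF assms]) (auto intro!: continuous_intros)
  then show ?thesis
    by simp
qed

text \<open>The time derivative itself is bounded, because the Laplacian decays and the forcing
  \<open>time_deriv f s - laplacian (f s)\<close> is bounded.\<close>

lemma heat_path_derivative:
  fixes f :: "real \<Rightarrow> real^3 \<Rightarrow> 'b::euclidean_space"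
  assumes f: "smooth_on future (\<lambda>(t, x). f t x)" and dec: "decays 2 q {0..t} f" and q: "0 \<le> q"
    and M: "\<And>s y. s \<in> {0<..<t} \<Longrightarrow> norm (time_deriv f s y - laplacian (f s) y) \<le> M"
    and s: "s \<in> {0<..<t}"
  shows "((\<lambda>s. heat (t - s) (f s) x) has_vector_derivative
      heat (t - s) (\<lambda>y. time_deriv f s y - laplacian (f s) y) x) (at s)"
proof -
  have dec2: "decays (Suc (Suc 0)) q {0..t} f"
    using dec by (simp add: numeral_2_eq_2)
  obtain B0 where B0: "0 \<le> B0" "\<And>s y. s \<in> {0..t} \<Longrightarrow> norm (f s y) \<le> B0"
    using decay_bounded[OF decays_bound[OF dec] q] by metis
  have "\<exists>B. 0 \<le> B \<and> (\<forall>s\<in>{0..t}. \<forall>y. norm (partial i (f s) y) \<le> B)" for i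
    using decay_bounded[OF decays_bound[OF decays_partial[OF dec2, of i]] q] by metis
  then obtain B1 where B1: "\<And>i. 0 \<le> B1 i" "\<And>i s y. s \<in> {0..t} \<Longrightarrow> norm (partial i (f s) y) \<le> B1 i"
    by metis
  have "\<exists>B. 0 \<le> B \<and> (\<forall>s\<in>{0..t}. \<forall>y. norm (partial i (partial i (f s)) y) \<le> B)" for i
    using decay_bounded[OF decays_bound[OF decays_partial[OF decays_partial[OF dec2, of i], of i]] q] by metis
  then obtain B2 where B2: "\<And>i. 0 \<le> B2 i" "\<And>i s y. s \<in> {0..t} \<Longrightarrow> norm (partial i (partial i (f s)) y) \<le> B2 i"
    by metis
  have M0: "0 \<le> M"
    using order_trans[OF norm_ge_zero M[OF s]] .
  define B where "B = B0 + (\<Sum>i\<in>UNIV. B1 i) + (\<Sum>i\<in>UNIV. B2 i) + M"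
  have S1: "B1 i \<le> (\<Sum>i\<in>UNIV. B1 i)" "0 \<le> (\<Sum>i\<in>UNIV. B1 i)" for i
    using B1 by (auto intro!: member_le_sum sum_nonneg)
  have S2: "B2 i \<le> (\<Sum>i\<in>UNIV. B2 i)" "0 \<le> (\<Sum>i\<in>UNIV. B2 i)" for i
    using B2 by (auto intro!: member_le_sum sum_nonneg)
  show ?thesis
  proof (rule heat_duhamel_derivative[OF _ _ _ _ _ _ _ _ _ s])
    fix s y assume s: "s \<in> {0<..<t}"
    then have s0: "0 < s" "s \<in> {0..t}"
      by auto
    show "((\<lambda>(s, y). f s y) has_derivative
        (\<lambda>(h, k). h *\<^sub>R time_deriv f s y + (\<Sum>i\<in>UNIV. k $ i *\<^sub>R partial i (f s) y))) (at (s, y))"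
      by (rule spacetime_total_derivative[OF f s0(1)])
    show "partial i (f s) differentiable (at y)" for i
      by (rule decays_differentiable[OF decays_partial[OF dec2] s0(2)])
    show "continuous_on UNIV (f s)"
      by (rule decays_continuous[OF dec s0(2)])
    show "continuous_on UNIV (time_deriv f s)"
    proof -
      have "continuous_on UNIV (\<lambda>y. case (s, y) of (s, y) \<Rightarrow> time_deriv f s y)"
        by (rule continuous_on_compose2[OF spacetime_continuous[OF smooth_on_time_deriv[OF f]]])
          (use s0 in \<open>auto intro!: continuous_intros\<close>)
      then show ?thesis
        by simp
    qed
    show "continuous_on UNIV (partial i (partial i (f s)))" for i
      by (rule decays_continuous[OF decays_partial[OF decays_partial[OF dec2]] s0(2)])
    show "norm (f s y) \<le> B"
      using B0(2)[OF s0(2), of y] S1 S2 M0 unfolding B_def by linarith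
    show "norm (partial i (f s) y) \<le> B" for i
      using B1(2)[OF s0(2), of i y] S1(1)[of i] S2(2) B0(1) M0 unfolding B_def by linarith
    show "norm (partial i (partial i (f s)) y) \<le> B" for i
      using B2(2)[OF s0(2), of i y] S2(1)[of i] S1(2) B0(1) M0 unfolding B_def by linarith
    show "norm (time_deriv f s y) \<le> B"
    proof -
      have "norm (laplacian (f s) y) \<le> (\<Sum>i\<in>UNIV. B2 i)"
        unfolding laplacian_def using B2(2)[OF s0(2)] by (intro order_trans[OF norm_sum] sum_mono)
      moreover have "norm (time_deriv f s y) \<le> norm (laplacian (f s) y) + norm (time_deriv f s y - laplacian (f s) y)"
        by (rule norm_triangle_sub)
      ultimately show ?thesis
        using M[OF s, of y] B0(1) S1(2) unfolding B_def by linarith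
    qed
  qed
qed

section \<open>Duhamel's principle on the Fourier side\<close>

lemma fourier_laplacian:
  assumes f: "decays 2 r S f" and r: "3 < r" and s: "s \<in> S"
  shows "ft (laplacian (f s)) \<xi> = - of_real ((norm \<xi>)\<^sup>2) * ft (f s) \<xi>"
proof -
  have f2: "decays (Suc (Suc 0)) r S f"
    using f by (simp add: numeral_2_eq_2)
  have i: "integrable lborel (partial i (partial i (f s)))" for i
    by (rule decay_integrable[OF decays_bound[OF decays_partial[OF decays_partial[OF f2]]] r s])
  have "ft (laplacian (f s)) \<xi> = (\<Sum>i\<in>UNIV. ft (partial i (partial i (f s))) \<xi>)"
    using integrable_cis_mult(2)[OF integrable_of_real[OF i]]
    by (simp add: fourier_def laplacian_def sum_distrib_left)
  also have "\<dots> = (\<Sum>i\<in>UNIV. \<i> * of_real (\<xi> $ i) * (\<i> * of_real (\<xi> $ i) * ft (f s) \<xi>))"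
    using fourier_partial_decays[OF f2 r s] fourier_partial_decays[OF decays_partial[OF f2] r s] by simp
  also have "\<dots> = - of_real (\<Sum>i\<in>UNIV. (\<xi> $ i)\<^sup>2) * ft (f s) \<xi>"
  proof -
    have "\<i> * of_real a * (\<i> * of_real a * z) = - (of_real (a\<^sup>2) * z)" for a z
      by (simp add: complex_eq_iff power2_eq_square)
    then show ?thesis
      by (simp add: sum_distrib_right sum_negf)
  qed
  also have "(\<Sum>i\<in>UNIV. (\<xi> $ i)\<^sup>2) = (norm \<xi>)\<^sup>2"
    by (simp only: power2_norm_eq_inner) (simp add: inner_vec_def power2_eq_square)
  finally show ?thesis .
qed

lemma fourier_time_derivative:
  fixes f g :: "real \<Rightarrow> real^3 \<Rightarrow> real"
  assumes r: "3 < r" and f: "decay_bound r {0<..<t} f" and g: "decay_bound r {0<..<t} g"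
    and der: "\<And>s y. s \<in> {0<..<t} \<Longrightarrow> ((\<lambda>s. f s y) has_real_derivative g s y) (at s)"
    and s: "s \<in> {0<..<t}"
  shows "((\<lambda>s. ft (f s) \<xi>) has_vector_derivative ft (g s) \<xi>) (at s)"
proof -
  obtain C where C: "0 \<le> C" "\<And>s x. s \<in> {0<..<t} \<Longrightarrow> norm (g s x) \<le> C * (1 + norm x) powr (- r)"
    using decay_boundE[OF g] by blast
  show ?thesis
    unfolding fourier_def
  proof (rule has_vector_derivative_integral(1)[OF s])
    show "integrable lborel (\<lambda>x. cis (- (\<xi> \<bullet> x)) * of_real (f s x))" if "s \<in> {0<..<t}" for s
      using decay_integrable[OF f r that] by (intro integrable_cis_mult(2) integrable_of_real)
    show "((\<lambda>s. cis (- (\<xi> \<bullet> x)) * of_real (f s x)) has_vector_derivative cis (- (\<xi> \<bullet> x)) * of_real (g s x)) (at s)"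
      if "s \<in> {0<..<t}" for s x
      using der[OF that] by (intro has_vector_derivative_mult_right has_vector_derivative_of_real)
    show "integrable lborel (\<lambda>x::real^3. C * (1 + norm x) powr (- r))"
      using integrable_weight[OF r] by simp
  qed (use C in \<open>auto simp: norm_mult\<close>)
qed

lemma leray_hat_scaleR:
  "leray_hat (\<lambda>y. f y *\<^sub>R e) j \<xi> = of_real (\<Sum>k\<in>UNIV. leray_symbol \<xi> $ j $ k * e $ k) * ft f \<xi>"
proof -
  have "ft (\<lambda>y. (f y *\<^sub>R e) $ k) \<xi> = of_real (e $ k) * ft f \<xi>" for k
    by (simp add: fourier_def mult.left_commute[of _ "of_real (e $ k)"] mult.commute[of _ "of_real (e $ k)"])
  then show ?thesis
    by (simp add: leray_hat_def sum_distrib_right mult.assoc)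
qed

text \<open>At a fixed frequency \<open>f\<close> satisfies a linear ordinary differential equation with rate
  \<open>- (norm \<xi>)\<^sup>2\<close>, and the integrating factor \<open>exp (- (t - s) * (norm \<xi>)\<^sup>2)\<close> removes this term. The
  weight \<open>t - s\<close> then contributes the first term of the derivative. Since the large factor
  \<open>(norm \<xi>)\<^sup>2\<close> has cancelled, the bounds on the Fourier transforms of \<open>f\<close> and \<open>d\<close> suffice for
  differentiating under the frequency integral.\<close>

lemma heat_leray_duhamel_derivative:
  fixes f g d :: "real \<Rightarrow> real^3 \<Rightarrow> real" and e :: "real^3"
  assumes r: "3 < r" and f: "decays 4 r {0<..<t} f" and d: "decays 4 r {0<..<t} d"
    and der: "\<And>s y. s \<in> {0<..<t} \<Longrightarrow> ((\<lambda>s. f s y) has_real_derivative laplacian (f s) y - d s y) (at s)"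
    and s: "s \<in> {0<..<t}"
  shows "((\<lambda>s. (t - s) *\<^sub>R heat (t - s) (leray (\<lambda>y. f s y *\<^sub>R e)) x) has_vector_derivative
      - heat (t - s) (leray (\<lambda>y. f s y *\<^sub>R e)) x - (t - s) *\<^sub>R heat (t - s) (leray (\<lambda>y. d s y *\<^sub>R e)) x) (at s)"
proof -
  let ?I = "{0<..<t}"
  define L where "L j \<xi> = complex_of_real (\<Sum>k\<in>UNIV. leray_symbol \<xi> $ j $ k * e $ k)" for j \<xi>
  define K where "K = (\<Sum>k\<in>(UNIV::3 set). 2 * \<bar>e $ k\<bar>)"
  have K: "0 \<le> K" "norm (L j \<xi>) \<le> K" for j \<xi>
  proof -
    show "0 \<le> K"
      unfolding K_def by (intro sum_nonneg) simp
    have "norm (L j \<xi>) \<le> (\<Sum>k\<in>UNIV. \<bar>leray_symbol \<xi> $ j $ k * e $ k\<bar>)"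
      unfolding L_def norm_of_real by (rule sum_abs)
    also have "\<dots> \<le> K"
      unfolding K_def abs_mult using leray_symbol_bound by (intro sum_mono mult_right_mono) auto
    finally show "norm (L j \<xi>) \<le> K" .
  qed
  have Lm[measurable]: "L j \<in> borel_measurable borel" for j
    unfolding L_def by measurable
  obtain C1 where C1: "0 \<le> C1" "\<And>s \<xi>. s \<in> ?I \<Longrightarrow> norm (ft (f s) \<xi>) \<le> C1 * (1 + norm \<xi>) powr (- real 4)"
    using fourier_decay_powr[OF r f] by metis
  obtain C2 where C2: "0 \<le> C2" "\<And>s \<xi>. s \<in> ?I \<Longrightarrow> norm (ft (d s) \<xi>) \<le> C2 * (1 + norm \<xi>) powr (- real 4)"
    using fourier_decay_powr[OF r d] by metis
  define E where "E s \<xi> = complex_of_real (exp (- (t - s) * (norm \<xi>)\<^sup>2))" for s and \<xi> :: "real^3"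
  have E1: "norm (E s \<xi>) \<le> 1" if "s \<in> ?I" for s \<xi>
  proof -
    have "0 \<le> (t - s) * (norm \<xi>)\<^sup>2"
      using that by auto
    then show ?thesis
      unfolding E_def by simp (simp add: algebra_simps)
  qed
  have Em[measurable]: "E s \<in> borel_measurable borel" for s
    unfolding E_def by measurable
  have ftm: "ft (f s) \<in> borel_measurable borel" "ft (d s) \<in> borel_measurable borel" if "s \<in> ?I" for s
    using decay_integrable[OF decays_bound[OF f] r that] decay_integrable[OF decays_bound[OF d] r that]
    by (auto intro!: borel_measurable_ft)
  (* Up to the symbol L, the transform of the differentiated quantity, and its time derivative after
     the two terms with the factor (norm \<xi>)\<^sup>2 have cancelled. *)
  define H where "H s \<xi> = of_real (t - s) * (E s \<xi> * ft (f s) \<xi>)" for s \<xi>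
  define H' where "H' s \<xi> = - (E s \<xi> * ft (f s) \<xi>) - of_real (t - s) * (E s \<xi> * ft (d s) \<xi>)" for s \<xi>
  have ft': "((\<lambda>s. ft (f s) \<xi>) has_vector_derivative - of_real ((norm \<xi>)\<^sup>2) * ft (f s) \<xi> - ft (d s) \<xi>) (at s)"
    if s: "s \<in> ?I" for s \<xi>
  proof -
    have lap: "decays 2 r ?I (\<lambda>s. laplacian (f s))"
    proof -
      have "decays (Suc (Suc 2)) r ?I f"
        using f by (simp add: eval_nat_numeral)
      then show ?thesis
        unfolding laplacian_def[abs_def] by (intro decays_sum decays_partial)
    qed
    have g: "decay_bound r ?I (\<lambda>s y. laplacian (f s) y - d s y)"
      using decay_bound_add[OF decays_bound[OF lap] decay_bound_linear[OF bounded_linear_minus[OF bounded_linear_ident] decays_bound[OF d]]]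
      by simp
    have "ft (\<lambda>y. laplacian (f s) y - d s y) \<xi> = ft (laplacian (f s)) \<xi> - ft (d s) \<xi>"
      using integrable_cis_mult(2)[OF integrable_of_real[OF decay_integrable[OF decays_bound[OF lap] r s]], of \<xi>]
        integrable_cis_mult(2)[OF integrable_of_real[OF decay_integrable[OF decays_bound[OF d] r s]], of \<xi>]
      by (simp add: fourier_def right_diff_distrib)
    also have "\<dots> = - of_real ((norm \<xi>)\<^sup>2) * ft (f s) \<xi> - ft (d s) \<xi>"
      by (simp only: fourier_laplacian[OF decays_mono[OF f] r s])
    finally show ?thesis
      using fourier_time_derivative[OF r decays_bound[OF f] g der s, of \<xi>] by simp
  qed
  have H': "((\<lambda>s. H s \<xi>) has_vector_derivative H' s \<xi>) (at s)" if s: "s \<in> ?I" for s \<xi>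
  proof -
    have 1: "((\<lambda>s. complex_of_real (t - s)) has_vector_derivative - 1) (at s)"
    proof -
      have "((\<lambda>s. t - s) has_real_derivative - 1) (at s)"
        by (auto intro!: derivative_eq_intros)
      from has_vector_derivative_of_real[OF this] show ?thesis
        by simp
    qed
    have 2: "((\<lambda>s. E s \<xi>) has_vector_derivative of_real ((norm \<xi>)\<^sup>2) * E s \<xi>) (at s)"
    proof -
      have "((\<lambda>s. exp (- (t - s) * (norm \<xi>)\<^sup>2)) has_real_derivative (norm \<xi>)\<^sup>2 * exp (- (t - s) * (norm \<xi>)\<^sup>2)) (at s)"
        by (auto intro!: derivative_eq_intros)
      from has_vector_derivative_of_real[OF this] show ?thesis
        by (simp add: E_def)
    qed
    show ?thesis
      using has_vector_derivative_mult[OF 1 has_vector_derivative_mult[OF 2 ft'[OF s, of \<xi>]]]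
      unfolding H_def H'_def by (simp add: algebra_simps)
  qed
  have Hbd: "norm (cis (\<xi> \<bullet> x) * (L j \<xi> * H s \<xi>)) \<le> K * (t * C1) * (1 + norm \<xi>) powr (- real 4)" if s: "s \<in> ?I" for j s \<xi>
  proof -
    have "norm (E s \<xi>) * norm (ft (f s) \<xi>) \<le> 1 * (C1 * (1 + norm \<xi>) powr (- real 4))"
      using E1[OF s] C1 s by (intro mult_mono) auto
    then have "(t - s) * (norm (E s \<xi>) * norm (ft (f s) \<xi>)) \<le> t * (1 * (C1 * (1 + norm \<xi>) powr (- real 4)))"
      using s by - (rule mult_mono, auto)
    then have "norm (L j \<xi>) * norm (H s \<xi>) \<le> K * (t * (1 * (C1 * (1 + norm \<xi>) powr (- real 4))))"
      using K s by - (rule mult_mono, auto simp: H_def norm_mult simp del: of_real_diff)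
    then show ?thesis
      by (simp add: norm_mult mult.assoc)
  qed
  have H'bd: "norm (cis (\<xi> \<bullet> x) * (L j \<xi> * H' s \<xi>)) \<le> K * (C1 + t * C2) * (1 + norm \<xi>) powr (- real 4)" if s: "s \<in> ?I" for j s \<xi>
  proof -
    have 1: "norm (E s \<xi>) * norm (ft (f s) \<xi>) \<le> 1 * (C1 * (1 + norm \<xi>) powr (- real 4))"
      using E1[OF s] C1 s by (intro mult_mono) auto
    have "norm (E s \<xi>) * norm (ft (d s) \<xi>) \<le> 1 * (C2 * (1 + norm \<xi>) powr (- real 4))"
      using E1[OF s] C2 s by (intro mult_mono) auto
    then have "(t - s) * (norm (E s \<xi>) * norm (ft (d s) \<xi>)) \<le> t * (1 * (C2 * (1 + norm \<xi>) powr (- real 4)))"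
      using s by - (rule mult_mono, auto)
    moreover have "norm (H' s \<xi>) \<le> norm (E s \<xi>) * norm (ft (f s) \<xi>) + (t - s) * (norm (E s \<xi>) * norm (ft (d s) \<xi>))"
      unfolding H'_def using s
      by (intro order_trans[OF norm_triangle_ineq4]) (simp add: norm_mult del: of_real_diff)
    ultimately have "norm (H' s \<xi>) \<le> (C1 + t * C2) * (1 + norm \<xi>) powr (- real 4)"
      using 1 by (simp add: distrib_right mult.assoc)
    then have "norm (L j \<xi>) * norm (H' s \<xi>) \<le> K * ((C1 + t * C2) * (1 + norm \<xi>) powr (- real 4))"
      using K by - (rule mult_mono, auto)
    then show ?thesis
      by (simp add: norm_mult mult.assoc)
  qed
  have w: "integrable lborel (\<lambda>x::real^3. c * (1 + norm x) powr (- real 4))" for c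
    using integrable_weight[of 4] by simp
  have main: "((\<lambda>s. inv_fourier (\<lambda>\<xi>. L j \<xi> * H s \<xi>) x) has_vector_derivative inv_fourier (\<lambda>\<xi>. L j \<xi> * H' s \<xi>) x) (at s)" for j
  proof -
    have "((\<lambda>s. \<integral>\<xi>. cis (\<xi> \<bullet> x) * (L j \<xi> * H s \<xi>) \<partial>lborel) has_vector_derivative
        (\<integral>\<xi>. cis (\<xi> \<bullet> x) * (L j \<xi> * H' s \<xi>) \<partial>lborel)) (at s)"
    proof (rule has_vector_derivative_integral(1)[OF s _ _ H'bd w])
      show "integrable lborel (\<lambda>\<xi>. cis (\<xi> \<bullet> x) * (L j \<xi> * H s \<xi>))" if "s \<in> ?I" for s
        using Hbd[OF that] ftm[OF that] by (intro integrable_weight_bound[where r = 4]) (auto simp: H_def)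
      show "((\<lambda>s. cis (\<xi> \<bullet> x) * (L j \<xi> * H s \<xi>)) has_vector_derivative cis (\<xi> \<bullet> x) * (L j \<xi> * H' s \<xi>)) (at s)"
        if "s \<in> ?I" for s \<xi>
        by (intro has_vector_derivative_mult_right H' that)
    qed
    from has_vector_derivative_scaleR[OF DERIV_const this, of "1 / (2 * pi) ^ 3"] show ?thesis
      by (simp add: inv_fourier_def)
  qed
  have lin: "decays 4 r ?I (\<lambda>s y. h s y *\<^sub>R e)" if "decays 4 r ?I h" for h
    by (rule decays_linear[OF bounded_linear_scaleR_left that])
  have nth: "heat (t - s) (leray (\<lambda>y. h s y *\<^sub>R e)) x $ j = Re (inv_fourier (\<lambda>\<xi>. L j \<xi> * (E s \<xi> * ft (h s) \<xi>)) x)"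
    if "decays 4 r ?I h" "s \<in> ?I" for h s j
    using heat_leray_nth[OF r lin[OF that(1)] that(2), of "t - s" x j] that(2)
    by (simp add: leray_hat_scaleR L_def E_def mult.left_commute)
  have inv_cmult: "inv_fourier (\<lambda>\<xi>. L j \<xi> * (of_real c * h \<xi>)) x = of_real c * inv_fourier (\<lambda>\<xi>. L j \<xi> * h \<xi>) x" for j c h
    unfolding inv_fourier_def by (simp add: mult.left_commute[of _ "of_real c"])
  have comp: "((\<lambda>s. (t - s) * heat (t - s) (leray (\<lambda>y. f s y *\<^sub>R e)) x $ j) has_vector_derivative
      (- heat (t - s) (leray (\<lambda>y. f s y *\<^sub>R e)) x - (t - s) *\<^sub>R heat (t - s) (leray (\<lambda>y. d s y *\<^sub>R e)) x) $ j) (at s)" for j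
  proof -
    have "((\<lambda>s. Re (inv_fourier (\<lambda>\<xi>. L j \<xi> * H s \<xi>) x)) has_vector_derivative Re (inv_fourier (\<lambda>\<xi>. L j \<xi> * H' s \<xi>) x)) (at s)"
      by (rule bounded_linear.has_vector_derivative[OF bounded_linear_Re main])
    then have 1: "((\<lambda>s. (t - s) * heat (t - s) (leray (\<lambda>y. f s y *\<^sub>R e)) x $ j) has_vector_derivative
        Re (inv_fourier (\<lambda>\<xi>. L j \<xi> * H' s \<xi>) x)) (at s)"
      by (rule has_vector_derivative_transform_within_open[where S = ?I])
        (use s in \<open>simp_all add: nth[OF f] H_def inv_cmult del: of_real_diff\<close>)
    have i: "integrable lborel (\<lambda>\<xi>. L j \<xi> * (E s \<xi> * ft (h s) \<xi>))"
      if h: "decays 4 r ?I h" for h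
    proof -
      have "integrable lborel (\<lambda>\<xi>. E s \<xi> * leray_hat (\<lambda>y. h s y *\<^sub>R e) j \<xi>)"
        by (rule integrable_bounded_mult_complex[OF leray_hat_integrable[OF r lin[OF h] s] _ E1[OF s]]) simp
      then show ?thesis
        by (simp add: leray_hat_scaleR L_def mult.left_commute)
    qed
    have "inv_fourier (\<lambda>\<xi>. L j \<xi> * H' s \<xi>) x =
        - inv_fourier (\<lambda>\<xi>. L j \<xi> * (E s \<xi> * ft (f s) \<xi>)) x - inv_fourier (\<lambda>\<xi>. L j \<xi> * (of_real (t - s) * (E s \<xi> * ft (d s) \<xi>))) x"
    proof -
      have "cis (\<xi> \<bullet> x) * (L j \<xi> * H' s \<xi>) = - (cis (\<xi> \<bullet> x) * (L j \<xi> * (E s \<xi> * ft (f s) \<xi>))) -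
          of_real (t - s) * (cis (\<xi> \<bullet> x) * (L j \<xi> * (E s \<xi> * ft (d s) \<xi>)))" for \<xi>
        unfolding H'_def by (simp add: algebra_simps)
      moreover have "cis (\<xi> \<bullet> x) * (L j \<xi> * (of_real (t - s) * (E s \<xi> * ft (d s) \<xi>))) =
          of_real (t - s) * (cis (\<xi> \<bullet> x) * (L j \<xi> * (E s \<xi> * ft (d s) \<xi>)))" for \<xi>
        by (simp add: algebra_simps)
      moreover have "integrable lborel (\<lambda>\<xi>. - (cis (\<xi> \<bullet> x) * (L j \<xi> * (E s \<xi> * ft (f s) \<xi>))))"
        using integrable_cis_mult(1)[OF i[OF f], of x] by simp
      moreover have "integrable lborel (\<lambda>\<xi>. of_real (t - s) * (cis (\<xi> \<bullet> x) * (L j \<xi> * (E s \<xi> * ft (d s) \<xi>))))"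
        by (rule integrable_mult_right[OF integrable_cis_mult(1)[OF i[OF d]]])
      ultimately show ?thesis
        unfolding inv_fourier_def by (simp only: Bochner_Integration.integral_diff integral_minus scaleR_diff_right scaleR_minus_right)
    qed
    then have "Re (inv_fourier (\<lambda>\<xi>. L j \<xi> * H' s \<xi>) x) =
        (- heat (t - s) (leray (\<lambda>y. f s y *\<^sub>R e)) x - (t - s) *\<^sub>R heat (t - s) (leray (\<lambda>y. d s y *\<^sub>R e)) x) $ j"
      by (simp add: nth[OF f s] nth[OF d s] inv_cmult del: of_real_diff)
    with 1 show ?thesis
      by simp
  qed
  have expand: "v = (\<Sum>j\<in>UNIV. (v $ j) *\<^sub>R axis j 1)" for v :: "real^3"
    using basis_expansion[of v] by (simp add: scalar_mult_eq_scaleR)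
  have "((\<lambda>s. \<Sum>j\<in>UNIV. ((t - s) * heat (t - s) (leray (\<lambda>y. f s y *\<^sub>R e)) x $ j) *\<^sub>R (axis j 1 :: real^3)) has_vector_derivative
      (\<Sum>j\<in>UNIV. ((- heat (t - s) (leray (\<lambda>y. f s y *\<^sub>R e)) x - (t - s) *\<^sub>R heat (t - s) (leray (\<lambda>y. d s y *\<^sub>R e)) x) $ j) *\<^sub>R axis j 1)) (at s)"
    by (intro has_vector_derivative_sum bounded_linear.has_vector_derivative[OF bounded_linear_scaleR_left comp])
  moreover have "(\<Sum>j\<in>UNIV. ((t - s) * heat (t - s) (leray (\<lambda>y. f s y *\<^sub>R e)) x $ j) *\<^sub>R (axis j 1 :: real^3)) =
      (t - s) *\<^sub>R heat (t - s) (leray (\<lambda>y. f s y *\<^sub>R e)) x" for s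
    using expand[of "(t - s) *\<^sub>R heat (t - s) (leray (\<lambda>y. f s y *\<^sub>R e)) x"] by simp
  ultimately show ?thesis
    by (simp only: expand[symmetric])
qed

section \<open>Decaying solutions of the Boussinesq system\<close>

lemma decays_vec:
  fixes F :: "'i \<Rightarrow> real^3 \<Rightarrow> real^3"
  assumes "\<And>k. decays n r S (\<lambda>s y. F s y $ k)"
  shows "decays n r S F"
proof -
  have "decays n r S (\<lambda>s y. \<Sum>k\<in>UNIV. (F s y $ k) *\<^sub>R axis k 1)"
    by (intro decays_sum decays_linear[OF bounded_linear_scaleR_left] assms)
  then show ?thesis
    by (rule decays_transfer) (simp add: scalar_mult_eq_scaleR[symmetric] basis_expansion)
qed

lemma partial_trace_zero:
  fixes w :: "3 \<Rightarrow> real^3 \<Rightarrow> real^3"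
  assumes "\<And>i x. w i differentiable (at x)" and "\<And>x. (\<Sum>i\<in>UNIV. w i x $ i) = 0"
  shows "(\<Sum>i\<in>UNIV. partial h (w i) x $ i) = 0"
proof -
  have "(\<Sum>i\<in>UNIV. partial h (w i) x $ i) = partial h (\<lambda>x. \<Sum>i\<in>UNIV. w i x $ i) x"
    using assms(1) by (simp add: partial_sum partial_nth)
  also have "\<dots> = 0"
    unfolding assms(2) using partial_unique[OF has_derivative_const] by auto
  finally show ?thesis .
qed

lemma divergence_eq: "(\<And>x. v differentiable (at x)) \<Longrightarrow> divergence v x = (\<Sum>i\<in>UNIV. partial i v x $ i)"
  by (simp add: divergence_def partial_nth)

text \<open>The Laplacian commutes with the divergence; differentiating \<open>div v = 0\<close> twice in the same
  direction gives the summands.\<close>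

lemma divergence_laplacian:
  fixes v :: "real^3 \<Rightarrow> real^3"
  assumes v: "smooth_on UNIV v" and div: "\<And>x. divergence v x = 0"
  shows "divergence (laplacian v) x = 0"
proof -
  have d: "g differentiable (at x)" if "smooth_on UNIV g" for g :: "real^3 \<Rightarrow> real^3" and x
    using smooth_on_differentiable[OF that] by simp
  note sp = smooth_on_partial
  have "(\<Sum>i\<in>UNIV. partial i v x $ i) = 0" for x
    using div[of x] d[OF v] by (simp add: divergence_eq)
  then have "(\<Sum>i\<in>UNIV. partial h (partial i v) x $ i) = 0" for h x
    by (intro partial_trace_zero[where w = "\<lambda>i. partial i v"] d sp v)
  then have 0: "(\<Sum>i\<in>UNIV. partial h (partial h (partial i v)) x $ i) = 0" for h x
    by (intro partial_trace_zero[where w = "\<lambda>i. partial h (partial i v)" for h] d sp v)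
  have dl: "laplacian v differentiable (at x)" for x
    unfolding laplacian_def[abs_def] by (intro differentiable_sum) (auto intro: d sp v)
  have "divergence (laplacian v) x = (\<Sum>i\<in>UNIV. \<Sum>h\<in>UNIV. partial i (partial h (partial h v)) x $ i)"
    unfolding divergence_eq[OF dl] unfolding laplacian_def[abs_def]
    by (subst partial_sum) (auto intro: d sp v)
  also have "\<dots> = (\<Sum>i\<in>UNIV. \<Sum>h\<in>UNIV. partial h (partial h (partial i v)) x $ i)"
  proof -
    have "partial i (partial h (partial h v)) x $ i = partial h (partial h (partial i v)) x $ i" for i h
      by (simp only: partial_commute[OF sp[OF v, of h], of i h] partial_commute[OF v, of i h])
    then show ?thesis
      by (rule sum.cong[OF refl sum.cong[OF refl]])
  qed
  also have "\<dots> = 0"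
    by (subst sum.swap) (simp add: 0)
  finally show ?thesis .
qed

locale decaying_boussinesq =
  fixes u :: "real \<Rightarrow> real^3 \<Rightarrow> real^3" and \<theta> p :: "real \<Rightarrow> real^3 \<Rightarrow> real" and a b :: real
  assumes solution: "smooth_boussinesq_solution u \<theta> p"
    and a: "3/2 < a" "spatial_decay a u" and b: "3 < b" "spatial_decay b \<theta>"
    and grad_p: "\<And>t. 0 < t \<Longrightarrow> (grad (p t) \<longlongrightarrow> 0) at_infinity"
begin

lemma smooth_u: "smooth_on future (\<lambda>(t, x). u t x)"
  and smooth_\<theta>: "smooth_on future (\<lambda>(t, x). \<theta> t x)"
  and smooth_p: "0 < t \<Longrightarrow> smooth_on UNIV (p t)"
  and cont_u: "continuous_on ({0..} \<times> UNIV) (\<lambda>(t, x). u t x)"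
  and cont_\<theta>: "continuous_on ({0..} \<times> UNIV) (\<lambda>(t, x). \<theta> t x)"
  and momentum: "0 < t \<Longrightarrow> time_deriv u t x + advect (u t) (u t) x + grad (p t) x = laplacian (u t) x + \<theta> t x *\<^sub>R e3"
  and div_free: "0 < t \<Longrightarrow> divergence (u t) x = 0"
  and transport: "0 < t \<Longrightarrow> time_deriv \<theta> t x + advect (u t) (\<theta> t) x = laplacian (\<theta> t) x"
  using solution unfolding smooth_boussinesq_solution_def time_deriv_def by auto

lemma decays_u: "decays n a {0..T} u"
  by (rule decays_if_spatial_decay[OF a(2)])

lemma decays_\<theta>: "decays n b {0..T} \<theta>"
  by (rule decays_if_spatial_decay[OF b(2)])

lemma smooth_on_u: "0 \<le> t \<Longrightarrow> smooth_on UNIV (u t)"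
  using a(2) by (simp add: spatial_decay_def)

lemma differentiable_u: "0 \<le> t \<Longrightarrow> u t differentiable (at x)"
  using smooth_on_differentiable[OF smooth_on_u] by simp

lemma differentiable_\<theta>: "0 \<le> t \<Longrightarrow> \<theta> t differentiable (at x)"
  using smooth_on_differentiable[of UNIV "\<theta> t"] b(2) by (simp add: spatial_decay_def)

definition convection :: "real \<Rightarrow> real^3 \<Rightarrow> real^3" where
  "convection t = tensor_div (\<lambda>y. tensor (u t y) (u t y))"

definition flux_div :: "real \<Rightarrow> real^3 \<Rightarrow> real" where
  "flux_div t = divergence (\<lambda>y. \<theta> t y *\<^sub>R u t y)"

definition forcing :: "real \<Rightarrow> real^3 \<Rightarrow> real^3" where
  "forcing t y = \<theta> t y *\<^sub>R e3 - convection t y"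

lemma convection_nth: "convection t y $ k = (\<Sum>h\<in>UNIV. partial h (\<lambda>y. u t y $ k * u t y $ h) y)"
  by (simp add: convection_def tensor_div_def tensor_def)

lemma flux_div_eq: "flux_div t y = (\<Sum>h\<in>UNIV. partial h (\<lambda>y. \<theta> t y * u t y $ h) y)"
  by (simp add: flux_div_def divergence_def)

lemma tensor_div_buoyancy: "tensor_div (\<lambda>y. tensor (\<theta> t y *\<^sub>R e3) (u t y)) y = flux_div t y *\<^sub>R e3"
proof -
  have "partial h (\<lambda>y. \<theta> t y * axis 3 1 $ k * u t y $ h) y = partial h (\<lambda>y. \<theta> t y * u t y $ h) y * axis 3 1 $ k"
    for h k :: 3
    using partial_unique[OF has_derivative_const, of h 0 y] by (cases "k = 3") (simp_all add: axis_def)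
  then show ?thesis
    by (simp add: vec_eq_iff tensor_div_def tensor_def flux_div_eq sum_distrib_right)
qed

lemma decays_convection: "decays n (a + a) {0..T} convection"
proof (rule decays_vec)
  fix k
  have "decays n (a + a) {0..T} (\<lambda>t y. \<Sum>h\<in>UNIV. partial h (\<lambda>y. u t y $ k * u t y $ h) y)"
    by (intro decays_sum decays_partial decays_bilinear[OF bounded_bilinear_mult] decays_nth decays_u)
  then show "decays n (a + a) {0..T} (\<lambda>t y. convection t y $ k)"
    by (simp add: convection_nth)
qed

lemma decays_flux_div: "decays n (b + a) {0..T} flux_div"
proof -
  have "decays n (b + a) {0..T} (\<lambda>t y. \<Sum>h\<in>UNIV. partial h (\<lambda>y. \<theta> t y * u t y $ h) y)"
    by (intro decays_sum decays_partial decays_bilinear[OF bounded_bilinear_mult] decays_nth decays_u decays_\<theta>)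
  then show ?thesis
    by (simp add: flux_div_eq[symmetric])
qed

lemma decays_buoyancy: "decays n b {0..T} (\<lambda>t y. \<theta> t y *\<^sub>R e3)"
  by (rule decays_linear[OF bounded_linear_scaleR_left decays_\<theta>])

text \<open>The weaker of the decay rates of the buoyancy and of the convection term; it still exceeds the
  dimension, so that the forcing can be Fourier transformed.\<close>

definition rate :: real where "rate = min b (a + a)"

lemma rate: "3 < rate" "rate \<le> b" "rate \<le> a + a"
  using a b by (auto simp: rate_def)

lemma decays_forcing: "decays n rate {0..T} forcing"
proof -
  have "decays n rate {0..T} (\<lambda>t y. \<theta> t y *\<^sub>R e3 + - convection t y)"
    by (intro decays_add decays_weaken[OF decays_buoyancy rate(2)]
      decays_linear[OF bounded_linear_minus[OF bounded_linear_ident]] decays_weaken[OF decays_convection rate(3)])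
  then show ?thesis
    by (rule decays_transfer) (simp add: forcing_def)
qed

lemma div_free_sum: "0 < t \<Longrightarrow> (\<Sum>h\<in>UNIV. partial h (u t) x $ h) = 0"
  using div_free[of t x] differentiable_u[of t] by (simp add: divergence_eq)

text \<open>The two forms differ by \<open>u\<close> times its divergence.\<close>

lemma convection_eq_advect:
  assumes t: "0 < t"
  shows "convection t x = advect (u t) (u t) x"
proof -
  have d: "(\<lambda>y. u t y $ k) differentiable (at x)" "partial h (\<lambda>y. u t y $ k) x = partial h (u t) x $ k" for k h
    using partial_nth[OF differentiable_u[of t x]] t by auto
  have "convection t x $ k = advect (u t) (u t) x $ k" for k
  proof -
    have "convection t x $ k = (\<Sum>h\<in>UNIV. u t x $ k * partial h (u t) x $ h + partial h (u t) x $ k * u t x $ h)"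
      unfolding convection_nth using d by (simp add: partial_bilinear(2)[OF bounded_bilinear_mult])
    also have "\<dots> = u t x $ k * (\<Sum>h\<in>UNIV. partial h (u t) x $ h) + advect (u t) (u t) x $ k"
      by (simp add: sum.distrib sum_distrib_left advect_def mult.commute)
    finally show ?thesis
      by (simp add: div_free_sum[OF t])
  qed
  then show ?thesis
    by (simp add: vec_eq_iff)
qed

lemma flux_div_eq_advect:
  assumes t: "0 < t"
  shows "flux_div t x = advect (u t) (\<theta> t) x"
proof -
  have d: "(\<lambda>y. u t y $ k) differentiable (at x)" "partial h (\<lambda>y. u t y $ k) x = partial h (u t) x $ k" for k h
    using partial_nth[OF differentiable_u[of t x]] t by auto
  have "flux_div t x = (\<Sum>h\<in>UNIV. \<theta> t x * partial h (u t) x $ h + partial h (\<theta> t) x * u t x $ h)"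
    unfolding flux_div_eq using d differentiable_\<theta>[of t x] t by (simp add: partial_bilinear(2)[OF bounded_bilinear_mult])
  also have "\<dots> = \<theta> t x * (\<Sum>h\<in>UNIV. partial h (u t) x $ h) + advect (u t) (\<theta> t) x"
    by (simp add: sum.distrib sum_distrib_left advect_def mult.commute)
  finally show ?thesis
    by (simp add: div_free_sum[OF t])
qed

text \<open>The time derivative of \<open>div u = 0\<close>, with the order of differentiation exchanged.\<close>

lemma divergence_time_deriv:
  assumes t: "0 < t"
  shows "divergence (time_deriv u t) x = 0"
proof -
  have "((\<lambda>s. \<Sum>i\<in>UNIV. partial i (u s) x $ i) has_vector_derivative
      (\<Sum>i\<in>UNIV. time_deriv (\<lambda>t. partial i (u t)) t x $ i)) (at t)"
    by (intro has_vector_derivative_sum bounded_linear.has_vector_derivative[OF bounded_linear_vec_nth]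
      spacetime_time_deriv(1)[OF smooth_on_spacetime_partial[OF smooth_u] t])
  moreover have "((\<lambda>s. \<Sum>i\<in>UNIV. partial i (u s) x $ i) has_vector_derivative 0) (at t)"
    by (rule has_vector_derivative_transform_within_open[OF has_vector_derivative_const, where S = "{0<..}"])
      (use t div_free_sum in auto)
  ultimately have "(\<Sum>i\<in>UNIV. time_deriv (\<lambda>t. partial i (u t)) t x $ i) = 0"
    by (rule vector_derivative_unique_at)
  then show ?thesis
    using spacetime_partial(1)[OF smooth_on_time_deriv[OF smooth_u] t]
    by (simp add: divergence_eq partial_time_deriv[OF smooth_u t])
qed

lemma grad_p_eq: "0 < t \<Longrightarrow> grad (p t) x = forcing t x - (time_deriv u t x - laplacian (u t) x)"
  using momentum[of t x] by (simp add: forcing_def convection_eq_advect algebra_simps)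

text \<open>The divergence of the momentum equation: the time derivative and the Laplacian of the velocity
  are divergence free, so only the forcing remains.\<close>

lemma laplacian_p:
  assumes t: "0 < t"
  shows "laplacian (p t) x = divergence (forcing t) x"
proof -
  have f: "forcing t differentiable (at x)" for x
    using decays_differentiable[OF decays_forcing[of "Suc 0" t], of t x] t by simp
  have td: "time_deriv u t differentiable (at x)" for x
    by (rule spacetime_partial(1)[OF smooth_on_time_deriv[OF smooth_u] t])
  have lu: "laplacian (u t) differentiable (at x)" for x
    unfolding laplacian_def[abs_def] using t
    using smooth_on_differentiable[OF smooth_on_partial[OF smooth_on_partial[OF smooth_on_u]]]
    by (intro differentiable_sum) auto
  have "partial i (partial i (p t)) x = partial i (forcing t) x $ i - (partial i (time_deriv u t) x $ i - partial i (laplacian (u t)) x $ i)" for i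
  proof -
    have "partial i (p t) = (\<lambda>x. forcing t x $ i - (time_deriv u t x $ i - laplacian (u t) x $ i))"
      using grad_p_eq[OF t] by (auto simp: fun_eq_iff grad_def vec_eq_iff)
    then show ?thesis
      using partial_nth[OF f] partial_nth[OF td] partial_nth[OF lu]
      by (simp add: partial_diff differentiable_diff)
  qed
  then have "laplacian (p t) x = (\<Sum>i\<in>UNIV. partial i (forcing t) x $ i) -
      ((\<Sum>i\<in>UNIV. partial i (time_deriv u t) x $ i) - (\<Sum>i\<in>UNIV. partial i (laplacian (u t)) x $ i))"
    by (simp add: laplacian_def sum_subtractf)
  also have "\<dots> = divergence (forcing t) x - (divergence (time_deriv u t) x - divergence (laplacian (u t)) x)"
    using f td lu by (simp add: divergence_eq)
  finally show ?thesis
    using divergence_time_deriv[OF t] divergence_laplacian[OF smooth_on_u div_free] t by simp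
qed

text \<open>Eliminates the pressure: \<open>u\<close> solves a heat equation with forcing \<open>leray (forcing t)\<close>.\<close>

lemma leray_forcing:
  assumes t: "0 < t"
  shows "time_deriv u t x - laplacian (u t) x = leray (forcing t) x"
  using leray_eq_minus_grad[OF rate(1) decays_forcing[of 6 t] _ smooth_p[OF t] grad_p[OF t] laplacian_p[OF t]]
    grad_p_eq[OF t, of x] t by simp

lemma leray_forcing_split:
  assumes t: "0 \<le> t"
  shows "leray (forcing t) x = leray (\<lambda>y. \<theta> t y *\<^sub>R e3) x - leray (convection t) x"
proof -
  have m: "t \<in> {0..t}"
    using t by simp
  have B: "decays 4 rate {0..t} (\<lambda>t y. \<theta> t y *\<^sub>R e3)" and C: "decays 4 rate {0..t} convection"
    using decays_weaken[OF decays_buoyancy rate(2)] decays_weaken[OF decays_convection rate(3)] by auto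
  have "forcing t = (\<lambda>y. \<theta> t y *\<^sub>R e3 - convection t y)"
    by (simp add: forcing_def fun_eq_iff)
  then show ?thesis
    using leray_diff[OF decays_nth_integrable[OF rate(1) B m] leray_hat_integrable[OF rate(1) B m]
      decays_nth_integrable[OF rate(1) C m] leray_hat_integrable[OF rate(1) C m]] by simp
qed

lemma convection_continuous_time: "continuous_on {0<..} (\<lambda>t. convection t y)"
proof -
  have "continuous_on {0<..} (\<lambda>t. advect (u t) (u t) y)"
    unfolding advect_def
    by (intro continuous_intros continuous_on_slice_time[OF spacetime_continuous[OF smooth_u]]
      continuous_on_slice_time[OF spacetime_continuous[OF smooth_on_spacetime_partial[OF smooth_u]]])
  then show ?thesis
    by (rule continuous_on_cong[THEN iffD1, rotated 2]) (auto simp: convection_eq_advect)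
qed

lemma flux_div_continuous: "continuous_on future (\<lambda>(t, y). flux_div t y)"
proof -
  have "continuous_on future (\<lambda>z. \<Sum>i\<in>UNIV. (case z of (t, y) \<Rightarrow> u t y) $ i * (case z of (t, y) \<Rightarrow> partial i (\<theta> t) y))"
    by (intro continuous_intros spacetime_continuous[OF smooth_u]
      spacetime_continuous[OF smooth_on_spacetime_partial[OF smooth_\<theta>]])
  then show ?thesis
    by (rule continuous_on_cong[THEN iffD1, rotated 2]) (auto simp: flux_div_eq_advect advect_def)
qed

lemma velocity_path_derivative:
  assumes s: "s \<in> {0<..<t}"
  shows "((\<lambda>s. heat (t - s) (u s) x) has_vector_derivative heat (t - s) (leray (forcing s)) x) (at s)"
proof -
  obtain B where B: "\<And>s y. s \<in> {0..t} \<Longrightarrow> norm (leray (forcing s) y) \<le> B"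
    using leray_bounded[OF rate(1) decays_forcing] by metis
  have "norm (time_deriv u s y - laplacian (u s) y) \<le> B" if "s \<in> {0<..<t}" for s y
    using B[of s y] that by (simp add: leray_forcing)
  from heat_path_derivative[OF smooth_u decays_u _ this s]
  have "((\<lambda>s. heat (t - s) (u s) x) has_vector_derivative
      heat (t - s) (\<lambda>y. time_deriv u s y - laplacian (u s) y) x) (at s)"
    using a by simp
  moreover have "(\<lambda>y. time_deriv u s y - laplacian (u s) y) = leray (forcing s)"
    using leray_forcing s by (auto simp: fun_eq_iff)
  ultimately show ?thesis
    by simp
qed

text \<open>As \<open>u\<close> is divergence free, the transport term is the divergence of \<open>\<theta> u\<close>.\<close>

lemma temperature_equation:
  "0 < s \<Longrightarrow> time_deriv \<theta> s y = laplacian (\<theta> s) y - flux_div s y"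
  using transport[of s y] by (simp add: flux_div_eq_advect)

lemma temperature_path_derivative:
  assumes s: "s \<in> {0<..<t}"
  shows "((\<lambda>s. heat (t - s) (\<theta> s) x) has_vector_derivative - heat (t - s) (flux_div s) x) (at s)"
proof -
  obtain B where B: "\<And>s y. s \<in> {0..t} \<Longrightarrow> norm (flux_div s y) \<le> B"
  proof -
    have "0 \<le> b + a"
      using a b by simp
    then show ?thesis
      using that decay_bounded[OF decays_bound[OF decays_flux_div[of 0]]] by metis
  qed
  have "norm (time_deriv \<theta> s y - laplacian (\<theta> s) y) \<le> B" if "s \<in> {0<..<t}" for s y
    using B[of s y] that by (simp add: temperature_equation)
  from heat_path_derivative[OF smooth_\<theta> decays_\<theta> _ this s]
  have "((\<lambda>s. heat (t - s) (\<theta> s) x) has_vector_derivative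
      heat (t - s) (\<lambda>y. time_deriv \<theta> s y - laplacian (\<theta> s) y) x) (at s)"
    using b by simp
  moreover have "(\<lambda>y. time_deriv \<theta> s y - laplacian (\<theta> s) y) = (\<lambda>y. - flux_div s y)"
    using temperature_equation s by (auto simp: fun_eq_iff)
  moreover have "heat (t - s) (\<lambda>y. - flux_div s y) x = - heat (t - s) (flux_div s) x"
  proof (rule heat_bounded_linear[OF bounded_linear_minus[OF bounded_linear_ident]])
    show "flux_div s \<in> borel_measurable borel"
      using decays_continuous[OF decays_flux_div[of 0 t], of s] s by (intro borel_measurable_continuous_onI) auto
    show "norm (flux_div s y) \<le> B" for y
      using B[of s y] s by auto
  qed (use s in auto)
  ultimately show ?thesis
    by simp
qed

lemma temperature_formula:
  assumes t: "0 \<le> t"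
  shows "set_integrable lborel {0<..<t} (\<lambda>s. heat (t - s) (flux_div s) x)"
    and "\<theta> t x = heat t (\<theta> 0) x - (LBINT s:{0<..<t}. heat (t - s) (flux_div s) x)"
proof -
  have b0: "0 \<le> b" "0 \<le> b + a"
    using a b by auto
  obtain B where B: "0 \<le> B" "\<And>s y. s \<in> {0..t} \<Longrightarrow> norm (flux_div s y) \<le> B"
    using decay_bounded[OF decays_bound[OF decays_flux_div[of 0]] b0(2)] by metis
  show int: "set_integrable lborel {0<..<t} (\<lambda>s. heat (t - s) (flux_div s) x)"
  proof (rule set_integrable_bounded_open)
    show "continuous_on {0<..<t} (\<lambda>s. heat (t - s) (flux_div s) x)"
      by (rule continuous_on_heat_path[OF continuous_on_subset[OF flux_div_continuous], where B = B]) (use B in auto)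
    show "norm (heat (t - s) (flux_div s) x) \<le> B" if "s \<in> {0<..<t}" for s
      using that B decays_continuous[OF decays_flux_div[of 0 t], of s]
      by (intro heat_norm_bound borel_measurable_continuous_onI) auto
  qed
  obtain B0 where B0: "0 \<le> B0" "\<And>s y. s \<in> {0..t} \<Longrightarrow> norm (\<theta> s y) \<le> B0"
    using decay_bounded[OF decays_bound[OF decays_\<theta>[of 0]] b0(1)] by metis
  have "continuous_on {0..t} (\<lambda>s. heat (t - s) (\<theta> s) x)"
    by (rule continuous_on_heat_path[OF continuous_on_subset[OF cont_\<theta>], where B = B0]) (use B0 in auto)
  moreover have "set_integrable lborel {0<..<t} (\<lambda>s. - heat (t - s) (flux_div s) x)"
    unfolding set_integrable_def scaleR_minus_right
    by (rule Bochner_Integration.integrable_minus[OF int[unfolded set_integrable_def]])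
  ultimately have "(LBINT s:{0<..<t}. - heat (t - s) (flux_div s) x) = heat (t - t) (\<theta> t) x - heat (t - 0) (\<theta> 0) x"
    using temperature_path_derivative by (intro set_lborel_integral_derivative[OF t])
  moreover have "(LBINT s:{0<..<t}. - heat (t - s) (flux_div s) x) = - (LBINT s:{0<..<t}. heat (t - s) (flux_div s) x)"
    by (simp add: set_lebesgue_integral_def)
  ultimately show "\<theta> t x = heat t (\<theta> 0) x - (LBINT s:{0<..<t}. heat (t - s) (flux_div s) x)"
    by (simp add: heat_def)
qed

text \<open>The heat flow of \<open>u\<close> alone produces the integral of the projected buoyancy \<open>\<theta> e3\<close>, which still
  involves the unknown temperature. Adding \<open>(t - s)\<close> times the heat flow of the projected buoyancy
  cancels exactly this term, so the sum \<open>\<Phi>\<close> has the two integrands of the formula as its derivative.\<close>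

lemma velocity_formula:
  assumes t: "0 \<le> t"
  shows "set_integrable lborel {0<..<t} (\<lambda>s. heat (t - s) (leray (convection s)) x)"
    and "set_integrable lborel {0<..<t} (\<lambda>s. (t - s) *\<^sub>R heat (t - s) (leray (\<lambda>y. flux_div s y *\<^sub>R e3)) x)"
    and "u t x = heat t (u 0) x + t *\<^sub>R heat t (leray (\<lambda>y. \<theta> 0 y *\<^sub>R e3)) x
       - (LBINT s:{0<..<t}. heat (t - s) (leray (convection s)) x)
       - (LBINT s:{0<..<t}. (t - s) *\<^sub>R heat (t - s) (leray (\<lambda>y. flux_div s y *\<^sub>R e3)) x)"
proof -
  let ?I = "{0<..<t}"
  have sub: "?I \<subseteq> {0..t}"
    by auto
  have C: "decays 4 rate {0..t} convection"
    by (rule decays_weaken[OF decays_convection rate(3)])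
  have D: "decays 4 rate {0..t} flux_div"
    by (rule decays_weaken[OF decays_flux_div]) (use rate(2) a in simp)
  have T: "decays 4 rate {0..t} \<theta>"
    by (rule decays_weaken[OF decays_\<theta> rate(2)])
  have lift: "decays 4 rate S (\<lambda>s y. h s y *\<^sub>R e3)" if "decays 4 rate S h" for h and S :: "real set"
    by (rule decays_linear[OF bounded_linear_scaleR_left that])
  have Cc: "continuous_on ?I (\<lambda>s. convection s y)" for y
    by (rule continuous_on_subset[OF convection_continuous_time]) auto
  have Dc: "continuous_on ?I (\<lambda>s. flux_div s y *\<^sub>R e3)" for y
    by (intro continuous_intros continuous_on_subset[OF continuous_on_slice_time[OF flux_div_continuous]]) auto
  have Tc: "continuous_on {0..t} (\<lambda>s. \<theta> s y *\<^sub>R e3)" for y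
    by (intro continuous_intros continuous_on_subset[OF continuous_on_slice_time[OF cont_\<theta>]]) auto
  note P1 = heat_leray_path[OF rate(1) decays_subset[OF C sub] _ Cc, of t x]
  note P2 = heat_leray_path[OF rate(1) decays_subset[OF lift[OF D] sub] _ Dc, of t x]
  note P3 = heat_leray_path[OF rate(1) lift[OF T] _ Tc, of t x]
  obtain B1 where B1: "\<And>s. s \<in> ?I \<Longrightarrow> norm (heat (t - s) (leray (convection s)) x) \<le> B1"
    using P1(2) by force
  obtain B2 where B2: "\<And>s. s \<in> ?I \<Longrightarrow> norm (heat (t - s) (leray (\<lambda>y. flux_div s y *\<^sub>R e3)) x) \<le> B2"
    using P2(2) by force
  show int1: "set_integrable lborel ?I (\<lambda>s. heat (t - s) (leray (convection s)) x)"
    by (rule set_integrable_bounded_open[OF P1(1) B1]) auto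
  show int2: "set_integrable lborel ?I (\<lambda>s. (t - s) *\<^sub>R heat (t - s) (leray (\<lambda>y. flux_div s y *\<^sub>R e3)) x)"
  proof (rule set_integrable_bounded_open)
    show "continuous_on ?I (\<lambda>s. (t - s) *\<^sub>R heat (t - s) (leray (\<lambda>y. flux_div s y *\<^sub>R e3)) x)"
      by (intro continuous_intros P2(1)) auto
    show "norm ((t - s) *\<^sub>R heat (t - s) (leray (\<lambda>y. flux_div s y *\<^sub>R e3)) x) \<le> t * B2" if "s \<in> ?I" for s
      using B2[OF that] that by (auto intro!: mult_mono)
  qed
  define \<Phi> where "\<Phi> s = heat (t - s) (u s) x + (t - s) *\<^sub>R heat (t - s) (leray (\<lambda>y. \<theta> s y *\<^sub>R e3)) x" for s
  define \<phi> where "\<phi> s = - heat (t - s) (leray (convection s)) x - (t - s) *\<^sub>R heat (t - s) (leray (\<lambda>y. flux_div s y *\<^sub>R e3)) x" for s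
  have "(LBINT s:?I. \<phi> s) = \<Phi> t - \<Phi> 0"
  proof (rule set_lborel_integral_derivative[OF t])
    obtain B0 where B0: "0 \<le> B0" "\<And>s y. s \<in> {0..t} \<Longrightarrow> norm (u s y) \<le> B0"
    proof -
      have "0 \<le> a"
        using a by simp
      then show ?thesis
        using that decay_bounded[OF decays_bound[OF decays_u[of 0]]] by metis
    qed
    have "continuous_on {0..t} (\<lambda>s. heat (t - s) (u s) x)"
      by (rule continuous_on_heat_path[OF continuous_on_subset[OF cont_u], where B = B0]) (use B0 in auto)
    then show "continuous_on {0..t} \<Phi>"
      unfolding \<Phi>_def by (intro continuous_intros P3(1)) auto
    show "set_integrable lborel ?I \<phi>"
    proof -
      have "set_integrable lborel ?I (\<lambda>s. - heat (t - s) (leray (convection s)) x)"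
        unfolding set_integrable_def scaleR_minus_right
        by (rule Bochner_Integration.integrable_minus[OF int1[unfolded set_integrable_def]])
      then show ?thesis
        unfolding \<phi>_def using int2 by (rule set_integral_diff(1))
    qed
    show "(\<Phi> has_vector_derivative \<phi> s) (at s)" if s: "s \<in> ?I" for s
    proof -
      have s0: "0 < s" "0 \<le> t - s" "s \<in> {0..t}"
        using s by auto
      have der: "((\<lambda>s. \<theta> s y) has_real_derivative laplacian (\<theta> s) y - flux_div s y) (at s)" if "s \<in> ?I" for s y
        using spacetime_time_deriv(1)[OF smooth_\<theta>, of s y] that
        by (simp add: has_real_derivative_iff_has_vector_derivative temperature_equation)
      have split: "heat (t - s) (leray (forcing s)) x =
          heat (t - s) (leray (\<lambda>y. \<theta> s y *\<^sub>R e3)) x - heat (t - s) (leray (convection s)) x"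
      proof -
        obtain A1 where A1: "\<And>y. norm (leray (\<lambda>y. \<theta> s y *\<^sub>R e3) y) \<le> A1"
          using leray_bounded[OF rate(1) lift[OF T]] s0(3) by metis
        obtain A2 where A2: "\<And>y. norm (leray (convection s) y) \<le> A2"
          using leray_bounded[OF rate(1) C] s0(3) by metis
        have "leray (forcing s) = (\<lambda>y. leray (\<lambda>y. \<theta> s y *\<^sub>R e3) y - leray (convection s) y)"
          using leray_forcing_split s0 by (auto simp: fun_eq_iff)
        then show ?thesis
          using heat_diff[OF s0(2) borel_measurable_continuous_onI borel_measurable_continuous_onI A1 A2]
            leray_continuous[OF leray_hat_integrable[OF rate(1) lift[OF T] s0(3)]]
            leray_continuous[OF leray_hat_integrable[OF rate(1) C s0(3)]] by simp
      qed
      have "(\<Phi> has_vector_derivative heat (t - s) (leray (forcing s)) x +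
          (- heat (t - s) (leray (\<lambda>y. \<theta> s y *\<^sub>R e3)) x - (t - s) *\<^sub>R heat (t - s) (leray (\<lambda>y. flux_div s y *\<^sub>R e3)) x)) (at s)"
        unfolding \<Phi>_def
        by (intro has_vector_derivative_add velocity_path_derivative s
          heat_leray_duhamel_derivative[OF rate(1) decays_subset[OF T sub] decays_subset[OF D sub] der s])
      then show ?thesis
        by (simp add: \<phi>_def split)
    qed
  qed
  moreover have "(LBINT s:?I. \<phi> s) = - (LBINT s:?I. heat (t - s) (leray (convection s)) x)
       - (LBINT s:?I. (t - s) *\<^sub>R heat (t - s) (leray (\<lambda>y. flux_div s y *\<^sub>R e3)) x)"
  proof -
    have "set_integrable lborel ?I (\<lambda>s. - heat (t - s) (leray (convection s)) x)"
      unfolding set_integrable_def scaleR_minus_right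
      by (rule Bochner_Integration.integrable_minus[OF int1[unfolded set_integrable_def]])
    from set_integral_diff(2)[OF this int2] show ?thesis
      by (simp add: \<phi>_def set_lebesgue_integral_def)
  qed
  moreover have "\<Phi> t = u t x" "\<Phi> 0 = heat t (u 0) x + t *\<^sub>R heat t (leray (\<lambda>y. \<theta> 0 y *\<^sub>R e3)) x"
    by (simp_all add: \<Phi>_def heat_def)
  ultimately show "u t x = heat t (u 0) x + t *\<^sub>R heat t (leray (\<lambda>y. \<theta> 0 y *\<^sub>R e3)) x
       - (LBINT s:{0<..<t}. heat (t - s) (leray (convection s)) x)
       - (LBINT s:{0<..<t}. (t - s) *\<^sub>R heat (t - s) (leray (\<lambda>y. flux_div s y *\<^sub>R e3)) x)"
    by (simp add: algebra_simps)
qed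

end

theorem lemma3p5:
  fixes u :: "real \<Rightarrow> real^3 \<Rightarrow> real^3"
    and \<theta> p :: "real \<Rightarrow> real^3 \<Rightarrow> real"
    and u0 :: "real^3 \<Rightarrow> real^3"
    and \<theta>0 :: "real^3 \<Rightarrow> real"
    and t :: real and x :: "real^3"
  assumes "smooth_boussinesq_solution u \<theta> p"
    and "sufficient_decay u \<theta> p"
    and "\<And>y. u 0 y = u0 y"
    and "\<And>y. \<theta> 0 y = \<theta>0 y"
    and "\<And>y. divergence u0 y = 0"
    and "0 \<le> t"
  shows
    "set_integrable lborel {0<..<t}
       (\<lambda>s. heat (t - s) (leray (tensor_div (\<lambda>y. tensor (u s y) (u s y)))) x) \<and>
     set_integrable lborel {0<..<t}
       (\<lambda>s. (t - s) *\<^sub>R heat (t - s) (leray (tensor_div (\<lambda>y. tensor (\<theta> s y *\<^sub>R e3) (u s y)))) x) \<and>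
     set_integrable lborel {0<..<t}
       (\<lambda>s. heat (t - s) (divergence (\<lambda>y. \<theta> s y *\<^sub>R u s y)) x) \<and>
     u t x =
       heat t u0 x + t *\<^sub>R heat t (leray (\<lambda>y. \<theta>0 y *\<^sub>R e3)) x
       - (LBINT s:{0<..<t}.
            heat (t - s) (leray (tensor_div (\<lambda>y. tensor (u s y) (u s y)))) x)
       - (LBINT s:{0<..<t}.
            (t - s) *\<^sub>R heat (t - s) (leray (tensor_div (\<lambda>y. tensor (\<theta> s y *\<^sub>R e3) (u s y)))) x) \<and>
     \<theta> t x =
       heat t \<theta>0 x
       - (LBINT s:{0<..<t}. heat (t - s) (divergence (\<lambda>y. \<theta> s y *\<^sub>R u s y)) x)"
proof -
  obtain a b where ab: "3/2 < a" "spatial_decay a u" "3 < b" "spatial_decay b \<theta>"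
    and "\<And>t. 0 < t \<Longrightarrow> (grad (p t) \<longlongrightarrow> 0) at_infinity"
    using assms(2) unfolding sufficient_decay_def by blast
  then interpret decaying_boussinesq u \<theta> p a b
    using assms(1) by unfold_locales
  have init: "u0 = u 0" "\<theta>0 = \<theta> 0"
    using assms(3,4) by (auto simp: fun_eq_iff)
  have buoyancy: "tensor_div (\<lambda>y. tensor (\<theta> s y *\<^sub>R e3) (u s y)) = (\<lambda>y. flux_div s y *\<^sub>R e3)" for s
    by (simp add: fun_eq_iff tensor_div_buoyancy)
  show ?thesis
    unfolding buoyancy init convection_def[symmetric] flux_div_def[symmetric]
    using velocity_formula[OF assms(6), of x] temperature_formula[OF assms(6), of x] by blast
qed

end
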